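(* Let $\mathbb F$ be an algebraically closed field of characteristic zero, $\mathfrak g=\mathfrak{gl}(\mathbb V)$ with $\dim\mathbb V\ge 3$ (finite), and let $e\in\mathfrak g$ be a nilpotent element. Then $$\mathrm{codim}\,(\mathfrak g_e^* )_{\rm sing}\ge 3,$$ where the codimension is taken in $\mathfrak g_e^*$.
   Context: $\mathfrak g_e$ is the centraliser of $e$ in $\mathfrak g$. For a finite-dimensional Lie algebra $\mathfrak q$ and $\gamma\in\mathfrak q^*$, let $\mathfrak q_\gamma=\{x\in\mathfrak q\mid \gamma([x,\mathfrak q])=0\}$ be the stabiliser under the coadjoint action, $\mathrm{ind}\,\mathfrak q=\min_{\gamma\in\mathfrak q^*}\dim\mathfrak q_\gamma$, and $\mathfrak q^*_{\rm sing}=\{\gamma\in\mathfrak q^*\mid\dim\mathfrak q_\gamma>\mathrm{ind}\,\mathfrak q\}$, a Zariski closed subset. If $\mathfrak q^*_{\rm sing}$ is empty (e.g. $\mathfrak q$ abelian), the inequality is regarded as satisfied. *)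

theory Defs
  imports
    "HOL-Analysis.Abstract_Topology"
    "HOL-Library.Extended_Real"
    "HOL-Library.Function_Algebras"
    "HOL-Computational_Algebra.Polynomial"
begin

text \<open>
  Vector spaces are those of \<^theory>\<open>HOL.Vector_Spaces\<close>: a type with an explicit scalar
  multiplication. Functions into a vector space are added pointwise, by the instances of
  \<^theory>\<open>HOL-Library.Function_Algebras\<close>; the scalar multiplication is the following.
\<close>

definition fun_scale :: "('f \<Rightarrow> 'v \<Rightarrow> 'v) \<Rightarrow> 'f \<Rightarrow> ('b \<Rightarrow> 'v) \<Rightarrow> ('b \<Rightarrow> 'v)"
  where "fun_scale s c f = (\<lambda>x. s c (f x))"

lemma vector_space_fun_scale:
  assumes "vector_space s"
  shows "vector_space (fun_scale s)"
proof -
  interpret vector_space s by fact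
  show ?thesis
    by unfold_locales
      (simp_all add: fun_scale_def fun_eq_iff scale_right_distrib scale_left_distrib)
qed

text \<open>
  The dual of a subspace \<open>Q\<close>. As the functionals are HOL functions on the whole ambient type,
  they are made unique by the value \<open>0\<close> outside \<open>Q\<close>, so that \<open>dual s Q\<close> is itself a subspace
  of a function type, with scalar multiplication \<open>fun_scale (*)\<close>.
\<close>

definition dual :: "('f::field \<Rightarrow> 'b::ab_group_add \<Rightarrow> 'b) \<Rightarrow> 'b set \<Rightarrow> ('b \<Rightarrow> 'f) set"
  where "dual s Q =
    {\<gamma>. (\<forall>x\<in>Q. \<forall>y\<in>Q. \<gamma> (x + y) = \<gamma> x + \<gamma> y) \<and>
        (\<forall>c. \<forall>x\<in>Q. \<gamma> (s c x) = c * \<gamma> x) \<and>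
        (\<forall>x. x \<notin> Q \<longrightarrow> \<gamma> x = 0)}"


text \<open>
  A Lie algebra is given by a subspace \<open>Q\<close> of a vector space with scalar multiplication \<open>s\<close>,
  and a bracket \<open>br\<close> under which \<open>Q\<close> is closed.
\<close>

definition stabiliser ::
    "('b \<Rightarrow> 'b \<Rightarrow> 'b) \<Rightarrow> 'b set \<Rightarrow> ('b \<Rightarrow> 'f::field) \<Rightarrow> 'b set"
  where "stabiliser br Q \<gamma> = {x\<in>Q. \<forall>y\<in>Q. \<gamma> (br x y) = 0}"

definition lie_index ::
    "('f::field \<Rightarrow> 'b::ab_group_add \<Rightarrow> 'b) \<Rightarrow> ('b \<Rightarrow> 'b \<Rightarrow> 'b) \<Rightarrow> 'b set \<Rightarrow> nat"
  where "lie_index s br Q = (INF \<gamma>\<in>dual s Q. vector_space.dim s (stabiliser br Q \<gamma>))"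

definition dual_sing ::
    "('f::field \<Rightarrow> 'b::ab_group_add \<Rightarrow> 'b) \<Rightarrow> ('b \<Rightarrow> 'b \<Rightarrow> 'b) \<Rightarrow> 'b set \<Rightarrow> ('b \<Rightarrow> 'f) set"
  where "dual_sing s br Q =
    {\<gamma>\<in>dual s Q. vector_space.dim s (stabiliser br Q \<gamma>) > lie_index s br Q}"


text \<open>
  Polynomial functions on a finite-dimensional subspace \<open>W\<close>, without a choice of coordinates:
  the algebra generated by the constants and the linear functionals. Only their values on \<open>W\<close>
  matter.
\<close>

inductive_set poly_funs :: "('f::field \<Rightarrow> 'w::ab_group_add \<Rightarrow> 'w) \<Rightarrow> 'w set \<Rightarrow> ('w \<Rightarrow> 'f) set"
  for s :: "'f::field \<Rightarrow> 'w::ab_group_add \<Rightarrow> 'w" and W :: "'w set"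
  where
    const: "(\<lambda>_. c) \<in> poly_funs s W"
  | functional: "l \<in> dual s W \<Longrightarrow> l \<in> poly_funs s W"
  | add: "p \<in> poly_funs s W \<Longrightarrow> q \<in> poly_funs s W \<Longrightarrow> (\<lambda>w. p w + q w) \<in> poly_funs s W"
  | mult: "p \<in> poly_funs s W \<Longrightarrow> q \<in> poly_funs s W \<Longrightarrow> (\<lambda>w. p w * q w) \<in> poly_funs s W"

definition zero_locus :: "'w set \<Rightarrow> ('w \<Rightarrow> 'f::field) set \<Rightarrow> 'w set"
  where "zero_locus W P = {w\<in>W. \<forall>p\<in>P. p w = 0}"

definition zariski :: "('f::field \<Rightarrow> 'w::ab_group_add \<Rightarrow> 'w) \<Rightarrow> 'w set \<Rightarrow> 'w topology"
  where "zariski s W = topology (\<lambda>U. \<exists>P\<subseteq>poly_funs s W. U = W - zero_locus W P)"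

lemma istopology_zariski: "istopology (\<lambda>U. \<exists>P\<subseteq>poly_funs s W. U = W - zero_locus W P)"
  unfolding istopology_def
proof (intro conjI allI impI)
  fix S T
  assume "\<exists>P\<subseteq>poly_funs s W. S = W - zero_locus W P"
    and "\<exists>P\<subseteq>poly_funs s W. T = W - zero_locus W P"
  then obtain P P' where P: "P \<subseteq> poly_funs s W" "S = W - zero_locus W P"
    and P': "P' \<subseteq> poly_funs s W" "T = W - zero_locus W P'"
    by blast
  let ?R = "{(\<lambda>w. p w * q w) |p q. p \<in> P \<and> q \<in> P'}"
  have "?R \<subseteq> poly_funs s W"
    using P(1) P'(1) by (auto intro: poly_funs.mult)
  moreover have "S \<inter> T = W - zero_locus W ?R"
    unfolding P(2) P'(2) zero_locus_def by auto (metis mult_eq_0_iff)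
  ultimately show "\<exists>P\<subseteq>poly_funs s W. S \<inter> T = W - zero_locus W P"
    by blast
next
  fix K :: "'a set set"
  assume "\<forall>S\<in>K. \<exists>P\<subseteq>poly_funs s W. S = W - zero_locus W P"
  then obtain P where P: "\<And>S. S \<in> K \<Longrightarrow> P S \<subseteq> poly_funs s W \<and> S = W - zero_locus W (P S)"
    by metis
  have "(\<Union>S\<in>K. P S) \<subseteq> poly_funs s W"
    using P by blast
  moreover have "\<Union>K = (\<Union>S\<in>K. W - zero_locus W (P S))"
    using P by auto
  then have "\<Union>K = W - zero_locus W (\<Union>S\<in>K. P S)"
    by (auto simp: zero_locus_def)
  ultimately show "\<exists>P\<subseteq>poly_funs s W. \<Union>K = W - zero_locus W P"
    by blast
qed

lemma openin_zariski:
  "openin (zariski s W) U \<longleftrightarrow> (\<exists>P\<subseteq>poly_funs s W. U = W - zero_locus W P)"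
  unfolding zariski_def by (simp add: topology_inverse'[OF istopology_zariski])

lemma topspace_zariski [simp]: "topspace (zariski s W) = W"
proof
  show "topspace (zariski s W) \<subseteq> W"
    unfolding topspace_def openin_zariski by auto
  have "W = W - zero_locus W {\<lambda>_. 1}"
    by (auto simp: zero_locus_def)
  then have "openin (zariski s W) W"
    unfolding openin_zariski by (intro exI[of _ "{\<lambda>_. 1}"]) (auto intro: poly_funs.const)
  then show "W \<subseteq> topspace (zariski s W)"
    by (rule openin_subset)
qed

lemma closedin_zariski:
  "closedin (zariski s W) X \<longleftrightarrow> (\<exists>P\<subseteq>poly_funs s W. X = zero_locus W P)"
proof -
  have "zero_locus W P \<subseteq> W" for P :: "('a \<Rightarrow> 'b) set"
    by (auto simp: zero_locus_def)
  then show ?thesis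
    unfolding closedin_def topspace_zariski openin_zariski
    by (metis Diff_Diff_Int Int_absorb1 Diff_subset)
qed

definition irreducible_closedin :: "'w topology \<Rightarrow> 'w set \<Rightarrow> bool"
  where "irreducible_closedin T Z \<longleftrightarrow> closedin T Z \<and> Z \<noteq> {} \<and>
    (\<forall>A B. closedin T A \<and> closedin T B \<and> Z = A \<union> B \<longrightarrow> Z = A \<or> Z = B)"

text \<open>
  The supremum of the lengths \<open>n\<close> of chains \<open>C 0 \<subset> \<dots> \<subset> C n\<close> of irreducible closed subsets.
  The empty space has dimension \<open>-\<infinity>\<close>.
\<close>

definition krull_dim :: "'w topology \<Rightarrow> ereal"
  where "krull_dim T = Sup {ereal (real n) |n. \<exists>C.
    (\<forall>i\<le>n. irreducible_closedin T (C i)) \<and> (\<forall>i<n. C i \<subset> C (Suc i))}"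

text \<open>
  Codimension of \<open>X\<close> in the finite-dimensional vector space \<open>W\<close>. For empty \<open>X\<close> it is \<open>\<infinity>\<close>, so
  that every lower bound on the codimension of an empty set is satisfied.
\<close>

definition codim :: "('f::field \<Rightarrow> 'w::ab_group_add \<Rightarrow> 'w) \<Rightarrow> 'w set \<Rightarrow> 'w set \<Rightarrow> ereal"
  where "codim s W X =
    ereal (real (vector_space.dim s W)) - krull_dim (subtopology (zariski s W) X)"

lemma codim_empty: "codim s W {} = \<infinity>"
proof -
  have "\<not> irreducible_closedin (subtopology (zariski s W) {}) Z" for Z
    by (auto simp: irreducible_closedin_def dest: closedin_subset)
  then have "{ereal (real n) |n. \<exists>C.
      (\<forall>i\<le>n. irreducible_closedin (subtopology (zariski s W) {}) (C i)) \<and>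
      (\<forall>i<n. C i \<subset> C (Suc i))} = {}"
    by auto
  then have "krull_dim (subtopology (zariski s W) {}) = -\<infinity>"
    unfolding krull_dim_def by (simp only: Sup_empty bot_ereal_def)
  then show ?thesis
    by (simp add: codim_def)
qed


definition gl :: "('f::field \<Rightarrow> 'v::ab_group_add \<Rightarrow> 'v) \<Rightarrow> ('v \<Rightarrow> 'v) set"
  where "gl s = {x. Vector_Spaces.linear s s x}"

definition commutator :: "('v \<Rightarrow> 'v) \<Rightarrow> ('v \<Rightarrow> 'v) \<Rightarrow> ('v \<Rightarrow> 'v::ab_group_add)"
  where "commutator x y = (x \<circ> y) - (y \<circ> x)"

text \<open>
  Iterated composition is \<open>e ^^ k\<close>; on a function type \<open>e ^ k\<close> would be a pointwise power.
\<close>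

definition nilpotent_endo :: "('v \<Rightarrow> 'v::zero) \<Rightarrow> bool"
  where "nilpotent_endo e \<longleftrightarrow> (\<exists>k. e ^^ k = (\<lambda>_. 0))"

definition centraliser :: "('f::field \<Rightarrow> 'v::ab_group_add \<Rightarrow> 'v) \<Rightarrow> ('v \<Rightarrow> 'v) \<Rightarrow> ('v \<Rightarrow> 'v) set"
  where "centraliser s e = {x\<in>gl s. commutator x e = 0}"

lemma mem_gl_iff:
  assumes "vector_space s"
  shows "x \<in> gl s \<longleftrightarrow> (\<forall>u v. x (u + v) = x u + x v) \<and> (\<forall>c v. x (s c v) = s c (x v))"
proof -
  have "module s"
    using assms by (simp add: module_iff_vector_space)
  with assms show ?thesis
    by (simp add: gl_def Vector_Spaces.linear_def module_hom_iff)
qed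

lemma mem_centraliser_iff:
  assumes "vector_space s"
  shows "x \<in> centraliser s e \<longleftrightarrow>
    (\<forall>u v. x (u + v) = x u + x v) \<and> (\<forall>c v. x (s c v) = s c (x v)) \<and> (\<forall>v. x (e v) = e (x v))"
  by (auto simp: centraliser_def mem_gl_iff[OF assms] commutator_def fun_eq_iff)

lemma subspace_centraliser:
  assumes "vector_space s" and "e \<in> gl s"
  shows "module.subspace (fun_scale s) (centraliser s e)"
proof -
  interpret V: vector_space s by fact
  interpret E: vector_space "fun_scale s"
    by (rule vector_space_fun_scale) fact
  have e: "e (u + v) = e u + e v" "e (s c v) = s c (e v)" for u v c
    using assms(2) by (auto simp: mem_gl_iff[OF assms(1)])
  have "e 0 = 0"
    using e(1)[of 0 0] by simp
  then show ?thesis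
    unfolding E.subspace_def
    by (auto simp: mem_centraliser_iff[OF assms(1)] fun_scale_def e V.scale_right_distrib
        mult.commute add_ac)
qed

lemma commutator_mem_centraliser:
  assumes "vector_space s" and "e \<in> gl s" and "x \<in> centraliser s e" and "y \<in> centraliser s e"
  shows "commutator x y \<in> centraliser s e"
proof -
  interpret V: vector_space s by fact
  have "e (u + v) = e u + e v" for u v
    using assms(2) by (auto simp: mem_gl_iff[OF assms(1)])
  then have e: "e (u - v) = e u - e v" for u v
    by (metis add_diff_cancel diff_add_cancel)
  show ?thesis
    using assms(3,4)
    by (auto simp: mem_centraliser_iff[OF assms(1)] commutator_def e V.scale_right_diff_distrib)
qed

end

theory Submission
  imports Defs "Jordan_Normal_Form.Determinant"
begin

text \<open>Geometrically, a closed cone that meets a three-dimensional linear space only in 0 has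
  codimension at least 3. The minors make this effective: together they force x = y = z = 0 on that
  space. A principal minor does not vanish at a regular functional if the basis elements it keeps
  span a complement of the stabiliser. The deleted ones therefore depend on the functional: those
  mapping a block to itself for the diagonal weights, those starting in the first, longest block for
  the subdiagonal weights, and those ending in it for the superdiagonal weights. For the first of
  these sets the grading does not separate x from the rest, because y times z has degree 0, like a
  square of x. Hence x to the power r is obtained only modulo (y, z), and y and z are eliminated
  afterwards. Finiteness over the linear forms is expressed as follows: all monomials of one degree
  lie in the ideal of these forms. Both halves of the dimension estimate then become counts of
  linearly independent functions.\<close>

text \<open>
  Let \<open>n = dim V\<close> and let \<open>r = dim \<gg>\<^sub>e - n\<close>. By Vinberg's inequality all stabilisers have dimension at
  least \<open>n\<close>, so at a singular functional every \<open>r \<times> r\<close> minor of the matrix of the form \<open>\<gamma>([x, y])\<close>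
  vanishes. In a Jordan basis, the functionals with diagonal, subdiagonal and superdiagonal weights
  on the top coefficients span a three-dimensional space with coordinates \<open>x, y, z\<close>, on which three
  principal minors restrict, up to nonzero scalars, to \<open>x\<^sup>r\<close> modulo \<open>(y, z)\<close>, to \<open>y\<^sup>r\<close> and to \<open>z\<^sup>r\<close>; the
  last two because of the grading by the difference of the block numbers. Since the singular set is a
  cone, its coordinate ring is therefore finite over the polynomials in the \<open>dim \<gg>\<^sub>e - 3\<close> linear forms
  that vanish on that space, so the polynomial functions of degree at most \<open>m\<close> on it span a space of
  dimension \<open>O(m\<^bsup>dim \<gg>\<^sub>e - 3\<^esup>)\<close>. A chain of irreducible closed subsets of length \<open>l\<close> would make this grow
  at least like \<open>m\<^bsup>l\<^esup>\<close>.
\<close>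

section \<open>Determinants and linear dependence\<close>

lemma det_mat_leibniz:
  "det (mat r r (\<lambda>(i, j). M i j)) =
    (\<Sum>\<pi> | \<pi> permutes {0..<r}. of_int (sign \<pi>) * (\<Prod>i=0..<r. M i (\<pi> i)))"
  for M :: "nat \<Rightarrow> nat \<Rightarrow> 'a::comm_ring_1"
proof -
  have "(\<Prod>i=0..<r. mat r r (\<lambda>(i, j). M i j) $$ (i, \<pi> i)) = (\<Prod>i=0..<r. M i (\<pi> i))"
    if "\<pi> permutes {0..<r}" for \<pi>
    using that by (intro prod.cong) (auto dest: permutes_in_image)
  then show ?thesis
    by (subst det_def'[of _ r]) (auto intro!: sum.cong)
qed

lemma det_mat_eq_0_iff:
  fixes M :: "nat \<Rightarrow> nat \<Rightarrow> 'a::field"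
  shows "det (mat r r (\<lambda>(i, j). M i j)) = 0 \<longleftrightarrow>
    (\<exists>c. (\<exists>i<r. c i \<noteq> 0) \<and> (\<forall>i<r. (\<Sum>j<r. M i j * c j) = 0))"
proof -
  let ?A = "mat r r (\<lambda>(i, j). M i j)"
  have A: "?A \<in> carrier_mat r r"
    by simp
  have mult: "(?A *\<^sub>v v) $ i = (\<Sum>j<r. M i j * v $ j)" if "v \<in> carrier_vec r" "i < r" for v i
    using that by (auto simp: scalar_prod_def lessThan_atLeast0 intro!: sum.cong)
  show ?thesis
    unfolding det_0_iff_vec_prod_zero_field[OF A]
  proof
    assume "\<exists>v. v \<in> carrier_vec r \<and> v \<noteq> 0\<^sub>v r \<and> ?A *\<^sub>v v = 0\<^sub>v r"
    then obtain v where v: "v \<in> carrier_vec r" "v \<noteq> 0\<^sub>v r" "?A *\<^sub>v v = 0\<^sub>v r"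
      by blast
    have "\<exists>i<r. v $ i \<noteq> 0"
      using v(1,2) by (metis carrier_vecD dim_vec eq_vecI index_zero_vec(1) index_zero_vec(2))
    moreover have "(\<Sum>j<r. M i j * v $ j) = 0" if "i < r" for i
      using mult[OF v(1) that] v(3) that by simp
    ultimately show "\<exists>c. (\<exists>i<r. c i \<noteq> 0) \<and> (\<forall>i<r. (\<Sum>j<r. M i j * c j) = 0)"
      by (intro exI[of _ "\<lambda>i. v $ i"]) auto
  next
    assume "\<exists>c. (\<exists>i<r. c i \<noteq> 0) \<and> (\<forall>i<r. (\<Sum>j<r. M i j * c j) = 0)"
    then obtain c where c: "\<exists>i<r. c i \<noteq> 0" "\<forall>i<r. (\<Sum>j<r. M i j * c j) = 0"
      by blast
    let ?v = "vec r c"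
    have "?A *\<^sub>v ?v = 0\<^sub>v r"
      using c(2) by (intro eq_vecI) (auto simp del: index_mult_mat_vec simp: mult)
    moreover have "?v \<noteq> 0\<^sub>v r"
      using c(1) by (metis index_vec index_zero_vec(1))
    ultimately show "\<exists>v. v \<in> carrier_vec r \<and> v \<noteq> 0\<^sub>v r \<and> ?A *\<^sub>v v = 0\<^sub>v r"
      by (intro exI[of _ ?v]) auto
  qed
qed

lemma poly_det_mat:
  "poly (det (mat r r (\<lambda>(i, j). P i j))) t = det (mat r r (\<lambda>(i, j). poly (P i j) t))"
  for P :: "nat \<Rightarrow> nat \<Rightarrow> 'a::comm_ring_1 poly"
  by (simp add: det_mat_leibniz poly_sum poly_prod)

context vector_space
begin

text \<open>A family, unlike a set, may repeat a vector, and the repetition is then itself a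
  dependence.\<close>

lemma family_dependent:
  assumes "finite Z" and "\<And>i. i < m \<Longrightarrow> f i \<in> span Z" and "card Z < m"
  shows "\<exists>c. (\<exists>i<m. c i \<noteq> 0) \<and> (\<Sum>i<m. scale (c i) (f i)) = 0"
proof (cases "inj_on f {..<m}")
  case True
  have "\<not> independent (f ` {..<m})"
    using independent_span_bound[OF assms(1), of "f ` {..<m}"] assms(2,3) True
    by (auto simp: card_image)
  then obtain u where u: "\<exists>v\<in>f ` {..<m}. u v \<noteq> 0" "(\<Sum>v\<in>f ` {..<m}. scale (u v) v) = 0"
    using dependent_finite[of "f ` {..<m}"] by auto
  show ?thesis
    using u True by (intro exI[of _ "u \<circ> f"]) (auto simp: sum.reindex)
next
  case False
  then obtain i j where ij: "i < m" "j < m" "i \<noteq> j" "f i = f j"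
    by (auto simp: inj_on_def)
  let ?c = "\<lambda>l. if l = i then 1 else if l = j then -1 else 0"
  have "(\<Sum>l<m. scale (?c l) (f l)) = (\<Sum>l\<in>{i, j}. scale (?c l) (f l))"
    using ij by (intro sum.mono_neutral_right) auto
  also have "\<dots> = 0"
    using ij by simp
  finally show ?thesis
    using ij by (intro exI[of _ ?c]) auto
qed

lemma independent_family:
  fixes f :: "nat \<Rightarrow> 'b"
  assumes "independent (f ` {..<m})" and "inj_on f {..<m}"
    and "(\<Sum>i<m. scale (c i) (f i)) = 0" and "i < m"
  shows "c i = 0"
proof -
  let ?u = "\<lambda>v. c (the_inv_into {..<m} f v)"
  have "(\<Sum>v\<in>f ` {..<m}. scale (?u v) v) = 0"
    using assms(2,3) by (simp add: sum.reindex the_inv_into_f_f)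
  then have "?u (f i) = 0"
    using assms(4) by (intro independentD[OF assms(1) _ subset_refl, of ?u]) simp_all
  then show ?thesis
    using assms(2,4) by (simp add: the_inv_into_f_f)
qed

end

section \<open>Homogeneous parts of an algebra of functions\<close>

interpretation FS: vector_space "fun_scale ((*) :: 'f::field \<Rightarrow> 'f \<Rightarrow> 'f)"
  by (rule vector_space_fun_scale) (unfold_locales, simp_all add: algebra_simps)

lemma fun_scale_mult_left: "fun_scale (*) c f * g = fun_scale (*) c (f * g)"
  and fun_scale_mult_right: "f * fun_scale (*) c g = fun_scale (*) c (f * g)"
  for f g :: "'w \<Rightarrow> 'f::field"
  by (simp_all add: fun_scale_def fun_eq_iff)

lemma prod_fun_apply: "(\<Prod>i\<in>I. f i) w = (\<Prod>i\<in>I. f i w)"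
  for f :: "'i \<Rightarrow> 'w \<Rightarrow> 'f::comm_ring_1"
  by (induction I rule: infinite_finite_induct) auto

lemma sum_fun_apply: "(\<Sum>i\<in>I. f i) w = (\<Sum>i\<in>I. f i w)"
  for f :: "'i \<Rightarrow> 'w \<Rightarrow> 'f::comm_monoid_add"
  by (induction I rule: infinite_finite_induct) auto

lemma power_fun_apply: "(f ^ n) w = f w ^ n"
  for f :: "'w \<Rightarrow> 'f::comm_ring_1"
  by (induction n) auto

lemma span_mult_mem:
  fixes f g :: "'w \<Rightarrow> 'f::field"
  assumes "f \<in> FS.span A" and "g \<in> FS.span B"
    and "\<And>a b. a \<in> A \<Longrightarrow> b \<in> B \<Longrightarrow> a * b \<in> FS.span D"
  shows "f * g \<in> FS.span D"
proof -
  have "a * g \<in> FS.span D" if "a \<in> A" for a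
    using assms(2)
  proof (induction rule: FS.span_induct_alt)
    case base
    show ?case unfolding mult_zero_left mult_zero_right by (rule FS.span_zero)
  next
    case (step c x y)
    then show ?case
      using assms(3)[OF that]
      by (simp only: distrib_left fun_scale_mult_right FS.span_add FS.span_scale)
  qed
  with assms(1) show ?thesis
  proof (induction rule: FS.span_induct_alt)
    case base
    show ?case unfolding mult_zero_left mult_zero_right by (rule FS.span_zero)
  next
    case (step c x y)
    then show ?case
      by (simp only: distrib_right fun_scale_mult_left FS.span_add FS.span_scale)
  qed
qed

text \<open>The generators will be functions, so products of different lengths may coincide and
  there is no true grading. The degree is carried by the index \<open>m\<close>, and what follows
  concerns spans of products of that length.\<close>

primrec monomials :: "'a::comm_monoid_mult set \<Rightarrow> nat \<Rightarrow> 'a set" where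
  "monomials G 0 = {1}"
| "monomials G (Suc m) = {g * \<mu> |g \<mu>. g \<in> G \<and> \<mu> \<in> monomials G m}"

lemma monomials_1: "monomials G 1 = G"
  by auto

lemma finite_monomials: "finite G \<Longrightarrow> finite (monomials G m)"
proof (induction m)
  case (Suc m)
  have "monomials G (Suc m) = (\<lambda>(g, \<mu>). g * \<mu>) ` (G \<times> monomials G m)"
    by auto
  then show ?case
    using Suc by simp
qed simp

lemma monomials_add: "monomials G (a + b) = {\<mu> * \<nu> |\<mu> \<nu>. \<mu> \<in> monomials G a \<and> \<nu> \<in> monomials G b}"
proof (induction a)
  case (Suc a)
  show ?case
    by (auto simp: Suc) (metis mult.assoc)+
qed auto

lemma monomials_mono: "A \<subseteq> G \<Longrightarrow> monomials A m \<subseteq> monomials G m"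
  by (induction m) auto

lemma power_in_monomials: "g \<in> G \<Longrightarrow> g ^ m \<in> monomials G m"
  by (induction m) auto

lemma monomials_insert:
  "monomials (insert g A) m \<subseteq> {g ^ i * \<nu> |i \<nu>. i \<le> m \<and> \<nu> \<in> monomials A (m - i)}"
proof (induction m)
  case (Suc m)
  show ?case
  proof
    fix \<mu> assume "\<mu> \<in> monomials (insert g A) (Suc m)"
    then obtain h \<mu>' where h: "\<mu> = h * \<mu>'" "h = g \<or> h \<in> A" "\<mu>' \<in> monomials (insert g A) m"
      by auto
    then obtain i \<nu> where i: "\<mu>' = g ^ i * \<nu>" "i \<le> m" "\<nu> \<in> monomials A (m - i)"
      using Suc by blast
    show "\<mu> \<in> {g ^ i * \<nu> |i \<nu>. i \<le> Suc m \<and> \<nu> \<in> monomials A (Suc m - i)}"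
    proof (cases "h = g")
      case True
      then have "\<mu> = g ^ Suc i * \<nu>"
        using h i by (simp add: mult_ac)
      then show ?thesis
        using i by (intro CollectI exI[of _ "Suc i"] exI[of _ \<nu>]) auto
    next
      case False
      then have "h \<in> A" "Suc m - i = Suc (m - i)"
        using h i by auto
      then have "h * \<nu> \<in> monomials A (Suc m - i)"
        using i(3) by auto
      moreover have "\<mu> = g ^ i * (h * \<nu>)"
        unfolding h(1) i(1) by (rule mult.left_commute)
      ultimately show ?thesis
        using i by (intro CollectI exI[of _ i] exI[of _ "h * \<nu>"]) auto
    qed
  qed
qed simp

lemmas sum_recursion = sum.infinite sum.empty sum.insert not_False_eq_True

text \<open>
  The part of degree \<open>m\<close> of the ideal generated by \<open>T\<close> in the algebra generated by \<open>G\<close>. It is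
  \<open>{0}\<close> for \<open>m = 0\<close>.
\<close>

definition ideal_part :: "('w \<Rightarrow> 'f::field) set \<Rightarrow> ('w \<Rightarrow> 'f) set \<Rightarrow> nat \<Rightarrow> ('w \<Rightarrow> 'f) set" where
  "ideal_part T G m = FS.span {\<tau> * \<mu> |\<tau> \<mu> l. \<tau> \<in> T \<and> m = Suc l \<and> \<mu> \<in> monomials G l}"

lemma subspace_ideal_part: "FS.subspace (ideal_part T G m)"
  unfolding ideal_part_def by (rule FS.subspace_span)

lemma ideal_part_mono: "T \<subseteq> T' \<Longrightarrow> ideal_part T G m \<subseteq> ideal_part T' G m"
  unfolding ideal_part_def by (intro FS.span_mono) blast

lemma span_monomials_mult:
  fixes f g :: "'w \<Rightarrow> 'f::field"
  assumes "f \<in> FS.span (monomials G a)" and "g \<in> FS.span (monomials G b)"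
  shows "f * g \<in> FS.span (monomials G (a + b))"
  by (rule span_mult_mem[OF assms]) (auto simp: monomials_add intro!: FS.span_base)

lemma span_monomials_power:
  fixes f :: "'w \<Rightarrow> 'f::field"
  assumes "f \<in> FS.span (monomials G a)"
  shows "f ^ b \<in> FS.span (monomials G (a * b))"
proof (induction b)
  case (Suc b)
  show ?case
    using span_monomials_mult[OF assms Suc] by (simp only: power_Suc mult_Suc_right)
qed (simp only: power_0 mult_0_right monomials.simps FS.span_base singletonI)

lemma ideal_part_mult:
  fixes f g :: "'w \<Rightarrow> 'f::field"
  assumes "f \<in> ideal_part T G a" and "g \<in> FS.span (monomials G b)"
  shows "f * g \<in> ideal_part T G (a + b)"
  unfolding ideal_part_def
proof (rule span_mult_mem[OF assms[unfolded ideal_part_def]])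
  fix x \<nu> assume "x \<in> {\<tau> * \<mu> |\<tau> \<mu> l. \<tau> \<in> T \<and> a = Suc l \<and> \<mu> \<in> monomials G l}"
    and \<nu>: "\<nu> \<in> monomials G b"
  then obtain \<tau> \<mu> l where x: "x = \<tau> * \<mu>" "\<tau> \<in> T" "a = Suc l" "\<mu> \<in> monomials G l"
    by blast
  then have "x * \<nu> = \<tau> * (\<mu> * \<nu>)" "\<mu> * \<nu> \<in> monomials G (l + b)"
    using \<nu> monomials_add[of G l b] by (blast intro: mult.assoc)+
  then have "\<exists>\<tau> \<mu>. x * \<nu> = \<tau> * \<mu> \<and> \<tau> \<in> T \<and> \<mu> \<in> monomials G (l + b)"
    using x(2) by blast
  then show "x * \<nu> \<in> FS.span {\<tau> * \<mu> |\<tau> \<mu> l. \<tau> \<in> T \<and> a + b = Suc l \<and> \<mu> \<in> monomials G l}"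
    using x by (intro FS.span_base) auto
qed

lemma ideal_part_mult':
  fixes f g :: "'w \<Rightarrow> 'f::field"
  assumes "f \<in> FS.span (monomials G a)" and "g \<in> ideal_part T G b"
  shows "f * g \<in> ideal_part T G (a + b)"
  using ideal_part_mult[OF assms(2,1)] by (simp add: mult.commute add.commute)

lemma ideal_part_generator:
  fixes f g :: "'w \<Rightarrow> 'f::field"
  assumes "f \<in> FS.span T" and "g \<in> FS.span (monomials G m)"
  shows "f * g \<in> ideal_part T G (Suc m)"
  unfolding ideal_part_def
  by (rule span_mult_mem[OF assms]) (auto intro!: FS.span_base)

lemma ideal_part_subset:
  assumes "T \<subseteq> G"
  shows "ideal_part T G m \<subseteq> FS.span (monomials G m)"
  unfolding ideal_part_def
proof (intro FS.span_mono subsetI)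
  fix x assume "x \<in> {\<tau> * \<mu> |\<tau> \<mu> l. \<tau> \<in> T \<and> m = Suc l \<and> \<mu> \<in> monomials G l}"
  then obtain \<tau> \<mu> l where "x = \<tau> * \<mu>" "\<tau> \<in> T" "m = Suc l" "\<mu> \<in> monomials G l"
    by blast
  then show "x \<in> monomials G m"
    using assms by auto
qed

lemma ideal_part_add:
  "f \<in> ideal_part T G m \<Longrightarrow> g \<in> ideal_part T G m \<Longrightarrow> f + g \<in> ideal_part T G m"
  using subspace_ideal_part FS.subspace_add by blast

text \<open>Telescoping: exchanging one factor changes the product by an element of the span of
  \<open>T\<close> times \<open>r - 1\<close> elements of the span of \<open>G\<close>, so every
  error term has degree exactly \<open>r\<close>.\<close>

lemma prod_diff_in_ideal_part:
  fixes f h :: "nat \<Rightarrow> 'w \<Rightarrow> 'f::field"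
  assumes "T \<subseteq> G" and "\<And>i. i < r \<Longrightarrow> h i \<in> FS.span G" and "\<And>i. i < r \<Longrightarrow> f i - h i \<in> FS.span T"
  shows "(\<Prod>i<r. f i) - (\<Prod>i<r. h i) \<in> ideal_part T G r"
  using assms(2,3)
proof (induction r)
  case 0
  show ?case
    unfolding lessThan_0 prod.empty diff_self by (rule FS.subspace_0[OF subspace_ideal_part])
next
  case (Suc r)
  have f: "f i \<in> FS.span G" if "i < Suc r" for i
  proof -
    have "f i - h i \<in> FS.span G"
      using Suc.prems(2)[OF that] FS.span_mono[OF assms(1)] by blast
    then have "h i + (f i - h i) \<in> FS.span G"
      using Suc.prems(1)[OF that] by (intro FS.span_add)
    then show ?thesis
      by (simp only: add_diff_cancel_left' add_diff_eq)
  qed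
  have prod: "(\<Prod>i<j. f i) \<in> FS.span (monomials G j)" if "j \<le> Suc r" for j
    using that
  proof (induction j)
    case (Suc j)
    then have "(\<Prod>i<j. f i) \<in> FS.span (monomials G j)" "f j \<in> FS.span (monomials G 1)"
      using f[of j] by (simp_all only: monomials_1)
    then have "(\<Prod>i<j. f i) * f j \<in> FS.span (monomials G (j + 1))"
      by (rule span_monomials_mult)
    then show ?case
      by (simp only: prod.lessThan_Suc Suc_eq_plus1[symmetric])
  qed (simp only: lessThan_0 prod.empty monomials.simps FS.span_base singletonI)
  have "(\<Prod>i<Suc r. f i) - (\<Prod>i<Suc r. h i) =
      ((\<Prod>i<r. f i) - (\<Prod>i<r. h i)) * h r + (f r - h r) * (\<Prod>i<r. f i)"
    by (simp add: algebra_simps)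
  moreover have "((\<Prod>i<r. f i) - (\<Prod>i<r. h i)) * h r \<in> ideal_part T G (r + 1)"
  proof (rule ideal_part_mult)
    show "(\<Prod>i<r. f i) - (\<Prod>i<r. h i) \<in> ideal_part T G r"
      using Suc.IH Suc.prems(1)[OF less_SucI] Suc.prems(2)[OF less_SucI] by blast
    show "h r \<in> FS.span (monomials G 1)"
      unfolding monomials_1 by (rule Suc.prems(1)) simp
  qed
  moreover have "(f r - h r) * (\<Prod>i<r. f i) \<in> ideal_part T G (r + 1)"
    unfolding Suc_eq_plus1[symmetric]
    by (rule ideal_part_generator[OF Suc.prems(2)[OF lessI] prod]) simp
  ultimately show ?case
    by (simp only: ideal_part_add Suc_eq_plus1[symmetric])
qed

text \<open>Each generator of the ideal part has one marked factor from \<open>insert y T\<close>;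
  the split is by whether this factor is \<open>y\<close>.\<close>

lemma ideal_part_insert:
  fixes y :: "'w \<Rightarrow> 'f::field"
  assumes "f \<in> ideal_part (insert y T) G (Suc l)"
  obtains g j where "f = y * g + j" "g \<in> FS.span (monomials G l)" "j \<in> ideal_part T G (Suc l)"
proof -
  have "\<exists>g j. f = y * g + j \<and> g \<in> FS.span (monomials G l) \<and> j \<in> ideal_part T G (Suc l)"
    using assms unfolding ideal_part_def[of "insert y T"]
  proof (induction rule: FS.span_induct_alt)
    case base
    show ?case
      using FS.span_zero[of "monomials G l"] FS.subspace_0[OF subspace_ideal_part, of T G "Suc l"]
      by (intro exI[of _ 0] conjI) (simp only: mult_zero_right add_0_right, assumption, assumption)
  next
    case (step c x f)
    then obtain g j where gj: "f = y * g + j" "g \<in> FS.span (monomials G l)" "j \<in> ideal_part T G (Suc l)"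
      by blast
    obtain \<tau> \<mu> where x: "x = \<tau> * \<mu>" "\<tau> \<in> insert y T" "\<mu> \<in> monomials G l"
      using step by auto
    show ?case
    proof (cases "\<tau> = y")
      case True
      then have "fun_scale (*) c x + f = y * (fun_scale (*) c \<mu> + g) + j"
        using gj x by (simp only: distrib_left fun_scale_mult_right add.assoc)
      moreover have "fun_scale (*) c \<mu> + g \<in> FS.span (monomials G l)"
        by (rule FS.span_add[OF FS.span_scale[OF FS.span_base[OF x(3)]] gj(2)])
      ultimately show ?thesis
        using gj by blast
    next
      case False
      then have "x \<in> ideal_part T G (Suc l)"
        using x by (auto intro!: ideal_part_generator FS.span_base)
      then have "fun_scale (*) c x + j \<in> ideal_part T G (Suc l)"
        using gj by (intro ideal_part_add FS.subspace_scale[OF subspace_ideal_part])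
      then show ?thesis
        using gj by (intro exI[of _ g] exI[of _ "fun_scale (*) c x + j"] conjI)
          (simp_all only: add.left_commute)
    qed
  qed
  then show ?thesis
    using that by blast
qed

text \<open>Modulo the ideal of \<open>T\<close>, \<open>f\<close> is a multiple of
  \<open>y\<close>, so \<open>f ^ b\<close> is a multiple of \<open>y ^ b\<close>, which lies in
  that ideal.\<close>

lemma ideal_part_eliminate:
  fixes f y :: "'w \<Rightarrow> 'f::field"
  assumes "T \<subseteq> G" and "y \<in> G" and "f \<in> ideal_part (insert y T) G (Suc l)" and "y ^ b \<in> ideal_part T G b"
  shows "f ^ b \<in> ideal_part T G (Suc l * b)"
proof -
  obtain g j where gj: "f = y * g + j" "g \<in> FS.span (monomials G l)" "j \<in> ideal_part T G (Suc l)"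
    using ideal_part_insert[OF assms(3)] .
  have f: "f \<in> FS.span (monomials G (Suc l))"
    using assms(1-3) ideal_part_subset[of "insert y T" G] by blast
  have yg: "y * g \<in> FS.span (monomials G (Suc l))"
    using span_monomials_mult[of y G 1 g l] gj(2) assms(2) by (auto simp: monomials_1 intro: FS.span_base)
  have "f ^ i - (y * g) ^ i \<in> ideal_part T G (Suc l * i)" for i
  proof (induction i)
    case 0
    show ?case
      unfolding power_0 diff_self by (rule FS.subspace_0[OF subspace_ideal_part])
  next
    case (Suc i)
    have "f ^ Suc i - (y * g) ^ Suc i = f * (f ^ i - (y * g) ^ i) + j * (y * g) ^ i"
      unfolding gj(1) by (simp add: algebra_simps)
    moreover have "f * (f ^ i - (y * g) ^ i) \<in> ideal_part T G (Suc l + Suc l * i)"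
      by (rule ideal_part_mult'[OF f Suc])
    moreover have "j * (y * g) ^ i \<in> ideal_part T G (Suc l + Suc l * i)"
      by (rule ideal_part_mult[OF gj(3) span_monomials_power[OF yg]])
    ultimately show ?case
      using ideal_part_add by (metis mult_Suc_right)
  qed
  moreover have "y ^ b * g ^ b \<in> ideal_part T G (b + l * b)"
    by (rule ideal_part_mult[OF assms(4) span_monomials_power[OF gj(2)]])
  ultimately have "(f ^ b - (y * g) ^ b) + y ^ b * g ^ b \<in> ideal_part T G (Suc l * b)"
    by (intro ideal_part_add) (auto simp: algebra_simps)
  then show ?thesis
    by (simp add: power_mult_distrib)
qed

text \<open>Pigeonhole on the exponent of a new generator \<open>g\<close>: in a monomial of degree
  \<open>K + a\<close>, either \<open>g\<close> occurs at least \<open>a\<close> times, or at least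
  \<open>K\<close> factors come from the generators already treated.\<close>

lemma monomials_subset_ideal_part:
  fixes S T :: "('w \<Rightarrow> 'f::field) set"
  assumes "finite S" and "S \<subseteq> G" and "T \<subseteq> G" and "\<And>g. g \<in> S \<Longrightarrow> \<exists>a. g ^ a \<in> ideal_part T G a"
  shows "\<exists>K. monomials (S \<union> T) K \<subseteq> ideal_part T G K"
  using assms(1,2,4)
proof (induction S)
  case empty
  \<comment> \<open>Degree 0 would fail: \<open>ideal_part\<close> is \<open>{0}\<close> there,
    while the only monomial is 1.\<close>
  have "monomials T 1 \<subseteq> ideal_part T G 1"
    using ideal_part_generator[of _ T 1 G 0] by (auto simp: FS.span_base)
  then have "monomials ({} \<union> T) 1 \<subseteq> ideal_part T G 1"
    unfolding Un_empty_left .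
  then show ?case
    by (rule exI)
next
  case (insert g S)
  then obtain K where K: "monomials (S \<union> T) K \<subseteq> ideal_part T G K"
    by auto
  have K': "\<nu> \<in> ideal_part T G m" if "m \<ge> K" "\<nu> \<in> monomials (S \<union> T) m" for m \<nu>
  proof -
    have "\<nu> \<in> monomials (S \<union> T) (K + (m - K))"
      using that by simp
    then obtain \<mu> \<mu>' where \<mu>: "\<nu> = \<mu> * \<mu>'" "\<mu> \<in> monomials (S \<union> T) K" "\<mu>' \<in> monomials (S \<union> T) (m - K)"
      unfolding monomials_add by blast
    have "S \<union> T \<subseteq> G"
      using insert.prems(1) assms(3) by blast
    then have "\<mu>' \<in> FS.span (monomials G (m - K))"
      by (rule FS.span_base[OF subsetD[OF monomials_mono \<mu>(3)]])
    then have "\<mu> * \<mu>' \<in> ideal_part T G (K + (m - K))"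
      using \<mu>(2) K by (intro ideal_part_mult) auto
    then show ?thesis
      unfolding \<mu>(1) le_add_diff_inverse[OF that(1)] .
  qed
  obtain a where a: "g ^ a \<in> ideal_part T G a"
    using insert.prems by blast
  have "\<mu> \<in> ideal_part T G (K + a)" if \<mu>: "\<mu> \<in> monomials (insert g S \<union> T) (K + a)" for \<mu>
  proof -
    obtain i \<nu> where i: "\<mu> = g ^ i * \<nu>" "i \<le> K + a" "\<nu> \<in> monomials (S \<union> T) (K + a - i)"
      using subsetD[OF monomials_insert \<mu>[unfolded Un_insert_left]] by blast
    show ?thesis
    proof (cases "i < a")
      case True
      then have "\<nu> \<in> ideal_part T G (K + a - i)"
        using i(3) by (intro K') auto
      moreover have "g ^ i \<in> FS.span (monomials G i)"
        using insert.prems(1) by (intro FS.span_base power_in_monomials) blast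
      ultimately have "g ^ i * \<nu> \<in> ideal_part T G (i + (K + a - i))"
        by (intro ideal_part_mult')
      then show ?thesis
        unfolding i(1) le_add_diff_inverse[OF i(2)] .
    next
      case False
      then have "g ^ i = g ^ a * g ^ (i - a)"
        by (simp only: power_add[symmetric] le_add_diff_inverse not_less)
      then have \<mu>_eq: "\<mu> = g ^ a * (g ^ (i - a) * \<nu>)"
        by (simp only: i(1) mult.assoc)
      have "S \<union> T \<subseteq> G"
        using insert.prems(1) assms(3) by blast
      then have "\<nu> \<in> FS.span (monomials G (K + a - i))"
        by (rule FS.span_base[OF subsetD[OF monomials_mono i(3)]])
      moreover have "g ^ (i - a) \<in> FS.span (monomials G (i - a))"
        using insert.prems(1) by (intro FS.span_base power_in_monomials) blast
      ultimately have "g ^ (i - a) * \<nu> \<in> FS.span (monomials G (i - a + (K + a - i)))"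
        by (intro span_monomials_mult)
      then have "\<mu> \<in> ideal_part T G (a + (i - a + (K + a - i)))"
        unfolding \<mu>_eq by (intro ideal_part_mult[OF a])
      moreover have "a + (i - a + (K + a - i)) = K + a"
        using False i(2) by simp
      ultimately show ?thesis
        by (simp only:)
    qed
  qed
  then have "monomials (insert g S \<union> T) (K + a) \<subseteq> ideal_part T G (K + a)"
    by (rule subsetI)
  then show ?case
    by (rule exI)
qed

text \<open>The algebra generated by \<open>G\<close> is a finite module over the one generated by
  \<open>T\<close>, with the monomials of degree below \<open>K\<close> as module generators;
  \<open>C\<close> is their number. Bounding each exponent separately, instead of the total degree,
  gives the factor \<open>(m + 1) ^ card T\<close>.\<close>

lemma hilbert_function_bound:
  fixes G T :: "('w \<Rightarrow> 'f::field) set"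
  assumes "finite G" and "T \<subseteq> G" and K: "monomials G K \<subseteq> ideal_part T G K"
  shows "\<exists>C. \<forall>m. \<exists>Z. finite Z \<and> card Z \<le> C * (m + 1) ^ card T \<and> (\<forall>i\<le>m. monomials G i \<subseteq> FS.span Z)"
proof -
  have T: "finite T"
    using assms finite_subset by blast
  define E where "E m = (\<lambda>a. \<Prod>t\<in>T. t ^ a t) ` (PiE T (\<lambda>_. {..m}))" for m :: nat
  define B where "B = (\<Union>i<K. monomials G i)"
  define Z where "Z m = {\<nu> * \<mu> |\<nu> \<mu>. \<nu> \<in> E m \<and> \<mu> \<in> B}" for m
  have finE: "finite (E m)" for m
    unfolding E_def using T by (auto intro!: finite_PiE)
  have cardE: "card (E m) \<le> (m + 1) ^ card T" for m
    unfolding E_def using T card_image_le[of "PiE T (\<lambda>_. {..m})" "\<lambda>a. \<Prod>t\<in>T. t ^ a t"]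
    by (simp add: finite_PiE card_PiE)
  have E_mono: "E m \<subseteq> E (Suc m)" for m
    unfolding E_def by (intro image_mono PiE_mono) auto
  have E_mult: "\<tau> * \<nu> \<in> E (Suc m)" if \<tau>: "\<tau> \<in> T" and \<nu>: "\<nu> \<in> E m" for \<tau> \<nu> m
  proof -
    obtain a where a: "\<nu> = (\<Prod>t\<in>T. t ^ a t)" "a \<in> PiE T (\<lambda>_. {..m})"
      using \<nu> by (auto simp: E_def)
    have "(\<Prod>t\<in>T. t ^ (a(\<tau> := Suc (a \<tau>))) t) = \<tau> * (\<Prod>t\<in>T. t ^ a t)"
    proof -
      have "(\<Prod>t\<in>T - {\<tau>}. t ^ (a(\<tau> := Suc (a \<tau>))) t) = (\<Prod>t\<in>T - {\<tau>}. t ^ a t)"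
        by (intro prod.cong) auto
      then show ?thesis
        unfolding prod.remove[OF T \<tau>] by (simp only: fun_upd_same power_Suc mult.assoc)
    qed
    moreover have "a(\<tau> := Suc (a \<tau>)) \<in> PiE T (\<lambda>_. {..Suc m})"
      using a(2) \<tau> by (auto simp: PiE_def Pi_def extensional_def le_SucI)
    ultimately show ?thesis
      unfolding E_def a(1) by (intro image_eqI[OF sym])
  qed
  have finB: "finite B"
    unfolding B_def using assms(1) by (auto intro: finite_monomials)
  have Z_image: "Z m = (\<lambda>(\<nu>, \<mu>). \<nu> * \<mu>) ` (E m \<times> B)" for m
    unfolding Z_def by auto
  have finZ: "finite (Z m)" for m
    unfolding Z_image using finE finB by auto
  have cardZ: "card (Z m) \<le> card B * (m + 1) ^ card T" for m
  proof -
    have "card (Z m) \<le> card (E m) * card B"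
      unfolding Z_image using card_image_le[of "E m \<times> B"] finE finB by (simp add: card_cartesian_product)
    then show ?thesis
      using mult_le_mono2[OF cardE[of m], of "card B"] by (metis mult.commute order_trans)
  qed
  have Z_mono: "Z m \<subseteq> Z (Suc m)" for m
    unfolding Z_def using E_mono[of m] by blast
  have span_Z_mono: "FS.span (Z m) \<subseteq> FS.span (Z m')" if "m \<le> m'" for m m'
    using lift_Suc_mono_le[of Z, OF Z_mono that] by (rule FS.span_mono)
  have mon: "monomials G m \<subseteq> FS.span (Z m)" for m
  proof (induction m rule: less_induct)
    case (less m)
    show ?case
    proof (cases "m < K")
      case True
      have "1 \<in> E m"
        unfolding E_def by (intro image_eqI[of _ _ "\<lambda>t\<in>T. 0"]) auto
      then have "1 * \<mu> \<in> Z m" if "\<mu> \<in> monomials G m" for \<mu>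
        unfolding Z_def B_def using True that by blast
      then have "monomials G m \<subseteq> Z m"
        by auto
      then show ?thesis
        using FS.span_superset by blast
    next
      case False
      show ?thesis
      proof
        fix \<mu> assume "\<mu> \<in> monomials G m"
        \<comment> \<open>Splitting off \<open>K\<close> factors puts the monomial into the ideal
          part; a factor from \<open>T\<close> then comes out and leaves cofactors of degree
          \<open>m - 1\<close>.\<close>
        then obtain \<mu>1 \<mu>2 where \<mu>: "\<mu> = \<mu>1 * \<mu>2" "\<mu>1 \<in> monomials G K" "\<mu>2 \<in> monomials G (m - K)"
          using False monomials_add[of G K "m - K"] by auto
        then have "\<mu> \<in> ideal_part T G m"
          using ideal_part_mult[of \<mu>1 T G K \<mu>2 "m - K"] False K by (auto simp: FS.span_base)
        moreover have "ideal_part T G m \<subseteq> FS.span (Z m)"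
          unfolding ideal_part_def
        proof (rule FS.span_minimal)
          show "{\<tau> * \<mu> |\<tau> \<mu> l. \<tau> \<in> T \<and> m = Suc l \<and> \<mu> \<in> monomials G l} \<subseteq> FS.span (Z m)"
          proof clarify
            fix \<tau> \<mu> l assume *: "\<tau> \<in> T" "m = Suc l" "\<mu> \<in> monomials G l"
            have "\<tau> \<in> FS.span {\<tau>}" "\<mu> \<in> FS.span (Z l)"
              using less[of l] * by (auto intro: FS.span_base)
            then show "\<tau> * \<mu> \<in> FS.span (Z (Suc l))"
            proof (rule span_mult_mem)
              fix a b assume "a \<in> {\<tau>}" "b \<in> Z l"
              then obtain \<nu> \<mu> where "a * b = \<tau> * (\<nu> * \<mu>)" "\<nu> \<in> E l" "\<mu> \<in> B"
                unfolding Z_def by blast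
              then have "a * b = (\<tau> * \<nu>) * \<mu>" "\<tau> * \<nu> \<in> E (Suc l)"
                using E_mult[OF *(1)] by (simp_all only: mult.assoc)
              then have "a * b \<in> Z (Suc l)"
                unfolding Z_def using \<open>\<mu> \<in> B\<close> by blast
              then show "a * b \<in> FS.span (Z (Suc l))"
                by (rule FS.span_base)
            qed
          qed
        qed simp
        ultimately show "\<mu> \<in> FS.span (Z m)"
          by blast
      qed
    qed
  qed
  show ?thesis
  proof (intro exI[of _ "card B"] allI)
    fix m
    have "monomials G i \<subseteq> FS.span (Z m)" if "i \<le> m" for i
      using mon[of i] span_Z_mono[OF that] by blast
    then show "\<exists>Z. finite Z \<and> card Z \<le> card B * (m + 1) ^ card T \<and> (\<forall>i\<le>m. monomials G i \<subseteq> FS.span Z)"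
      using finZ[of m] cardZ[of m] by (intro exI[of _ "Z m"]) blast
  qed
qed

section \<open>Krull dimension and growth\<close>

lemma poly_funs_sum:
  assumes "finite I" and "\<And>i. i \<in> I \<Longrightarrow> f i \<in> poly_funs s W"
  shows "(\<lambda>w. \<Sum>i\<in>I. f i w) \<in> poly_funs s W"
  using assms by (induction I rule: finite_induct) (auto intro: poly_funs.intros)

lemma poly_funs_power: "f \<in> poly_funs s W \<Longrightarrow> (\<lambda>w. f w ^ n) \<in> poly_funs s W"
  by (induction n) (auto intro: poly_funs.intros)

definition filtration :: "('w \<Rightarrow> 'f::field) set \<Rightarrow> nat \<Rightarrow> ('w \<Rightarrow> 'f) set" where
  "filtration G m = FS.span (\<Union>i\<le>m. monomials G i)"

lemma filtration_mono: "a \<le> b \<Longrightarrow> filtration G a \<subseteq> filtration G b"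
  unfolding filtration_def by (intro FS.span_mono UN_mono) auto

lemma filtration_mult:
  assumes "f \<in> filtration G a" and "g \<in> filtration G b"
  shows "f * g \<in> filtration G (a + b)"
  using assms unfolding filtration_def
proof (rule span_mult_mem)
  fix \<mu> \<nu> assume "\<mu> \<in> (\<Union>i\<le>a. monomials G i)" "\<nu> \<in> (\<Union>i\<le>b. monomials G i)"
  then obtain i j where "i \<le> a" "\<mu> \<in> monomials G i" "j \<le> b" "\<nu> \<in> monomials G j"
    by blast
  then have "i + j \<le> a + b" "\<mu> * \<nu> \<in> monomials G (i + j)"
    by (auto simp: monomials_add)
  then show "\<mu> * \<nu> \<in> FS.span (\<Union>i\<le>a + b. monomials G i)"
    by (intro FS.span_base) blast
qed

lemma filtration_power: "f \<in> filtration G a \<Longrightarrow> f ^ n \<in> filtration G (n * a)"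
proof (induction n)
  case 0
  have "1 \<in> (\<Union>i\<le>0. monomials G i)"
    by simp
  then show ?case
    unfolding filtration_def mult_0 power_0 by (rule FS.span_base)
next
  case (Suc n)
  then show ?case
    using filtration_mult[of f G a "f ^ n" "n * a"] by (simp only: power_Suc mult_Suc)
qed

text \<open>The equality is only on \<open>X\<close> because \<open>G\<close> will consist of
  functions cut off outside \<open>X\<close>. The degree is existential because membership in
  \<open>poly_funs\<close> carries none.\<close>

lemma poly_funs_filtration:
  fixes W X :: "'w::ab_group_add set"
  assumes "p \<in> poly_funs s W"
    and "\<And>l. l \<in> dual s W \<Longrightarrow> \<exists>g\<in>FS.span G. \<forall>w\<in>X. l w = g w"
  shows "\<exists>m. \<exists>q\<in>filtration G m. \<forall>w\<in>X. p w = q w"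
  using assms(1)
proof induction
  case (const c)
  have "fun_scale (*) c 1 \<in> filtration G 0"
    unfolding filtration_def by (intro FS.span_scale FS.span_base) simp
  then show ?case
    by (intro exI[of _ 0] bexI[of _ "fun_scale (*) c 1"]) (auto simp: fun_scale_def)
next
  case (functional l)
  then obtain g where "g \<in> FS.span G" "\<forall>w\<in>X. l w = g w"
    using assms(2) by blast
  moreover have "FS.span G \<subseteq> filtration G 1"
    unfolding filtration_def using monomials_1[of G] by (intro FS.span_mono) (metis One_nat_def UN_upper atMost_iff order_refl)
  ultimately show ?case
    by blast
next
  case (add p q)
  then obtain a b p' q' where *: "p' \<in> filtration G a" "\<forall>w\<in>X. p w = p' w"
    "q' \<in> filtration G b" "\<forall>w\<in>X. q w = q' w"
    by blast
  then have "p' \<in> filtration G (a + b)" "q' \<in> filtration G (a + b)"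
    using filtration_mono[of a "a + b" G] filtration_mono[of b "a + b" G] by auto
  then have "p' + q' \<in> filtration G (a + b)"
    unfolding filtration_def by (rule FS.span_add)
  then show ?case
    using * by (intro exI[of _ "a + b"] bexI[of _ "p' + q'"]) auto
next
  case (mult p q)
  then obtain a b p' q' where *: "p' \<in> filtration G a" "\<forall>w\<in>X. p w = p' w"
    "q' \<in> filtration G b" "\<forall>w\<in>X. q w = q' w"
    by blast
  then have "p' * q' \<in> filtration G (a + b)"
    by (intro filtration_mult)
  then show ?case
    using * by (intro exI[of _ "a + b"] bexI[of _ "p' * q'"]) auto
qed

text \<open>The vanishing ideal of an irreducible set is prime: the zero sets of the two factors are
  closed and cover \<open>Z\<close>.\<close>

lemma irreducible_closedin_mult_zero:
  fixes Z :: "'w::ab_group_add set"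
  assumes Z: "irreducible_closedin (subtopology (zariski s W) X) Z"
    and f: "f \<in> poly_funs s W" and g: "g \<in> poly_funs s W"
    and fg: "\<And>w. w \<in> Z \<Longrightarrow> f w * g w = 0" and nz: "\<exists>w\<in>Z. f w \<noteq> 0" and w: "w \<in> Z"
  shows "g w = 0"
proof -
  let ?T = "subtopology (zariski s W) X"
  have cl: "closedin ?T Z"
    using Z by (simp add: irreducible_closedin_def)
  then have ZW: "Z \<subseteq> W" "Z \<subseteq> X"
    using closedin_subset by fastforce+
  have closed: "closedin ?T {w\<in>Z. h w = 0}" if h: "h \<in> poly_funs s W" for h
  proof -
    have "closedin (zariski s W) (zero_locus W {h})"
      unfolding closedin_zariski using h by blast
    then have "closedin ?T (X \<inter> zero_locus W {h})"
      by (auto simp: closedin_subtopology)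
    then have "closedin ?T (Z \<inter> (X \<inter> zero_locus W {h}))"
      using cl by blast
    moreover have "Z \<inter> (X \<inter> zero_locus W {h}) = {w\<in>Z. h w = 0}"
      using ZW by (auto simp: zero_locus_def)
    ultimately show ?thesis
      by simp
  qed
  have "Z = {w\<in>Z. f w = 0} \<union> {w\<in>Z. g w = 0}"
    using fg by auto
  then have "Z = {w\<in>Z. f w = 0} \<or> Z = {w\<in>Z. g w = 0}"
    using Z closed[OF f] closed[OF g] unfolding irreducible_closedin_def by blast
  then show ?thesis
    using nz w by blast
qed

text \<open>
  A chain of irreducible closed sets of length \<open>n\<close> yields \<open>n\<close> polynomial functions, the \<open>i\<close>-th
  vanishing on \<open>C i\<close> but not on \<open>C (i + 1)\<close>. Dividing a linear relation between monomials in
  them by the largest possible power of the last function and restricting to the next smaller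
  member of the chain shows that these monomials are linearly independent on the last member.
\<close>

lemma irreducible_chain_independent:
  fixes s :: "'f::field \<Rightarrow> 'w::ab_group_add \<Rightarrow> 'w" and X :: "'w set"
  assumes irr: "\<And>i. i \<le> n \<Longrightarrow> irreducible_closedin (subtopology (zariski s W) X) (C i)"
    and chain: "\<And>i. i < n \<Longrightarrow> C i \<subset> C (Suc i)"
    and lin: "\<And>l. l \<in> dual s W \<Longrightarrow> \<exists>g\<in>FS.span G. \<forall>w\<in>X. l w = g w"
  shows "\<exists>D. \<forall>M>0. \<exists>q. (\<forall>t<M ^ n. q t \<in> filtration G (n * D * M)) \<and>
    (\<forall>c. (\<forall>w\<in>X. (\<Sum>t<M ^ n. c t * q t w) = 0) \<longrightarrow> (\<forall>t<M ^ n. c t = 0))"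
proof -
  have CX: "C i \<subseteq> X" "C i \<subseteq> W" if "i \<le> n" for i
    using irr[OF that] closedin_subset unfolding irreducible_closedin_def by fastforce+
  have "\<exists>f\<in>poly_funs s W. (\<forall>w\<in>C i. f w = 0) \<and> (\<exists>w\<in>C (Suc i). f w \<noteq> 0)" if i: "i < n" for i
  proof -
    have "closedin (subtopology (zariski s W) X) (C i)"
      using irr[of i] i by (simp add: irreducible_closedin_def)
    then obtain P where P: "P \<subseteq> poly_funs s W" "C i = zero_locus W P \<inter> X"
      by (auto simp: closedin_subtopology closedin_zariski)
    obtain w where w: "w \<in> C (Suc i)" "w \<notin> C i"
      using chain[OF i] by blast
    then have "w \<in> W" "w \<in> X"
      using CX[of "Suc i"] i by auto
    then obtain f where "f \<in> P" "f w \<noteq> 0"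
      using w P by (auto simp: zero_locus_def)
    then show ?thesis
      using P w by (intro bexI[of _ f]) (auto simp: zero_locus_def)
  qed
  then obtain f where f: "\<And>i. i < n \<Longrightarrow> f i \<in> poly_funs s W"
    "\<And>i w. i < n \<Longrightarrow> w \<in> C i \<Longrightarrow> f i w = 0" "\<And>i. i < n \<Longrightarrow> \<exists>w\<in>C (Suc i). f i w \<noteq> 0"
    by metis
  have "\<exists>m. \<exists>q\<in>filtration G m. \<forall>w\<in>X. f i w = q w" if "i < n" for i
    by (rule poly_funs_filtration[OF f(1)[OF that] lin])
  then obtain m g where mg: "\<And>i. i < n \<Longrightarrow> g i \<in> filtration G (m i)"
    "\<And>i w. i < n \<Longrightarrow> w \<in> X \<Longrightarrow> f i w = g i w"
    by metis
  \<comment> \<open>The sum is a common bound for the degrees of all the \<open>g i\<close>.\<close>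
  define D where "D = (\<Sum>i<n. m i)"
  have g: "g i \<in> filtration G D" if "i < n" for i
    using mg(1)[OF that] filtration_mono[of "m i" D G] that member_le_sum[of i "{..<n}" m]
    unfolding D_def by auto
  \<comment> \<open>Two families with the same values on \<open>X\<close> are carried along:
    \<open>p\<close> consists of polynomial functions, to which irreducibility applies, and
    \<open>q\<close> lies in the filtration, where functions are counted.\<close>
  have main: "\<exists>p q. (\<forall>t<M ^ i. p t \<in> poly_funs s W \<and> q t \<in> filtration G (i * D * M) \<and> (\<forall>w\<in>X. p t w = q t w)) \<and>
      (\<forall>c. (\<forall>w\<in>C i. (\<Sum>t<M ^ i. c t * p t w) = 0) \<longrightarrow> (\<forall>t<M ^ i. c t = 0))"
    if "i \<le> n" "M > 0" for i M
    using that(1)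
  proof (induction i)
    case 0
    have "C 0 \<noteq> {}"
      using irr[of 0] by (simp add: irreducible_closedin_def)
    then obtain w where w: "w \<in> C 0"
      by blast
    have "1 \<in> filtration G 0"
      unfolding filtration_def by (intro FS.span_base) simp
    then have "(\<lambda>_. 1) \<in> filtration G 0"
      unfolding one_fun_def .
    then have q: "(\<lambda>_. 1) \<in> filtration G (0 * D * M)"
      unfolding mult_0 .
    show ?case
    proof (rule exI[of _ "\<lambda>_ _. 1"], rule exI[of _ "\<lambda>_ _. 1"], intro conjI allI impI)
      fix c t assume "\<forall>w\<in>C 0. (\<Sum>t<M ^ 0. c t * 1) = (0 :: 'f)" and t: "t < M ^ 0"
      then have "(\<Sum>t<M ^ 0. c t * 1) = 0"
        using w by blast
      then show "c t = 0"
        using t by simp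
    qed (rule poly_funs.const | rule q | (rule ballI, rule refl))+
  next
    case (Suc i)
    then have i: "i < n"
      by simp
    obtain p q where pq: "\<forall>t<M ^ i. p t \<in> poly_funs s W \<and> q t \<in> filtration G (i * D * M) \<and> (\<forall>w\<in>X. p t w = q t w)"
      "\<forall>c. (\<forall>w\<in>C i. (\<Sum>t<M ^ i. c t * p t w) = 0) \<longrightarrow> (\<forall>t<M ^ i. c t = 0)"
      using Suc.IH[OF Suc_leD[OF Suc.prems]] by (elim exE conjE) (rule that)
    have p: "\<And>t. t < M ^ i \<Longrightarrow> p t \<in> poly_funs s W"
      "\<And>t. t < M ^ i \<Longrightarrow> q t \<in> filtration G (i * D * M)"
      "\<And>t w. t < M ^ i \<Longrightarrow> w \<in> X \<Longrightarrow> p t w = q t w"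
      using pq(1) by blast+
    have ind_p: "c t = 0" if "\<And>w. w \<in> C i \<Longrightarrow> (\<Sum>t<M ^ i. c t * p t w) = 0" "t < M ^ i" for c t
      using pq(2)[rule_format, of c t] that by blast
    define N where "N = M ^ i"
    have N: "N > 0" "M ^ Suc i = M * N"
      using that by (auto simp: N_def)
    \<comment> \<open>Digits in base \<open>M\<close>: \<open>t div N\<close> is the exponent of the
      new function \<open>f i\<close>, and \<open>t mod N\<close> indexes a product of the earlier
      ones.\<close>
    define p' where "p' t = (\<lambda>w. f i w ^ (t div N) * p (t mod N) w)" for t
    define q' where "q' t = g i ^ (t div N) * q (t mod N)" for t
    have div: "t div N < M" "t mod N < M ^ i" if "t < M * N" for t
      using that N by (auto simp: less_mult_imp_div_less N_def[symmetric])
    have p': "p' t \<in> poly_funs s W" if "t < M * N" for t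
      unfolding p'_def using div[OF that] by (intro poly_funs.mult poly_funs_power f p i)
    have pq: "p' t w = q' t w" if "t < M * N" "w \<in> X" for t w
      unfolding p'_def q'_def using div[OF that(1)] p(3) mg(2)[OF i] that(2)
      by (simp add: power_fun_apply)
    have q': "q' t \<in> filtration G (Suc i * D * M)" if "t < M * N" for t
    proof -
      have "q' t \<in> filtration G (t div N * D + i * D * M)"
        unfolding q'_def using div[OF that] by (intro filtration_mult filtration_power g p i)
      moreover have "t div N * D + i * D * M \<le> Suc i * D * M"
        using mult_le_mono1[of "t div N" M D] div[OF that] by (simp add: algebra_simps)
      ultimately show ?thesis
        using filtration_mono by blast
    qed
    have ind: "c t = 0" if c: "\<forall>w\<in>C (Suc i). (\<Sum>t<M * N. c t * p' t w) = 0" and t: "t < M * N" for c t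
    proof (rule ccontr)
      define S where "S a w = (\<Sum>l<N. c (a * N + l) * p l w)" for a w
      have S: "S a \<in> poly_funs s W" for a
        unfolding S_def by (intro poly_funs_sum poly_funs.mult poly_funs.const p) (auto simp: N_def)
      have sum: "(\<Sum>t<M * N. c t * p' t w) = (\<Sum>a<M. f i w ^ a * S a w)" for w
      proof -
        have "(\<Sum>t<M * N. c t * p' t w) = (\<Sum>a<M. \<Sum>t=a*N..<a*N+N. c t * p' t w)"
          by (rule sum.nat_group[symmetric])
        also have "\<dots> = (\<Sum>a<M. f i w ^ a * S a w)"
        proof (intro sum.cong refl)
          fix a
          have "(\<Sum>t=a*N..<a*N+N. c t * p' t w) = (\<Sum>l<N. c (l + a*N) * p' (l + a*N) w)"
            using sum.shift_bounds_nat_ivl[of "\<lambda>t. c t * p' t w" 0 "a*N" N]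
            by (simp add: lessThan_atLeast0 add.commute)
          also have "\<dots> = f i w ^ a * S a w"
            unfolding S_def p'_def sum_distrib_left using N
            by (intro sum.cong) (auto simp: add.commute)
          finally show "(\<Sum>t=a*N..<a*N+N. c t * p' t w) = f i w ^ a * S a w" .
        qed
        finally show ?thesis .
      qed
      assume "c t \<noteq> 0"
      then have "c (t div N * N + t mod N) \<noteq> 0"
        by (simp only: div_mult_mod_eq not_False_eq_True)
      then have ex: "\<exists>a. a < M \<and> (\<exists>l<N. c (a * N + l) \<noteq> 0)"
        using div[OF t] unfolding N_def[symmetric] by blast
      define a where "a = (LEAST a. a < M \<and> (\<exists>l<N. c (a * N + l) \<noteq> 0))"
      have a: "a < M" "\<exists>l<N. c (a * N + l) \<noteq> 0"
        by (rule conjunct1[OF LeastI_ex[OF ex, folded a_def]], rule conjunct2[OF LeastI_ex[OF ex, folded a_def]])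
      have "c (b * N + l) = 0" if b: "b < a" and l: "l < N" for b l
        using not_less_Least[of b "\<lambda>a. a < M \<and> (\<exists>l<N. c (a * N + l) \<noteq> 0)", folded a_def, OF b]
          less_trans[OF b a(1)] l by blast
      then have zero: "S b w = 0" if "b < a" for b w
        using that by (simp add: S_def)
      define R where "R w = (\<Sum>b<M - a. f i w ^ b * S (a + b) w)" for w
      have R: "R \<in> poly_funs s W"
        unfolding R_def by (intro poly_funs_sum poly_funs.mult poly_funs_power f i S) auto
      have fR: "f i w ^ a * R w = 0" if w: "w \<in> C (Suc i)" for w
      proof -
        have "0 = (\<Sum>b<M. f i w ^ b * S b w)"
          using c w sum by simp
        also have "\<dots> = (\<Sum>b=a..<M. f i w ^ b * S b w)"
          using zero by (intro sum.mono_neutral_right) auto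
        also have "\<dots> = (\<Sum>b<M - a. f i w ^ (a + b) * S (a + b) w)"
          using sum.shift_bounds_nat_ivl[of "\<lambda>t. f i w ^ t * S t w" 0 a "M - a"] a(1)
          by (simp add: lessThan_atLeast0 add.commute)
        also have "\<dots> = f i w ^ a * R w"
          unfolding R_def sum_distrib_left by (intro sum.cong) (auto simp: power_add)
        finally show ?thesis by simp
      qed
      have "R w = 0" if w: "w \<in> C (Suc i)" for w
      proof (rule irreducible_closedin_mult_zero[OF irr[OF Suc.prems] poly_funs_power[OF f(1)[OF i], of a] R fR _ w])
        show "\<exists>w\<in>C (Suc i). f i w ^ a \<noteq> 0"
          using f(3)[OF i] by auto
      qed
      moreover have "R w = S a w" if w: "w \<in> C i" for w
      proof -
        have "R w = (\<Sum>b<M - a. if b = 0 then S a w else 0)"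
          unfolding R_def using f(2)[OF i w] by (intro sum.cong) auto
        then show ?thesis
          using a(1) by simp
      qed
      ultimately have "(\<Sum>l<M ^ i. c (a * N + l) * p l w) = 0" if "w \<in> C i" for w
        using chain[OF i] that unfolding S_def N_def by fastforce
      then have "c (a * N + l) = 0" if "l < N" for l
        using ind_p[of "\<lambda>l. c (a * N + l)"] that by (auto simp: N_def)
      then show False
        using a(2) by blast
    qed
    show ?case
      unfolding N(2) using p' q' pq ind by (intro exI[of _ p'] exI[of _ q']) blast
  qed
  show ?thesis
  proof (intro exI[of _ D] allI impI)
    fix M :: nat assume M: "M > 0"
    obtain p q where pq: "\<forall>t<M ^ n. p t \<in> poly_funs s W \<and> q t \<in> filtration G (n * D * M) \<and> (\<forall>w\<in>X. p t w = q t w)"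
      "\<forall>c. (\<forall>w\<in>C n. (\<Sum>t<M ^ n. c t * p t w) = 0) \<longrightarrow> (\<forall>t<M ^ n. c t = 0)"
      using main[OF order_refl M] by blast
    have "\<forall>c. (\<forall>w\<in>X. (\<Sum>t<M ^ n. c t * q t w) = 0) \<longrightarrow> (\<forall>t<M ^ n. c t = 0)"
    proof (intro allI impI)
      fix c t assume *: "\<forall>w\<in>X. (\<Sum>t<M ^ n. c t * q t w) = 0" "t < M ^ n"
      have "(\<Sum>t<M ^ n. c t * p t w) = 0" if w: "w \<in> C n" for w
      proof -
        have "w \<in> X"
          using CX(1)[of n] w by auto
        then have "(\<Sum>t<M ^ n. c t * p t w) = (\<Sum>t<M ^ n. c t * q t w)"
          using pq(1) by (intro sum.cong) auto
        then show ?thesis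
          using * \<open>w \<in> X\<close> by simp
      qed
      then show "c t = 0"
        using pq(2) *(2) by blast
    qed
    then show "\<exists>q. (\<forall>t<M ^ n. q t \<in> filtration G (n * D * M)) \<and>
      (\<forall>c. (\<forall>w\<in>X. (\<Sum>t<M ^ n. c t * q t w) = 0) \<longrightarrow> (\<forall>t<M ^ n. c t = 0))"
      using pq(1) by blast
  qed
qed

text \<open>A chain of length \<open>n\<close> gives \<open>M ^ n\<close> independent functions of
  degree at most \<open>n * D * M\<close>, but functions of that degree span a space of dimension at
  most a constant times \<open>M ^ card T\<close>. Letting \<open>M\<close> grow yields
  \<open>n \<le> card T\<close>.\<close>

lemma krull_dim_le:
  fixes X :: "'w::ab_group_add set"
  assumes "finite G" and "T \<subseteq> G" and "monomials G K \<subseteq> ideal_part T G K"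
    and lin: "\<And>l. l \<in> dual s W \<Longrightarrow> \<exists>g\<in>FS.span G. \<forall>w\<in>X. l w = g w"
  shows "krull_dim (subtopology (zariski s W) X) \<le> ereal (real (card T))"
  unfolding krull_dim_def
proof (rule Sup_least)
  fix x assume "x \<in> {ereal (real n) |n. \<exists>C.
    (\<forall>i\<le>n. irreducible_closedin (subtopology (zariski s W) X) (C i)) \<and> (\<forall>i<n. C i \<subset> C (Suc i))}"
  then obtain n C where x: "x = ereal (real n)"
    and C: "\<And>i. i \<le> n \<Longrightarrow> irreducible_closedin (subtopology (zariski s W) X) (C i)"
      "\<And>i. i < n \<Longrightarrow> C i \<subset> C (Suc i)"
    by blast
  obtain D where D: "\<forall>M>0. \<exists>q. (\<forall>t<M ^ n. q t \<in> filtration G (n * D * M)) \<and>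
    (\<forall>c. (\<forall>w\<in>X. (\<Sum>t<M ^ n. c t * q t w) = 0) \<longrightarrow> (\<forall>t<M ^ n. c t = 0))"
    using irreducible_chain_independent[of n s W X C G, OF C lin] by blast
  obtain B where B: "\<forall>m. \<exists>Z. finite Z \<and> card Z \<le> B * (m + 1) ^ card T \<and>
    (\<forall>i\<le>m. monomials G i \<subseteq> FS.span Z)"
    using hilbert_function_bound[OF assms(1-3)] by blast
  have le: "M ^ n \<le> B * (n * D * M + 1) ^ card T" if M: "M > 0" for M
  proof (rule ccontr)
    assume "\<not> ?thesis"
    moreover obtain Z where Z: "finite Z" "card Z \<le> B * (n * D * M + 1) ^ card T"
      "\<forall>i\<le>n * D * M. monomials G i \<subseteq> FS.span Z"
      using B by blast
    ultimately have card: "card Z < M ^ n"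
      by simp
    obtain q where q: "\<forall>t<M ^ n. q t \<in> filtration G (n * D * M)"
      "\<forall>c. (\<forall>w\<in>X. (\<Sum>t<M ^ n. c t * q t w) = 0) \<longrightarrow> (\<forall>t<M ^ n. c t = 0)"
      using D M by blast
    have "filtration G (n * D * M) \<subseteq> FS.span Z"
      unfolding filtration_def using Z(3) by (intro FS.span_minimal) auto
    then have "\<exists>c. (\<exists>t<M ^ n. c t \<noteq> 0) \<and> (\<Sum>t<M ^ n. fun_scale (*) (c t) (q t)) = 0"
      using q(1) by (intro FS.family_dependent[OF Z(1) _ card]) auto
    then obtain c where c: "\<exists>t<M ^ n. c t \<noteq> 0" "(\<Sum>t<M ^ n. fun_scale (*) (c t) (q t)) = 0"
      by blast
    have "(\<Sum>t<M ^ n. c t * q t w) = 0" for w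
      using fun_cong[OF c(2), of w] by (simp add: sum_fun_apply fun_scale_def)
    then show False
      using q(2) c(1) by blast
  qed
  have "n \<le> card T"
  proof (rule ccontr)
    assume n: "\<not> n \<le> card T"
    \<comment> \<open>One more than the constant in the upper bound, so that this bound is at most
      \<open>(M - 1) * M ^ card T\<close>.\<close>
    define M where "M = B * (n * D + 1) ^ card T + 1"
    have M: "M > 0"
      by (simp add: M_def)
    have "M * M ^ card T \<le> M ^ n"
      using n M power_increasing[of "Suc (card T)" n M] by simp
    also have "\<dots> \<le> B * (n * D * M + 1) ^ card T"
      by (rule le[OF M])
    also have "\<dots> \<le> B * ((n * D + 1) * M) ^ card T"
      using M by (intro mult_le_mono2 power_mono) (auto simp: algebra_simps)
    also have "\<dots> = (M - 1) * M ^ card T"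
      unfolding power_mult_distrib by (simp only: M_def add_diff_cancel_right' mult.assoc)
    also have "\<dots> < M * M ^ card T"
      using M by simp
    finally show False
      by simp
  qed
  then show "x \<le> ereal (real (card T))"
    by (simp add: x)
qed

section \<open>The index of a centraliser is at least the dimension of the vector space\<close>

lemma comp_add_left: "(x + y) \<circ> z = (x \<circ> z) + (y \<circ> z)" for x y :: "'v \<Rightarrow> 'v::ab_group_add"
  by (simp add: fun_eq_iff)

text \<open>An indexed basis with its dual functionals. The instance used later is the union of the
  Jordan chains, so that \<open>n\<close> becomes the sum of their lengths.\<close>

locale coordinates = vector_space s
  for s :: "'f::field_char_0 \<Rightarrow> 'v::ab_group_add \<Rightarrow> 'v" (infixr \<open>*s\<close> 75) +
  fixes n :: nat and b :: "nat \<Rightarrow> 'v" and \<psi> :: "nat \<Rightarrow> 'v \<Rightarrow> 'f"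
  assumes \<psi>_add: "i < n \<Longrightarrow> \<psi> i (u + v) = \<psi> i u + \<psi> i v"
    and \<psi>_scale: "i < n \<Longrightarrow> \<psi> i (c *s v) = c * \<psi> i v"
    and \<psi>_b: "i < n \<Longrightarrow> j < n \<Longrightarrow> \<psi> i (b j) = (if i = j then 1 else 0)"
    and expand: "v = (\<Sum>i<n. \<psi> i v *s b i)"
begin

sublocale E: vector_space "fun_scale s :: 'f \<Rightarrow> ('v \<Rightarrow> 'v) \<Rightarrow> ('v \<Rightarrow> 'v)"
  by (rule vector_space_fun_scale) (rule vector_space_axioms)

lemma mem_gl: "x \<in> gl s \<longleftrightarrow> (\<forall>u v. x (u + v) = x u + x v) \<and> (\<forall>c v. x (c *s v) = c *s x v)"
  by (rule mem_gl_iff) (rule vector_space_axioms)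

lemma gl_add: "x \<in> gl s \<Longrightarrow> x (u + v) = x u + x v"
  and gl_scale: "x \<in> gl s \<Longrightarrow> x (c *s v) = c *s x v"
  by (auto simp: mem_gl)

lemma gl_0: "x \<in> gl s \<Longrightarrow> x 0 = 0"
  using gl_add[of x 0 0] by simp

lemma gl_diff: "x \<in> gl s \<Longrightarrow> x (u - v) = x u - x v"
  using gl_add[of x "u - v" v] by (simp add: algebra_simps)

lemma gl_sum: "x \<in> gl s \<Longrightarrow> x (\<Sum>i\<in>I. f i) = (\<Sum>i\<in>I. x (f i))"
  by (induction I rule: infinite_finite_induct) (auto simp: gl_0 gl_add)

lemma \<psi>_0: "i < n \<Longrightarrow> \<psi> i 0 = 0"
  using \<psi>_add[of i 0 0] by simp

lemma \<psi>_diff: "i < n \<Longrightarrow> \<psi> i (u - v) = \<psi> i u - \<psi> i v"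
  using \<psi>_add[of i "u - v" v] by (simp add: algebra_simps)

lemma \<psi>_sum: "i < n \<Longrightarrow> \<psi> i (\<Sum>j\<in>I. f j) = (\<Sum>j\<in>I. \<psi> i (f j))"
  by (induction I rule: infinite_finite_induct) (auto simp: \<psi>_0 \<psi>_add)

lemma eq_0_if_\<psi>_eq_0: "(\<And>i. i < n \<Longrightarrow> \<psi> i v = 0) \<Longrightarrow> v = 0"
  using expand[of v] by simp

lemma \<psi>_gl: "x \<in> gl s \<Longrightarrow> i < n \<Longrightarrow> \<psi> i (x v) = (\<Sum>l<n. \<psi> l v * \<psi> i (x (b l)))"
  using arg_cong[OF expand[of v], of "\<lambda>v. \<psi> i (x v)"]
  by (simp only: gl_sum gl_scale \<psi>_sum \<psi>_scale)

lemma subspace_gl: "E.subspace (gl s)"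
  unfolding E.subspace_def
  by (auto simp: mem_gl fun_scale_def scale_right_distrib mult.commute add_ac)

lemmas gl_closed = E.subspace_sum[OF subspace_gl] E.subspace_scale[OF subspace_gl]

lemma gl_comp: "x \<in> gl s \<Longrightarrow> y \<in> gl s \<Longrightarrow> x \<circ> y \<in> gl s"
  by (simp add: mem_gl)

lemma gl_comp_add: "x \<in> gl s \<Longrightarrow> x \<circ> (y + z) = (x \<circ> y) + (x \<circ> z)"
  and gl_comp_diff: "x \<in> gl s \<Longrightarrow> x \<circ> (y - z) = (x \<circ> y) - (x \<circ> z)"
  and gl_comp_scale: "x \<in> gl s \<Longrightarrow> x \<circ> fun_scale s c y = fun_scale s c (x \<circ> y)"
  by (simp_all add: fun_eq_iff gl_add gl_diff gl_scale fun_scale_def)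

lemma centraliser_subset_gl: "centraliser s e \<subseteq> gl s"
  by (auto simp: centraliser_def)

definition tr :: "('v \<Rightarrow> 'v) \<Rightarrow> 'f" where
  "tr x = (\<Sum>i<n. \<psi> i (x (b i)))"

lemma tr_add: "tr (x + y) = tr x + tr y"
  and tr_diff: "tr (x - y) = tr x - tr y"
  and tr_scale: "tr (fun_scale s c x) = c * tr x"
  by (simp_all add: tr_def \<psi>_add \<psi>_diff \<psi>_scale fun_scale_def sum.distrib sum_subtractf sum_distrib_left)

lemma tr_comp_commute:
  assumes "x \<in> gl s" and "y \<in> gl s"
  shows "tr (x \<circ> y) = tr (y \<circ> x)"
proof -
  have *: "tr (x \<circ> y) = (\<Sum>i<n. \<Sum>l<n. \<psi> l (y (b i)) * \<psi> i (x (b l)))" if "x \<in> gl s" for x y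
    unfolding tr_def comp_def by (intro sum.cong refl \<psi>_gl[OF that]) simp
  show ?thesis
    unfolding *[OF assms(1)] *[OF assms(2)] by (subst sum.swap) (simp add: mult.commute)
qed

text \<open>The Kirillov form on \<open>gl s\<close> of the functional
  \<open>tr (A \<circ> x)\<close> in \<open>x\<close>.\<close>

definition form :: "('v \<Rightarrow> 'v) \<Rightarrow> ('v \<Rightarrow> 'v) \<Rightarrow> ('v \<Rightarrow> 'v) \<Rightarrow> 'f" where
  "form A x y = tr (A \<circ> commutator x y)"

lemma form_eq:
  assumes "A \<in> gl s"
  shows "form A x y = tr (A \<circ> x \<circ> y) - tr (A \<circ> y \<circ> x)"
  unfolding form_def commutator_def gl_comp_diff[OF assms] tr_diff by (simp only: comp_assoc)

lemma form_swap: "A \<in> gl s \<Longrightarrow> form A x y = - form A y x"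
  by (simp add: form_eq)

lemma form_add_right:
  assumes "A \<in> gl s" and "x \<in> gl s"
  shows "form A x (y + z) = form A x y + form A x z"
  unfolding form_eq[OF assms(1)] gl_comp_add[OF gl_comp[OF assms]] gl_comp_add[OF assms(1)]
    comp_add_left tr_add by simp

lemma form_scale_right:
  assumes "A \<in> gl s" and "x \<in> gl s"
  shows "form A x (fun_scale s c y) = c * form A x y"
proof -
  have "fun_scale s c y \<circ> x = fun_scale s c (y \<circ> x)"
    by (simp add: fun_eq_iff fun_scale_def)
  then have "tr (A \<circ> fun_scale s c y \<circ> x) = c * tr (A \<circ> y \<circ> x)"
    unfolding comp_assoc by (simp only: gl_comp_scale[OF assms(1)] tr_scale)
  moreover have "tr (A \<circ> x \<circ> fun_scale s c y) = c * tr (A \<circ> x \<circ> y)"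
    by (simp only: gl_comp_scale[OF gl_comp[OF assms]] tr_scale)
  ultimately show ?thesis
    by (simp only: form_eq[OF assms(1)] right_diff_distrib)
qed

lemma form_0_right: "A \<in> gl s \<Longrightarrow> x \<in> gl s \<Longrightarrow> form A x 0 = 0"
  using form_scale_right[of A x 0 0] by (simp only: E.scale_zero_left mult_zero_left)

lemma form_sum_right:
  assumes "A \<in> gl s" and "x \<in> gl s"
  shows "form A x (\<Sum>j\<in>I. fun_scale s (c j) (z j)) = (\<Sum>j\<in>I. c j * form A x (z j))"
  by (induction I rule: infinite_finite_induct)
    (simp_all only: sum_recursion
      form_0_right form_add_right form_scale_right assms)

lemma form_span_zero:
  assumes "A \<in> gl s" and "v \<in> gl s" and "x \<in> E.span S" and "\<And>z. z \<in> S \<Longrightarrow> form A z v = 0"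
  shows "form A x v = 0"
  using assms(3)
proof (induction rule: E.span_induct_alt)
  case base
  show ?case
    unfolding form_swap[OF assms(1), of 0 v] form_0_right[OF assms(1,2)] by (rule minus_zero)
next
  case (step c x y)
  have "form A v (fun_scale s c x + y) = c * form A v x + form A v y"
    by (simp only: form_add_right form_scale_right assms(1,2))
  then show ?case
    unfolding form_swap[OF assms(1), of _ v] using step assms(4)[of x] form_swap[OF assms(1), of v]
    by (metis add_0_right minus_zero mult_zero_right neg_equal_0_iff_equal)
qed

text \<open>Cyclicity of the trace: whatever commutes with \<open>A\<close> lies in the radical of
  its form.\<close>

lemma form_commuting:
  assumes "A \<in> gl s" and "x \<in> gl s" and "v \<in> gl s" and "v \<circ> A = A \<circ> v"
  shows "form A x v = 0"
proof -
  have "tr (A \<circ> x \<circ> v) = tr (v \<circ> (A \<circ> x))"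
    by (intro tr_comp_commute gl_comp assms)
  then show ?thesis
    using assms(4) by (simp only: form_eq[OF assms(1)] comp_assoc[symmetric] diff_self)
qed

lemma mem_centraliser: "x \<in> centraliser s e \<longleftrightarrow> x \<in> gl s \<and> x \<circ> e = e \<circ> x"
  by (simp add: centraliser_def commutator_def)

definition unit :: "nat \<Rightarrow> nat \<Rightarrow> 'v \<Rightarrow> 'v" where
  "unit i j v = \<psi> j v *s b i"

lemma unit_gl: "j < n \<Longrightarrow> unit i j \<in> gl s"
  by (simp add: mem_gl unit_def \<psi>_add \<psi>_scale scale_left_distrib)

lemma gl_eq_sum_unit:
  assumes "x \<in> gl s"
  shows "x = (\<Sum>j<n. \<Sum>i<n. fun_scale s (\<psi> i (x (b j))) (unit i j))"
proof
  fix v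
  have "x v = (\<Sum>j<n. \<psi> j v *s x (b j))"
    using arg_cong[OF expand[of v], of x] by (simp only: gl_sum[OF assms] gl_scale[OF assms])
  also have "\<dots> = (\<Sum>j<n. \<psi> j v *s (\<Sum>i<n. \<psi> i (x (b j)) *s b i))"
    by (simp only: expand[symmetric])
  also have "\<dots> = (\<Sum>j<n. \<Sum>i<n. fun_scale s (\<psi> i (x (b j))) (unit i j)) v"
    by (simp add: sum_fun_apply fun_scale_def unit_def scale_sum_right mult.commute)
  finally show "x v = \<dots>" .
qed

lemma gl_finite_span: "\<exists>Z. finite Z \<and> gl s \<subseteq> E.span Z"
proof (intro exI conjI)
  let ?Z = "(\<lambda>(i, j). unit i j) ` ({..<n} \<times> {..<n})"
  show "finite ?Z"
    by simp
  show "gl s \<subseteq> E.span ?Z"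
  proof
    fix x assume "x \<in> gl s"
    then show "x \<in> E.span ?Z"
      by (subst gl_eq_sum_unit, assumption, intro E.span_sum E.span_scale E.span_base) auto
  qed
qed

lemma tr_unit:
  assumes "i < n" and "j < n"
  shows "tr (unit i j \<circ> x) = \<psi> j (x (b i))"
proof -
  have "tr (unit i j \<circ> x) = (\<Sum>l<n. if l = i then \<psi> j (x (b l)) else 0)"
    unfolding tr_def comp_def unit_def using assms by (intro sum.cong) (auto simp: \<psi>_scale \<psi>_b)
  then show ?thesis
    using assms by simp
qed

lemma functional_eq_tr:
  assumes add: "\<And>x y. \<Lambda> (x + y) = \<Lambda> x + \<Lambda> y" and scale: "\<And>c x. \<Lambda> (fun_scale s c x) = c * \<Lambda> x"
  shows "\<exists>y\<in>gl s. \<forall>x\<in>gl s. \<Lambda> x = tr (y \<circ> x)"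
proof (intro bexI ballI)
  \<comment> \<open>The transposed matrix of the values of \<open>\<Lambda>\<close> on matrix units:
    entry \<open>(j, i)\<close> is \<open>\<Lambda> (unit i j)\<close>.\<close>
  let ?y = "\<lambda>v. \<Sum>i<n. \<Sum>j<n. (\<psi> i v * \<Lambda> (unit i j)) *s b j"
  show y: "?y \<in> gl s"
    by (simp add: mem_gl \<psi>_add \<psi>_scale scale_left_distrib distrib_right sum.distrib scale_sum_right mult.assoc)
  fix x assume x: "x \<in> gl s"
  have "\<Lambda> 0 = 0"
    using add[of 0 0] by simp
  then have sum: "\<Lambda> (\<Sum>i\<in>I. f i) = (\<Sum>i\<in>I. \<Lambda> (f i))" for I :: "nat set" and f
    by (induction I rule: infinite_finite_induct)
      (simp_all only: sum_recursion add)
  have "\<psi> j (?y v) = (\<Sum>i<n. \<psi> i v * \<Lambda> (unit i j))" if j: "j < n" for j v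
  proof -
    have "\<psi> j (?y v) = (\<Sum>i<n. \<Sum>l<n. if l = j then \<psi> i v * \<Lambda> (unit i l) else 0)"
      unfolding \<psi>_sum[OF j] \<psi>_scale[OF j] using j by (intro sum.cong) (auto simp: \<psi>_b)
    then show ?thesis
      using j by simp
  qed
  then have "tr (?y \<circ> x) = (\<Sum>j<n. \<Sum>i<n. \<psi> i (x (b j)) * \<Lambda> (unit i j))"
    by (simp add: tr_def)
  also have "\<dots> = \<Lambda> x"
    using arg_cong[OF gl_eq_sum_unit[OF x], of \<Lambda>] by (simp only: sum scale)
  finally show "\<Lambda> x = tr (?y \<circ> x)"
    by simp
qed

text \<open>The converse of \<open>form_commuting\<close>: pairing with the matrix units reads off
  the entries of the commutator of \<open>v\<close> and \<open>e\<close>.\<close>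

lemma mem_centraliser_if_form_zero:
  assumes "e \<in> gl s" and "v \<in> gl s" and "\<And>z. z \<in> gl s \<Longrightarrow> form e z v = 0"
  shows "v \<in> centraliser s e"
proof -
  have *: "\<psi> j (v (e (b i))) = \<psi> j (e (v (b i)))" if "i < n" "j < n" for i j
  proof -
    let ?z = "unit i j"
    have z: "?z \<in> gl s"
      using that by (simp add: unit_gl)
    have "tr (e \<circ> ?z \<circ> v) = tr (?z \<circ> v \<circ> e)"
      using tr_comp_commute[of e "?z \<circ> v"] z assms by (simp add: gl_comp comp_assoc)
    moreover have "tr (e \<circ> v \<circ> ?z) = tr (?z \<circ> e \<circ> v)"
      using tr_comp_commute[of "e \<circ> v" ?z] z assms by (simp add: gl_comp comp_assoc)
    ultimately have "tr (?z \<circ> (v \<circ> e)) = tr (?z \<circ> (e \<circ> v))"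
      using assms(3)[OF z] by (simp add: form_eq[OF assms(1)] comp_assoc)
    then show ?thesis
      using that assms by (simp add: tr_unit gl_comp)
  qed
  have "v (e u) = e (v u)" for u
  proof -
    have "\<psi> j (v (e u) - e (v u)) = 0" if j: "j < n" for j
    proof -
      have "\<psi> j ((v \<circ> e) u) = \<psi> j ((e \<circ> v) u)"
      proof -
        have "\<psi> j ((v \<circ> e) u) = (\<Sum>l<n. \<psi> l u * \<psi> j ((v \<circ> e) (b l)))"
          by (rule \<psi>_gl[OF gl_comp[OF assms(2,1)] j])
        also have "\<dots> = (\<Sum>l<n. \<psi> l u * \<psi> j ((e \<circ> v) (b l)))"
          using * j by (intro sum.cong) auto
        also have "\<dots> = \<psi> j ((e \<circ> v) u)"
          by (rule \<psi>_gl[OF gl_comp[OF assms(1,2)] j, symmetric])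
        finally show ?thesis .
      qed
      then show ?thesis
        using j by (simp add: \<psi>_diff)
    qed
    then show ?thesis
      using eq_0_if_\<psi>_eq_0[of "v (e u) - e (v u)"] by simp
  qed
  then show ?thesis
    using assms(2) by (simp add: mem_centraliser fun_eq_iff)
qed

text \<open>The regular nilpotent of the chosen basis, a single Jordan block with cyclic vector
  \<open>b 0\<close>.\<close>

definition shift :: "'v \<Rightarrow> 'v" where
  "shift v = (\<Sum>i<n - 1. \<psi> i v *s b (Suc i))"

lemma shift_gl: "shift \<in> gl s"
  by (simp add: mem_gl shift_def \<psi>_add \<psi>_scale scale_left_distrib sum.distrib scale_sum_right)

lemma shift_b: "Suc i < n \<Longrightarrow> shift (b i) = b (Suc i)"
proof -
  assume i: "Suc i < n"
  have "shift (b i) = (\<Sum>j<n - 1. if j = i then b (Suc j) else 0)"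
    unfolding shift_def using i by (intro sum.cong) (auto simp: \<psi>_b)
  also have "\<dots> = b (Suc i)"
    using i by (simp add: less_diff_conv)
  finally show ?thesis .
qed

lemma shift_power: "i < n \<Longrightarrow> (shift ^^ i) (b 0) = b i"
  by (induction i) (auto simp: shift_b)

lemma funpow_gl: "x \<in> gl s \<Longrightarrow> x ^^ i \<in> gl s"
  by (induction i) (auto simp: mem_gl)

end

section \<open>Vinberg's inequality by a one-parameter degeneration\<close>

lemma sum_lessThan_add: "(\<Sum>i<m + n. f i) = (\<Sum>i<m. f i) + (\<Sum>i<n. f (m + i))"
  for f :: "nat \<Rightarrow> 'a::comm_monoid_add"
  by (induction n) (simp_all add: add.assoc)

lemma extend_functional:
  fixes s :: "'f::field \<Rightarrow> 'v::ab_group_add \<Rightarrow> 'v"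
  assumes "vector_space s" and "\<not> module.dependent s B"
  shows "\<exists>\<Lambda>. (\<forall>x y. \<Lambda> (x + y) = \<Lambda> x + \<Lambda> y) \<and> (\<forall>c x. \<Lambda> (s c x) = c * \<Lambda> x) \<and> (\<forall>x\<in>B. \<Lambda> x = f x)"
proof -
  have "vector_space ((*) :: 'f \<Rightarrow> 'f \<Rightarrow> 'f)"
    by (rule vector_space.intro) (simp_all add: algebra_simps)
  then have P: "vector_space_pair s ((*) :: 'f \<Rightarrow> 'f \<Rightarrow> 'f)"
    using assms(1) by (rule vector_space_pair.intro[rotated])
  obtain \<Lambda> where \<Lambda>: "Vector_Spaces.linear s (*) \<Lambda>" "\<forall>x\<in>B. \<Lambda> x = f x"
    using vector_space_pair.linear_independent_extend[OF P assms(2), of f] by (elim exE conjE) (rule that)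
  show ?thesis
    using vector_space_pair.linear_add[OF P \<Lambda>(1)] vector_space_pair.linear_scale[OF P \<Lambda>(1)] \<Lambda>(2)
    by (intro exI[of _ \<Lambda>]) simp
qed

context coordinates
begin

lemma form_add_operator: "form (A + B) x z = form A x z + form B x z"
  by (simp only: form_def comp_add_left tr_add)

lemma form_scale_operator: "form (fun_scale s c A) x z = c * form A x z"
proof -
  have "fun_scale s c A \<circ> commutator x z = fun_scale s c (A \<circ> commutator x z)"
    by (simp add: fun_eq_iff fun_scale_def)
  then show ?thesis
    by (simp only: form_def tr_scale)
qed

lemma form_centraliser:
  assumes "e \<in> gl s" and "x \<in> centraliser s e" and "z \<in> gl s"
  shows "form e x z = 0"
proof -
  have "form e z x = 0"
    using assms by (intro form_commuting) (auto simp: mem_centraliser)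
  then show ?thesis
    unfolding form_swap[OF assms(1), of x] by simp
qed

text \<open>To first order at 0 this is \<open>e + t y\<close>, and at 1 it is \<open>shift\<close>.
  The weight of \<open>shift\<close> is a square because a linear term would survive at
  \<open>t = 0\<close> once the rows in the centraliser are divided by \<open>t\<close>.\<close>

definition pencil :: "('v \<Rightarrow> 'v) \<Rightarrow> ('v \<Rightarrow> 'v) \<Rightarrow> 'f \<Rightarrow> 'v \<Rightarrow> 'v" where
  "pencil e y t = fun_scale s (1 - t\<^sup>2) (e + fun_scale s t y) + fun_scale s (t\<^sup>2) shift"

lemma pencil_gl: "e \<in> gl s \<Longrightarrow> y \<in> gl s \<Longrightarrow> pencil e y t \<in> gl s"
  unfolding pencil_def
  by (intro E.subspace_add[OF subspace_gl] E.subspace_scale[OF subspace_gl] shift_gl)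

lemma form_pencil:
  "form (pencil e y t) x z = (1 - t\<^sup>2) * (form e x z + t * form y x z) + t\<^sup>2 * form shift x z"
  by (simp only: pencil_def form_add_operator form_scale_operator)

text \<open>
  At \<open>t = 1\<close> the pencil is the regular nilpotent \<open>shift\<close>, so its first \<open>n\<close> powers are linearly
  independent for all but finitely many \<open>t\<close>.
\<close>

lemma pencil_powers_independent:
  assumes "e \<in> gl s" and "y \<in> gl s"
  shows "\<exists>p. p \<noteq> 0 \<and> (\<forall>t. poly p t \<noteq> 0 \<longrightarrow> (\<forall>c. (\<Sum>i<n. fun_scale s (c i) (pencil e y t ^^ i)) = 0 \<longrightarrow>
    (\<forall>i<n. c i = 0)))"
proof -
  define a where "a j l = [:1, 0, -1:] * ([:\<psi> j (e (b l)):] + [:0, \<psi> j (y (b l)):]) + [:0, 0, \<psi> j (shift (b l)):]" for j l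
  have a: "poly (a j l) t = \<psi> j (pencil e y t (b l))" if "j < n" for j l t
    unfolding a_def pencil_def fun_scale_def plus_fun_apply using that
    by (simp only: \<psi>_add \<psi>_scale) (simp add: algebra_simps power2_eq_square)
  \<comment> \<open>\<open>P i j\<close> is coordinate \<open>j\<close> of the \<open>i\<close>-th
    power of the pencil applied to \<open>b 0\<close>, as a polynomial in \<open>t\<close>; the
    recursion multiplies by the matrix \<open>a\<close>.\<close>
  define P where "P = rec_nat (\<lambda>j. if j = 0 then 1 else 0) (\<lambda>i p j. \<Sum>l<n. p l * a j l)"
  have P: "poly (P i j) t = \<psi> j ((pencil e y t ^^ i) (b 0))" if "j < n" for i j t
    using that
  proof (induction i arbitrary: j)
    case 0
    then show ?case
      by (auto simp: P_def \<psi>_b)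
  next
    case (Suc i)
    have "poly (P (Suc i) j) t = (\<Sum>l<n. poly (P i l) t * poly (a j l) t)"
      by (simp add: P_def poly_sum)
    also have "\<dots> = (\<Sum>l<n. \<psi> l ((pencil e y t ^^ i) (b 0)) * \<psi> j (pencil e y t (b l)))"
      using Suc a by (intro sum.cong) auto
    also have "\<dots> = \<psi> j (pencil e y t ((pencil e y t ^^ i) (b 0)))"
      using pencil_gl[OF assms] Suc.prems by (intro \<psi>_gl[symmetric])
    finally show ?case
      by simp
  qed
  \<comment> \<open>A relation between the powers is also one between their values at
    \<open>b 0\<close>, so it suffices that these have nonzero determinant. At \<open>t = 1\<close>
    they are the basis itself.\<close>
  define p where "p = det (mat n n (\<lambda>(j, i). P i j))"
  have poly_p: "poly p t = det (mat n n (\<lambda>(j, i). \<psi> j ((pencil e y t ^^ i) (b 0))))" for t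
    unfolding p_def poly_det_mat by (intro arg_cong[of _ _ det] cong_mat) (auto simp: P)
  have "pencil e y 1 = shift"
    by (simp add: pencil_def fun_scale_def fun_eq_iff)
  then have "poly p 1 = det (mat n n (\<lambda>(j, i). \<psi> j ((shift ^^ i) (b 0))))"
    by (simp only: poly_p)
  also have "\<dots> \<noteq> 0"
  proof
    assume "det (mat n n (\<lambda>(j, i). \<psi> j ((shift ^^ i) (b 0)))) = 0"
    then obtain c where c: "\<exists>i<n. c i \<noteq> 0" "\<And>j. j < n \<Longrightarrow> (\<Sum>i<n. \<psi> j ((shift ^^ i) (b 0)) * c i) = 0"
      unfolding det_mat_eq_0_iff by blast
    have "c j = 0" if j: "j < n" for j
    proof -
      have "(\<Sum>i<n. \<psi> j ((shift ^^ i) (b 0)) * c i) = (\<Sum>i<n. if i = j then c i else 0)"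
        using j by (intro sum.cong) (auto simp: shift_power \<psi>_b)
      then show ?thesis
        using c(2)[OF j] j by simp
    qed
    then show False
      using c(1) by blast
  qed
  finally have "p \<noteq> 0"
    by auto
  moreover have "c i = 0" if t: "poly p t \<noteq> 0" and c: "(\<Sum>i<n. fun_scale s (c i) (pencil e y t ^^ i)) = 0" and i: "i < n" for t c i
  proof (rule ccontr)
    assume "c i \<noteq> 0"
    have "(\<Sum>i<n. \<psi> j ((pencil e y t ^^ i) (b 0)) * c i) = 0" if j: "j < n" for j
    proof -
      have "(\<Sum>i<n. c i *s (pencil e y t ^^ i) (b 0)) = 0"
        using fun_cong[OF c, of "b 0"] by (simp add: sum_fun_apply fun_scale_def)
      then have "\<psi> j (\<Sum>i<n. c i *s (pencil e y t ^^ i) (b 0)) = 0"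
        using j by (simp add: \<psi>_0)
      then show ?thesis
        using j by (simp add: \<psi>_sum \<psi>_scale mult.commute)
    qed
    then have "poly p t = 0"
      unfolding poly_p det_mat_eq_0_iff using \<open>c i \<noteq> 0\<close> i by blast
    then show False
      using t by contradiction
  qed
  ultimately show ?thesis
    by blast
qed

text \<open>
  Vinberg's inequality. With \<open>\<gamma> = tr (y \<cdot>)\<close> on the centraliser \<open>\<gg>\<^sub>e\<close>, the form of \<open>e + t y\<close> on
  \<open>\<gg>\<ll>\<close> degenerates at \<open>t = 0\<close>, on a complement of the stabiliser of \<open>\<gamma>\<close>, to a nondegenerate one once
  the rows in \<open>\<gg>\<^sub>e\<close> have been divided by \<open>t\<close>. So its rank would exceed \<open>n\<^sup>2 - n\<close> if the stabiliser had
  dimension less than \<open>n\<close>, contradicting that \<open>n\<close> independent powers commute with a generic member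
  of the pencil. The term with \<open>shift\<close> makes the pencil generically regular.
\<close>

theorem dim_stabiliser_ge:
  assumes e: "e \<in> gl s" and \<gamma>: "\<gamma> \<in> dual (fun_scale s) (centraliser s e)"
  shows "n \<le> E.dim (stabiliser commutator (centraliser s e) \<gamma>)"
proof (rule ccontr)
  let ?g = "centraliser s e"
  let ?S = "stabiliser commutator ?g \<gamma>"
  assume less: "\<not> ?thesis"
  have \<gamma>_add: "\<gamma> (x + y) = \<gamma> x + \<gamma> y" and \<gamma>_scale: "\<gamma> (fun_scale s c x) = c * \<gamma> x"
    if "x \<in> ?g" "y \<in> ?g" for x y c
    using \<gamma> that by (auto simp: dual_def)
  have sub_g: "E.subspace ?g"
    by (rule subspace_centraliser[OF vector_space_axioms e])
  have \<gamma>_0: "\<gamma> 0 = 0"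
    using \<gamma>_scale[OF E.subspace_0[OF sub_g] E.subspace_0[OF sub_g], of 0] by (simp only: E.scale_zero_left mult_zero_left)
  \<comment> \<open>Nested bases \<open>BS\<close>, \<open>BG\<close>, \<open>BL\<close> of the
    stabiliser, the centraliser and \<open>gl s\<close>; below, \<open>Q\<close> spans a complement
    of the stabiliser in \<open>gl s\<close>.\<close>
  obtain BS where BS: "BS \<subseteq> ?S" "E.independent BS" "?S \<subseteq> E.span BS" "card BS = E.dim ?S"
    by (rule E.basis_exists)
  have "BS \<subseteq> ?g"
    using BS(1) by (auto simp: stabiliser_def)
  then obtain BG where BG: "BS \<subseteq> BG" "BG \<subseteq> ?g" "E.independent BG" "?g \<subseteq> E.span BG"
    using E.maximal_independent_subset_extend[OF _ BS(2), of ?g] by metis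
  then obtain BL where BL: "BG \<subseteq> BL" "BL \<subseteq> gl s" "E.independent BL" "gl s \<subseteq> E.span BL"
    using E.maximal_independent_subset_extend[OF subset_trans[OF BG(2) centraliser_subset_gl] BG(3)] by metis
  have finBL: "finite BL"
  proof -
    obtain Z where "finite Z" "gl s \<subseteq> E.span Z"
      using gl_finite_span by blast
    then show ?thesis
      using E.independent_span_bound[of Z BL] BL(2,3) by blast
  qed
  define Q where "Q = BL - BS"
  define m where "m = card Q"
  have finQ: "finite Q" and finBS: "finite BS"
    using finBL BL(1) BG(1) by (auto simp: Q_def intro: finite_subset)
  obtain q where q: "bij_betw q {..<m} Q"
    using ex_bij_betw_nat_finite[OF finQ] unfolding m_def lessThan_atLeast0 by blast
  have qQ: "q i \<in> Q" if "i < m" for i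
    using q that by (auto simp: bij_betw_def)
  have Qq: "\<exists>i<m. z = q i" if "z \<in> Q" for z
    using q that by (auto simp: bij_betw_def image_iff)
  have q_gl: "q i \<in> gl s" if "i < m" for i
    using qQ[OF that] BL(2) by (auto simp: Q_def)
  have card: "card BL < m + n"
  proof -
    have "card BL = m + card BS"
      unfolding m_def Q_def using finBL finBS BG(1) BL(1)
      by (simp add: card_Diff_subset card_mono subset_trans[OF BG(1) BL(1)])
    then show ?thesis
      using less BS(4) by simp
  qed
  \<comment> \<open>Only the extension of \<open>\<gamma>\<close> from the centraliser to all
    endomorphisms can be written as a trace against some \<open>y\<close>.\<close>
  have "\<exists>\<Lambda>. (\<forall>x z. \<Lambda> (x + z) = \<Lambda> x + \<Lambda> z) \<and> (\<forall>c x. \<Lambda> (fun_scale s c x) = c * \<Lambda> x) \<and> (\<forall>x\<in>BG. \<Lambda> x = \<gamma> x)"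
    using BG(3) by (rule extend_functional[OF E.vector_space_axioms])
  then obtain \<Lambda> where \<Lambda>_ex: "(\<forall>x z. \<Lambda> (x + z) = \<Lambda> x + \<Lambda> z) \<and> (\<forall>c x. \<Lambda> (fun_scale s c x) = c * \<Lambda> x) \<and> (\<forall>x\<in>BG. \<Lambda> x = \<gamma> x)" ..
  then have \<Lambda>_add: "\<Lambda> (x + z) = \<Lambda> x + \<Lambda> z" and \<Lambda>_scale: "\<Lambda> (fun_scale s c x) = c * \<Lambda> x"
    and \<Lambda>: "x \<in> BG \<Longrightarrow> \<Lambda> x = \<gamma> x" for x z c
    by simp_all
  have \<Lambda>_0: "\<Lambda> 0 = 0"
    using \<Lambda>_scale[of 0 0] by (simp only: E.scale_zero_left mult_zero_left)
  obtain y where y: "y \<in> gl s" "\<forall>x\<in>gl s. \<Lambda> x = tr (y \<circ> x)"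
    using functional_eq_tr[of \<Lambda>, OF \<Lambda>_add \<Lambda>_scale] by (elim bexE) (rule that)
  have form_y: "form y x z = \<gamma> (commutator x z)" if "x \<in> ?g" "z \<in> ?g" for x z
  proof -
    have *: "x \<in> ?g \<and> \<Lambda> x = \<gamma> x" if "x \<in> E.span BG" for x
      using that
    proof (induction rule: E.span_induct_alt)
      case base
      show ?case
        using E.subspace_0[OF sub_g] \<gamma>_0 \<Lambda>_0 by (simp only: simp_thms)
    next
      case (step c x z)
      then have x: "x \<in> ?g" "fun_scale s c x \<in> ?g"
        using BG(2) E.subspace_scale[OF sub_g] by auto
      then have "\<Lambda> (fun_scale s c x + z) = \<gamma> (fun_scale s c x + z)"
        using step \<Lambda>[OF step(1)] by (simp only: \<gamma>_add \<gamma>_scale \<Lambda>_add \<Lambda>_scale)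
      then show ?case
        using E.subspace_add[OF sub_g x(2)] step by blast
    qed
    have "commutator x z \<in> ?g"
      by (rule commutator_mem_centraliser[OF vector_space_axioms e that])
    then show ?thesis
      using * BG(4) y(2) centraliser_subset_gl unfolding form_def by (metis subsetD)
  qed
  \<comment> \<open>The Gram matrix of the pencil on \<open>Q\<close>, with the rows in the
    centraliser divided by \<open>t\<close>. The division is possible since the form of
    \<open>e\<close> vanishes on these rows.\<close>
  define F where "F i j = (if q i \<in> BG then [:1, 0, -1:] * [:form y (q i) (q j):] + [:0, form shift (q i) (q j):]
      else [:1, 0, -1:] * ([:form e (q i) (q j):] + [:0, form y (q i) (q j):]) + [:0, 0, form shift (q i) (q j):])" for i j
  have F: "form (pencil e y t) (q i) (q j) = (if q i \<in> BG then t else 1) * poly (F i j) t" if "i < m" "j < m" for i j t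
    unfolding form_pencil F_def using form_centraliser[OF e, of "q i" "q j"] q_gl[OF that(2)] BG(2)
    by (auto simp: algebra_simps power2_eq_square)
  define f where "f = det (mat m m (\<lambda>(i, j). F i j))"
  have poly_f: "poly f t = det (mat m m (\<lambda>(i, j). poly (F i j) t))" for t
    unfolding f_def poly_det_mat ..
  \<comment> \<open>Let \<open>v\<close> be a kernel vector at \<open>t = 0\<close>. The rows
    outside \<open>BG\<close> put it into the centraliser and the other rows into the stabiliser;
    being a combination of \<open>Q\<close>, which avoids \<open>BS\<close>, it is 0.\<close>
  have "poly f 0 \<noteq> 0"
  proof
    assume "poly f 0 = 0"
    then obtain c where c: "\<exists>i<m. c i \<noteq> 0" "\<And>i. i < m \<Longrightarrow> (\<Sum>j<m. poly (F i j) 0 * c j) = 0"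
      unfolding poly_f det_mat_eq_0_iff by blast
    define v where "v = (\<Sum>j<m. fun_scale s (c j) (q j))"
    have v_gl: "v \<in> gl s"
      unfolding v_def using q_gl by (intro gl_closed) auto
    have y_v: "form y (q i) v = 0" if "i < m" "q i \<in> BG" for i
      using c(2)[OF that(1)] that(2) unfolding v_def
      by (simp add: form_sum_right y(1) q_gl[OF that(1)] F_def mult.commute)
    have e_v: "form e (q i) v = 0" if "i < m" "q i \<notin> BG" for i
      using c(2)[OF that(1)] that(2) unfolding v_def
      by (simp add: form_sum_right e q_gl[OF that(1)] F_def mult.commute)
    have "form e z v = 0" if z: "z \<in> BL" for z
    proof (cases "z \<in> BG")
      case True
      then show ?thesis
        using form_centraliser[OF e _ v_gl] BG(2) by blast
    next
      case False
      then have "z \<in> Q"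
        using z BG(1) by (auto simp: Q_def)
      then show ?thesis
        using Qq e_v False by blast
    qed
    then have "form e z v = 0" if "z \<in> gl s" for z
      using form_span_zero[OF e v_gl, of z BL] BL(4) that by blast
    then have v_g: "v \<in> ?g"
      by (rule mem_centraliser_if_form_zero[OF e v_gl])
    have rep: "E.representation BL v (q j) = c j" if j: "j < m" for j
    proof -
      have inBL: "q i \<in> BL" if "i < m" for i
        using qQ[OF that] by (simp add: Q_def)
      have "E.representation BL v (q j) = (\<Sum>i<m. E.representation BL (fun_scale s (c i) (q i)) (q j))"
      proof -
        have "fun_scale s (c i) (q i) \<in> E.span BL" if "i \<in> {..<m}" for i
          using that inBL by (intro E.span_scale E.span_base) simp
        then show ?thesis
          unfolding v_def by (rule fun_cong[OF E.representation_sum[OF BL(3)]])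
      qed
      also have "\<dots> = (\<Sum>i<m. if i = j then c i else 0)"
      proof (intro sum.cong refl)
        fix i assume "i \<in> {..<m}"
        then have i: "i < m"
          by simp
        have "E.representation BL (fun_scale s (c i) (q i)) (q j) = c i * E.representation BL (q i) (q j)"
          by (rule fun_cong[OF E.representation_scale[OF BL(3) E.span_base[OF inBL[OF i]]]])
        also have "E.representation BL (q i) (q j) = (if q j = q i then 1 else 0)"
          unfolding E.representation_basis[OF BL(3) inBL[OF i]] ..
        also have "q j = q i \<longleftrightarrow> i = j"
          using q i j by (auto simp: bij_betw_def inj_on_def)
        finally show "E.representation BL (fun_scale s (c i) (q i)) (q j) = (if i = j then c i else 0)"
          by simp
      qed
      finally show ?thesis
        using j by simp
    qed
    have "\<gamma> (commutator z v) = 0" if z: "z \<in> BG" for z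
    proof (cases "z \<in> BS")
      case True
      then show ?thesis
        using BS(1) v_g by (auto simp: stabiliser_def)
    next
      case False
      then obtain i where i: "i < m" "z = q i"
        using Qq[of z] z BL(1) by (auto simp: Q_def)
      then show ?thesis
        using y_v z form_y[of z v] BG(2) v_g by auto
    qed
    then have "form y z v = 0" if "z \<in> BG" for z
      using form_y that BG(2) v_g by auto
    then have "form y z v = 0" if "z \<in> ?g" for z
      using form_span_zero[OF y(1) v_gl, of z BG] BG(4) that by blast
    then have "form y v z = 0" if "z \<in> ?g" for z
      unfolding form_swap[OF y(1), of v] using that by simp
    then have "v \<in> ?S"
      using form_y v_g by (auto simp: stabiliser_def)
    then have v: "v \<in> E.span BS"
      using BS(3) by blast
    have "E.representation BL v = E.representation BS v"
      using E.representation_extend[OF BL(3) v] BG(1) BL(1) by blast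
    moreover have "E.representation BS v (q j) = 0" if "j < m" for j
      using qQ[OF that] E.representation_ne_zero by (auto simp: Q_def)
    ultimately show False
      using rep c(1) by auto
  qed
  then have "f \<noteq> 0"
    by auto
  obtain p where p: "p \<noteq> 0" "\<And>t c i. poly p t \<noteq> 0 \<Longrightarrow> (\<Sum>i<n. fun_scale s (c i) (pencil e y t ^^ i)) = 0 \<Longrightarrow>
    i < n \<Longrightarrow> c i = 0"
    using pencil_powers_independent[OF e y(1)] by blast
  \<comment> \<open>The last factor ensures \<open>t \<noteq> 0\<close>, so that the division of
    rows by \<open>t\<close> can be undone.\<close>
  have "f * p * [:0, 1:] \<noteq> 0"
    using \<open>f \<noteq> 0\<close> p(1) by simp
  then obtain t where t: "poly (f * p * [:0, 1:]) t \<noteq> 0"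
    using poly_roots_finite infinite_UNIV_char_0 by (metis (mono_tags, lifting) UNIV_I finite_subset mem_Collect_eq subsetI)
  let ?A = "pencil e y t"
  have A: "?A \<in> gl s"
    by (rule pencil_gl[OF e y(1)])
  \<comment> \<open>The basis of the complement together with the first \<open>n\<close> powers:
    these are \<open>m + n\<close> vectors, too many if the stabiliser has dimension less than
    \<open>n\<close>.\<close>
  define h where "h i = (if i < m then q i else ?A ^^ (i - m))" for i
  have "h i \<in> E.span BL" if "i < m + n" for i
    using BL(4) q_gl funpow_gl[OF A] unfolding h_def by auto
  then obtain c where c: "\<exists>i<m + n. c i \<noteq> 0" "(\<Sum>i<m + n. fun_scale s (c i) (h i)) = 0"
    using E.family_dependent[OF finBL, of "m + n" h] card by blast
  define v where "v = (\<Sum>i<m. fun_scale s (c i) (q i))"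
  define u where "u = (\<Sum>i<n. fun_scale s (c (m + i)) (?A ^^ i))"
  have "(\<Sum>i<m + n. fun_scale s (c i) (h i)) = v + u"
  proof -
    have "(\<Sum>i<m + n. fun_scale s (c i) (h i)) =
        (\<Sum>i<m. fun_scale s (c i) (h i)) + (\<Sum>i<n. fun_scale s (c (m + i)) (h (m + i)))"
      by (rule sum_lessThan_add)
    moreover have "(\<Sum>i<m. fun_scale s (c i) (h i)) = v"
      unfolding v_def h_def by (intro sum.cong) auto
    moreover have "(\<Sum>i<n. fun_scale s (c (m + i)) (h (m + i))) = u"
      unfolding u_def h_def by (intro sum.cong) auto
    ultimately show ?thesis
      by (simp only:)
  qed
  then have vu: "v = - u"
    using c(2) by (simp only: eq_neg_iff_add_eq_0)
  show False
  \<comment> \<open>If the part in \<open>Q\<close> is zero, the powers are dependent, against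
    \<open>p\<close>. Otherwise \<open>v = - u\<close> commutes with \<open>?A\<close>, and its
    coefficients form a kernel vector of the Gram matrix on \<open>Q\<close>, against
    \<open>f\<close>.\<close>
  proof (cases "\<forall>i<m. c i = 0")
    case True
    have "fun_scale s (c i) (q i) = 0" if "i \<in> {..<m}" for i
    proof -
      have "c i = 0"
        using True that by simp
      then show ?thesis
        by (simp only: E.scale_zero_left)
    qed
    then have "v = 0"
      unfolding v_def by (intro sum.neutral ballI)
    then have "u = 0"
      using vu by (simp only: neg_equal_0_iff_equal)
    then have "c (m + i) = 0" if "i < n" for i
      using p(2)[OF _ _ that, of t "\<lambda>i. c (m + i)"] t \<open>u = 0\<close>[unfolded u_def] by simp
    then have "c i = 0" if "i < m + n" for i
      using True that by (metis add_diff_inverse_nat nat_add_left_cancel_less)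
    then show False
      using c(1) by blast
  next
    case False
    have "u (?A w) = ?A (u w)" for w
    proof -
      have "(?A ^^ i) (?A w) = ?A ((?A ^^ i) w)" for i
        by (rule funpow_swap1[symmetric])
      then show ?thesis
        unfolding u_def sum_fun_apply fun_scale_def
        by (simp only: gl_sum[OF A] gl_scale[OF A])
    qed
    then have "v (?A w) = ?A (v w)" for w
      unfolding vu using gl_diff[OF A, of 0] gl_0[OF A] by (simp add: fun_Compl_def)
    then have vA: "v \<circ> ?A = ?A \<circ> v"
      by (simp add: fun_eq_iff)
    have v_gl: "v \<in> gl s"
      unfolding v_def using q_gl by (intro gl_closed) auto
    have "(\<Sum>j<m. poly (F i j) t * c j) = 0" if i: "i < m" for i
    proof -
      let ?k = "if q i \<in> BG then t else 1"
      have "0 = form ?A (q i) v"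
        using form_commuting[OF A q_gl[OF i] v_gl vA] by simp
      also have "\<dots> = (\<Sum>j<m. c j * form ?A (q i) (q j))"
        unfolding v_def by (rule form_sum_right[OF A q_gl[OF i]])
      also have "\<dots> = (\<Sum>j<m. ?k * (poly (F i j) t * c j))"
        using F[OF i] by (intro sum.cong) (simp_all add: mult_ac)
      finally have "?k * (\<Sum>j<m. poly (F i j) t * c j) = 0"
        by (simp only: sum_distrib_left)
      moreover have "?k \<noteq> 0"
        using t by auto
      ultimately show ?thesis
        by simp
    qed
    then have "poly f t = 0"
      unfolding poly_f det_mat_eq_0_iff using False by blast
    then show False
      using t by simp
  qed
qed

end

section \<open>Jordan bases of nilpotent endomorphisms\<close>

text \<open>Chain \<open>i\<close> has length \<open>d i + 1\<close>. One functional per chain is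
  enough: \<open>\<phi> i\<close> is dual to the last vector of the chain, and its composition with
  \<open>e ^^ (d i - t)\<close> is dual to \<open>(e ^^ t) (w i)\<close>. Longer chains come first,
  so comparing block numbers compares lengths.\<close>

locale jordan_basis = vector_space s
  for s :: "'f::field_char_0 \<Rightarrow> 'v::ab_group_add \<Rightarrow> 'v" (infixr \<open>*s\<close> 75) +
  fixes e :: "'v \<Rightarrow> 'v" and k :: nat and d :: "nat \<Rightarrow> nat" and w :: "nat \<Rightarrow> 'v" and \<phi> :: "nat \<Rightarrow> 'v \<Rightarrow> 'f"
  assumes e_add: "e (u + v) = e u + e v"
    and e_scale: "e (c *s v) = c *s e v"
    and \<phi>_add: "i < k \<Longrightarrow> \<phi> i (u + v) = \<phi> i u + \<phi> i v"
    and \<phi>_scale: "i < k \<Longrightarrow> \<phi> i (c *s v) = c * \<phi> i v"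
    and d_antimono: "i \<le> j \<Longrightarrow> j < k \<Longrightarrow> d j \<le> d i"
    and \<phi>_w: "i < k \<Longrightarrow> j < k \<Longrightarrow> \<phi> i ((e ^^ t) (w j)) = (if i = j \<and> t = d i then 1 else 0)"
    and e_w: "i < k \<Longrightarrow> (e ^^ Suc (d i)) (w i) = 0"
    and \<phi>_pow: "i < k \<Longrightarrow> \<phi> i ((e ^^ Suc (d i)) v) = 0"
    and expand: "v = (\<Sum>i<k. \<Sum>t\<le>d i. \<phi> i ((e ^^ (d i - t)) v) *s (e ^^ t) (w i))"

section \<open>Greedy construction of Jordan chains\<close>

lemma funpow_linear:
  assumes "\<And>u v. e (u + v) = e u + e v" and "\<And>c v. e (s c v) = s c (e v)"
  shows "(e ^^ t) (u + v) = (e ^^ t) u + (e ^^ t) v" and "(e ^^ t) (s c v) = s c ((e ^^ t) v)"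
  by (induction t) (simp_all add: assms)

locale nilpotent_endomorphism = vector_space s
  for s :: "'f::field \<Rightarrow> 'v::ab_group_add \<Rightarrow> 'v" (infixr \<open>*s\<close> 75) +
  fixes e :: "'v \<Rightarrow> 'v" and N :: nat
  assumes e_add: "e (u + v) = e u + e v"
    and e_scale: "e (c *s v) = c *s e v"
    and nil: "(e ^^ N) v = 0"
begin

lemmas pow = funpow_linear[where s = s, OF e_add e_scale]

text \<open>The last conjunct is the greedy invariant: \<open>e ^^ Suc (d i)\<close> kills the
  common \<open>e\<close>-invariant kernel of the functionals, where the next chain is chosen. It
  keeps the chain lengths nonincreasing.\<close>

definition jordan_chains :: "nat \<Rightarrow> (nat \<Rightarrow> nat) \<Rightarrow> (nat \<Rightarrow> 'v) \<Rightarrow> (nat \<Rightarrow> 'v \<Rightarrow> 'f) \<Rightarrow> bool"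
  where "jordan_chains k d w \<phi> \<longleftrightarrow>
    (\<forall>i<k. \<forall>u v. \<phi> i (u + v) = \<phi> i u + \<phi> i v) \<and>
    (\<forall>i<k. \<forall>c v. \<phi> i (c *s v) = c * \<phi> i v) \<and>
    (\<forall>i j. i \<le> j \<longrightarrow> j < k \<longrightarrow> d j \<le> d i) \<and>
    (\<forall>i<k. \<forall>j<k. \<forall>t. \<phi> i ((e ^^ t) (w j)) = (if i = j \<and> t = d i then 1 else 0)) \<and>
    (\<forall>i<k. (e ^^ Suc (d i)) (w i) = 0) \<and>
    (\<forall>i<k. \<forall>v. \<phi> i ((e ^^ Suc (d i)) v) = 0) \<and>
    (\<forall>i<k. \<forall>v. (\<forall>j<k. \<forall>t. \<phi> j ((e ^^ t) v) = 0) \<longrightarrow> (e ^^ Suc (d i)) v = 0)"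

text \<open>For Jordan chains, this is the projection onto their span along the common
  \<open>e\<close>-invariant kernel of the functionals.\<close>

definition chain_part ::
    "nat \<Rightarrow> (nat \<Rightarrow> nat) \<Rightarrow> (nat \<Rightarrow> 'v) \<Rightarrow> (nat \<Rightarrow> 'v \<Rightarrow> 'f) \<Rightarrow> 'v \<Rightarrow> 'v"
  where "chain_part k d w \<phi> v = (\<Sum>i<k. \<Sum>t\<le>d i. \<phi> i ((e ^^ (d i - t)) v) *s (e ^^ t) (w i))"

lemma funpow_eq_0:
  assumes "(e ^^ m) v = 0" and "m \<le> t"
  shows "(e ^^ t) v = 0"
proof -
  have "e 0 = 0"
    using e_add[of 0 0] by simp
  then have "(e ^^ r) 0 = 0" for r
    by (induction r) simp_all
  then show ?thesis
    using assms funpow_add[of "t - m" m e] by simp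
qed

lemma jordan_chains_add:
  assumes "jordan_chains k d w \<phi>" and "i < k"
  shows "\<phi> i (u + v) = \<phi> i u + \<phi> i v"
  by (rule assms(1)[unfolded jordan_chains_def, THEN conjunct1, THEN spec, THEN mp, OF assms(2), THEN spec, THEN spec])

lemma jordan_chains_scale:
  assumes "jordan_chains k d w \<phi>" and "i < k"
  shows "\<phi> i (c *s v) = c * \<phi> i v"
  by (rule assms(1)[unfolded jordan_chains_def, THEN conjunct2, THEN conjunct1, THEN spec, THEN mp, OF assms(2), THEN spec, THEN spec])

lemma jordan_chains_antimono:
  assumes "jordan_chains k d w \<phi>" and "i < k" and "l \<le> i"
  shows "d i \<le> d l"
  by (rule assms(1)[unfolded jordan_chains_def, THEN conjunct2, THEN conjunct2, THEN conjunct1, THEN spec, THEN spec, THEN mp, THEN mp, OF assms(3,2)])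

lemma jordan_chains_w:
  assumes "jordan_chains k d w \<phi>" and "i < k" and "j < k"
  shows "\<phi> i ((e ^^ t) (w j)) = (if i = j \<and> t = d i then 1 else 0)"
  by (rule assms(1)[unfolded jordan_chains_def, THEN conjunct2, THEN conjunct2, THEN conjunct2, THEN conjunct1, THEN spec, THEN mp, OF assms(2), THEN spec, THEN mp, OF assms(3), THEN spec])

lemma jordan_chains_pow_w:
  assumes "jordan_chains k d w \<phi>" and "i < k"
  shows "(e ^^ Suc (d i)) (w i) = 0"
  by (rule assms(1)[unfolded jordan_chains_def, THEN conjunct2, THEN conjunct2, THEN conjunct2, THEN conjunct2, THEN conjunct1, THEN spec, THEN mp, OF assms(2)])

lemma jordan_chains_pow:
  assumes "jordan_chains k d w \<phi>" and "i < k"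
  shows "\<phi> i ((e ^^ Suc (d i)) v) = 0"
  by (rule assms(1)[unfolded jordan_chains_def, THEN conjunct2, THEN conjunct2, THEN conjunct2, THEN conjunct2, THEN conjunct2, THEN conjunct1, THEN spec, THEN mp, OF assms(2), THEN spec])

lemma jordan_chains_kernel:
  assumes "jordan_chains k d w \<phi>" and "i < k" and "\<forall>j<k. \<forall>t. \<phi> j ((e ^^ t) v) = 0"
  shows "(e ^^ Suc (d i)) v = 0"
  by (rule assms(1)[unfolded jordan_chains_def, THEN conjunct2, THEN conjunct2, THEN conjunct2, THEN conjunct2, THEN conjunct2, THEN conjunct2, THEN spec, THEN mp, OF assms(2), THEN spec, THEN mp, OF assms(3)])

text \<open>The data added by one greedy step: the generator \<open>z\<close>, its height
  \<open>\<delta>\<close>, which is maximal in the invariant kernel by the last conjunct, and the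
  functional \<open>\<chi>\<close> dual to the end of the new chain.\<close>

definition next_chain ::
    "nat \<Rightarrow> (nat \<Rightarrow> nat) \<Rightarrow> (nat \<Rightarrow> 'v) \<Rightarrow> (nat \<Rightarrow> 'v \<Rightarrow> 'f) \<Rightarrow> 'v \<Rightarrow> nat \<Rightarrow> ('v \<Rightarrow> 'f) \<Rightarrow> bool"
  where "next_chain k d w \<phi> z \<delta> \<chi> \<longleftrightarrow> (\<forall>u v. \<chi> (u + v) = \<chi> u + \<chi> v) \<and> (\<forall>c v. \<chi> (c *s v) = c * \<chi> v) \<and>
    (\<forall>i<k. \<forall>t. \<phi> i ((e ^^ t) z) = 0) \<and> (\<forall>t. \<chi> ((e ^^ t) z) = (if t = \<delta> then 1 else 0)) \<and>
    (\<forall>i<k. \<forall>t\<le>d i. \<chi> ((e ^^ t) (w i)) = 0) \<and>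
    (\<forall>v. (\<forall>i<k. \<forall>t. \<phi> i ((e ^^ t) v) = 0) \<longrightarrow> (e ^^ Suc \<delta>) v = 0)"

text \<open>
  Chains are split off greedily: if the functionals found so far have a nonzero common
  \<open>e\<close>-invariant kernel, choose in it a vector \<open>z\<close> of maximal height.
\<close>

lemma next_chain_exists:
  assumes J: "jordan_chains k d w \<phi>"
    and z0: "z0 \<noteq> 0" "\<And>i t. i < k \<Longrightarrow> \<phi> i ((e ^^ t) z0) = 0"
  shows "\<exists>z \<delta> \<chi>. next_chain k d w \<phi> z \<delta> \<chi>"
proof -
  note \<phi>_add = jordan_chains_add[OF J] and \<phi>_scale = jordan_chains_scale[OF J] and \<phi>_w = jordan_chains_w[OF J]
  define C where "C = {v. \<forall>i<k. \<forall>t. \<phi> i ((e ^^ t) v) = 0}"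
  have "\<exists>m. \<forall>v\<in>C. (e ^^ m) v = 0"
    using nil by blast
  define m where "m = (LEAST m. \<forall>v\<in>C. (e ^^ m) v = 0)"
  have m: "\<forall>v\<in>C. (e ^^ m) v = 0"
    unfolding m_def by (rule LeastI_ex) fact
  have "z0 \<in> C"
    using z0(2) by (simp add: C_def)
  then have "m \<noteq> 0"
    using m z0(1) by (metis funpow_0)
  then obtain \<delta> where \<delta>: "m = Suc \<delta>"
    by (cases m) auto
  have "\<not> (\<forall>v\<in>C. (e ^^ \<delta>) v = 0)"
    by (rule not_less_Least) (simp add: m_def[symmetric] \<delta>)
  then obtain z where z: "z \<in> C" "(e ^^ \<delta>) z \<noteq> 0"
    by blast
  have z_high: "(e ^^ t) z = 0" if "t > \<delta>" for t
  proof -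
    have "(e ^^ t) z = (e ^^ (t - Suc \<delta>)) ((e ^^ Suc \<delta>) z)"
      using that funpow_add[of "t - Suc \<delta>" "Suc \<delta>" e] by (simp del: funpow.simps)
    also have "\<dots> = 0"
      using m z(1) pow(2)[of _ 0 0] by (simp add: \<delta>)
    finally show ?thesis .
  qed
  define f where "f = (\<lambda>(i, t). (e ^^ t) (if i = k then z else w i))"
  define D where "D i = (if i = k then \<delta> else d i)" for i
  define I where "I = Sigma {..k} (\<lambda>i. {..D i})"
  have fin: "finite I"
    unfolding I_def by (rule finite_SigmaI) auto
  \<comment> \<open>Independence of all chain vectors. Some \<open>\<phi> i\<close> after a power of
    \<open>e\<close> reads off each old coefficient. The new ones vanish from the lowest power up:
    \<open>e ^^ (\<delta> - t)\<close> kills all higher terms.\<close>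
  have zero: "a p = 0" if a: "(\<Sum>p\<in>I. a p *s f p) = 0" and p: "p \<in> I" for a p
  proof -
    have sum: "(\<Sum>i\<le>k. \<Sum>t\<le>D i. a (i, t) *s f (i, t)) = 0"
    proof -
      have "(\<Sum>i\<le>k. \<Sum>t\<le>D i. a (i, t) *s f (i, t)) = (\<Sum>(i, t)\<in>I. a (i, t) *s f (i, t))"
        unfolding I_def by (rule sum.Sigma) auto
      then show ?thesis
        using a by (simp only: case_prod_beta' prod.collapse)
    qed
    have low: "a (i, t) = 0" if i: "i < k" and t: "t \<le> d i" for i t
    proof -
      define g where "g v = \<phi> i ((e ^^ (d i - t)) v)" for v
      have g_add: "g (u + v) = g u + g v" and g_scale: "g (c *s v) = c * g v" for u v c
        using i by (simp_all add: g_def pow \<phi>_add \<phi>_scale)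
      have g_0: "g 0 = 0"
        by (metis g_add add_cancel_right_right)
      have g_sum: "g (\<Sum>i\<in>J. h i) = (\<Sum>i\<in>J. g (h i))" for J :: "nat set" and h
        by (induction J rule: infinite_finite_induct) (simp_all add: g_add g_0)
      have g_f: "g (f (j, l)) = (if j = i \<and> l = t then 1 else 0)" if "j \<le> k" for j l
      proof (cases "j = k")
        case True
        then show ?thesis
          using z(1) i by (auto simp: g_def f_def C_def funpow_add[THEN fun_cong, unfolded o_apply, symmetric])
      next
        case False
        then have "g (f (j, l)) = \<phi> i ((e ^^ (d i - t + l)) (w j))"
          by (simp add: g_def f_def funpow_add)
        then show ?thesis
          using \<phi>_w[of i j "d i - t + l"] that False i t by auto
      qed
      have "0 = g (\<Sum>j\<le>k. \<Sum>l\<le>D j. a (j, l) *s f (j, l))"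
        using sum g_0 by simp
      also have "\<dots> = (\<Sum>j\<le>k. \<Sum>l\<le>D j. if j = i \<and> l = t then a (j, l) else 0)"
        unfolding g_sum g_scale by (intro sum.cong) (auto simp: g_f)
      also have "\<dots> = (\<Sum>j\<le>k. if j = i then a (i, t) else 0)"
        using i t by (intro sum.cong) (auto simp: D_def)
      also have "\<dots> = a (i, t)"
        using i by simp
      finally show ?thesis
        by simp
    qed
    have "(\<Sum>t\<le>\<delta>. a (k, t) *s (e ^^ t) z) = 0"
    proof -
      have "(\<Sum>i\<le>k. \<Sum>t\<le>D i. a (i, t) *s f (i, t)) = (\<Sum>i\<le>k. if i = k then (\<Sum>t\<le>\<delta>. a (k, t) *s (e ^^ t) z) else 0)"
        using low by (intro sum.cong refl) (auto simp: D_def f_def intro!: sum.neutral)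
      then show ?thesis
        using sum by simp
    qed
    note top = this
    have "a (k, t) = 0" if "t \<le> \<delta>" for t
      using that
    proof (induction t rule: less_induct)
      case (less t)
      have "(e ^^ (\<delta> - t)) (\<Sum>l\<le>\<delta>. a (k, l) *s (e ^^ l) z) = (\<Sum>l\<le>\<delta>. a (k, l) *s (e ^^ (\<delta> - t + l)) z)"
      proof -
        have "(e ^^ r) 0 = 0" for r
          using pow(2)[of r 0 0] by simp
        then have "(e ^^ r) (\<Sum>i\<in>J. h i) = (\<Sum>i\<in>J. (e ^^ r) (h i))" for J :: "nat set" and h r
          by (induction J rule: infinite_finite_induct) (simp_all add: pow)
        then show ?thesis
          by (simp add: pow funpow_add)
      qed
      also have "\<dots> = (\<Sum>l\<le>\<delta>. if l = t then a (k, t) *s (e ^^ \<delta>) z else 0)"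
      proof (intro sum.cong refl)
        fix l assume "l \<in> {..\<delta>}"
        then show "a (k, l) *s (e ^^ (\<delta> - t + l)) z = (if l = t then a (k, t) *s (e ^^ \<delta>) z else 0)"
          using less z_high[of "\<delta> - t + l"] by (cases l t rule: linorder_cases) auto
      qed
      also have "\<dots> = a (k, t) *s (e ^^ \<delta>) z"
        using less.prems by simp
      finally have "a (k, t) *s (e ^^ \<delta>) z = 0"
        using top pow(2)[of "\<delta> - t" 0 0] by simp
      then show ?case
        using z(2) by simp
    qed
    then show ?thesis
      using p low by (cases p) (auto simp: I_def D_def le_less split: if_splits)
  qed
  have inj: "inj_on f I"
  proof (rule inj_onI, rule ccontr)
    fix p q assume pq: "p \<in> I" "q \<in> I" "f p = f q" "p \<noteq> q"
    define a where "a r = (if r = p then 1 else if r = q then -1 else (0 :: 'f))" for r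
    have "(\<Sum>r\<in>I. a r *s f r) = (\<Sum>r\<in>{p, q}. a r *s f r)"
      using pq(1,2) fin by (intro sum.mono_neutral_right) (auto simp: a_def)
    also have "\<dots> = a p *s f p + a q *s f q"
      using pq(4) by simp
    also have "\<dots> = 0"
      using pq(4) by (simp add: a_def pq(3))
    finally have "a p = 0"
      by (rule zero[OF _ pq(1)])
    then show False
      by (simp add: a_def)
  qed
  have ind: "independent (f ` I)"
  proof (rule independent_if_scalars_zero)
    show "finite (f ` I)"
      using fin by simp
    fix g x assume g: "(\<Sum>x\<in>f ` I. g x *s x) = 0" and x: "x \<in> f ` I"
    then have "(\<Sum>p\<in>I. (g \<circ> f) p *s f p) = 0"
      using inj by (simp add: sum.reindex)
    then show "g x = 0"
      using zero[of "g \<circ> f"] x by (metis comp_apply imageE)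
  qed
  have "\<exists>\<chi>. (\<forall>x z. \<chi> (x + z) = \<chi> x + \<chi> z) \<and> (\<forall>c x. \<chi> (c *s x) = c * \<chi> x) \<and>
      (\<forall>x\<in>f ` I. \<chi> x = (if x = f (k, \<delta>) then 1 else 0))"
    using ind by (rule extend_functional[OF vector_space_axioms])
  then obtain \<chi> where \<chi>: "(\<forall>x z. \<chi> (x + z) = \<chi> x + \<chi> z) \<and> (\<forall>c x. \<chi> (c *s x) = c * \<chi> x) \<and>
      (\<forall>x\<in>f ` I. \<chi> x = (if x = f (k, \<delta>) then 1 else 0))" ..
  have \<chi>f: "\<chi> (f p) = (if p = (k, \<delta>) then 1 else 0)" if p: "p \<in> I" for p
  proof -
    have "(k, \<delta>) \<in> I"
      by (simp add: I_def D_def)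
    then have "f p = f (k, \<delta>) \<longleftrightarrow> p = (k, \<delta>)"
      using inj p by (auto dest: inj_onD)
    then show ?thesis
      using \<chi> p by simp
  qed
  have "\<chi> 0 = 0"
    using \<chi> by (metis add_cancel_right_right)
  then have "\<chi> ((e ^^ t) z) = (if t = \<delta> then 1 else 0)" for t
    using \<chi>f[of "(k, t)"] z_high[of t] by (cases "t \<le> \<delta>") (auto simp: I_def D_def f_def)
  moreover have "\<chi> ((e ^^ t) (w i)) = 0" if "i < k" "t \<le> d i" for i t
    using \<chi>f[of "(i, t)"] that by (simp add: I_def D_def f_def)
  moreover have "(e ^^ Suc \<delta>) v = 0" if "\<forall>i<k. \<forall>t. \<phi> i ((e ^^ t) v) = 0" for v
    using m that \<delta> by (auto simp: C_def)
  moreover have "\<forall>i<k. \<forall>t. \<phi> i ((e ^^ t) z) = 0"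
    using z(1) by (simp add: C_def)
  ultimately have "next_chain k d w \<phi> z \<delta> \<chi>"
    using \<chi> unfolding next_chain_def by (intro conjI) simp_all
  then show ?thesis
    by blast
qed

text \<open>By duality, only the summand with \<open>i = j\<close> and \<open>r + t = d j\<close> of
  the chain part survives under \<open>\<phi> j\<close> after \<open>e ^^ r\<close>, and it yields
  the value at \<open>v\<close>. For \<open>r > d j\<close> both values are 0.\<close>

lemma chain_part_kernel:
  assumes J: "jordan_chains k d w \<phi>" and j: "j < k"
  shows "\<phi> j ((e ^^ r) (v - chain_part k d w \<phi> v)) = 0"
proof -
  have \<phi>_w: "\<phi> j ((e ^^ t) (w i)) = (if j = i \<and> t = d j then 1 else 0)" if "i < k" for i t
    by (rule jordan_chains_w[OF J j that])
  define g where "g u = \<phi> j ((e ^^ r) u)" for u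
  have g_add: "g (u + v) = g u + g v" and g_scale: "g (c *s v) = c * g v" for u v c
    by (simp_all only: g_def pow jordan_chains_add[OF J j] jordan_chains_scale[OF J j])
  have g_0: "g 0 = 0"
    by (metis g_add add_cancel_right_right)
  have g_sum: "g (\<Sum>i\<in>J. h i) = (\<Sum>i\<in>J. g (h i))" for J :: "nat set" and h
    by (induction J rule: infinite_finite_induct) (simp_all add: g_add g_0)
  have "g (chain_part k d w \<phi> v) = (\<Sum>i<k. \<Sum>t\<le>d i. \<phi> i ((e ^^ (d i - t)) v) * g ((e ^^ t) (w i)))"
    unfolding chain_part_def g_sum g_scale ..
  also have "\<dots> = (\<Sum>i<k. if i = j then (\<Sum>t\<le>d j. if r + t = d j then g v else 0) else 0)"
  proof (intro sum.cong refl)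
    fix i assume i: "i \<in> {..<k}"
    have gw: "g ((e ^^ t) (w i)) = (if j = i \<and> r + t = d j then 1 else 0)" for t
    proof -
      have "g ((e ^^ t) (w i)) = \<phi> j ((e ^^ (r + t)) (w i))"
        by (simp only: g_def funpow_add comp_apply)
      also have "\<dots> = (if j = i \<and> r + t = d j then 1 else 0)"
        by (rule \<phi>_w) (use i in simp)
      finally show ?thesis .
    qed
    show "(\<Sum>t\<le>d i. \<phi> i ((e ^^ (d i - t)) v) * g ((e ^^ t) (w i))) =
        (if i = j then (\<Sum>t\<le>d j. if r + t = d j then g v else 0) else 0)"
    proof (cases "i = j")
      case True
      have *: "\<phi> j ((e ^^ (d j - t)) v) * (if j = j \<and> r + t = d j then 1 else 0) = (if r + t = d j then g v else 0)" for t
      proof (cases "r + t = d j")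
        case eq: True
        then have "d j - t = r"
          by simp
        then show ?thesis
          using eq by (simp only: g_def simp_thms if_True mult_1_right)
      qed simp
      show ?thesis
        unfolding True if_P[OF refl] gw[unfolded True] * ..
    next
      case False
      then show ?thesis
        unfolding gw by simp
    qed
  qed
  also have "\<dots> = (\<Sum>t\<le>d j. if r + t = d j then g v else 0)"
    using j by simp
  also have "\<dots> = g v"
  proof (cases "r \<le> d j")
    case True
    then have "(\<Sum>t\<le>d j. if r + t = d j then g v else 0) = (\<Sum>t\<le>d j. if t = d j - r then g v else 0)"
      by (intro sum.cong) auto
    then show ?thesis
      by simp
  next
    case False
    then have "(e ^^ r) v = (e ^^ Suc (d j)) ((e ^^ (r - Suc (d j))) v)"
      using funpow_add[of "Suc (d j)" "r - Suc (d j)" e] by (simp del: funpow.simps)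
    then have "g v = 0"
      by (simp only: g_def jordan_chains_pow[OF J j])
    then show ?thesis
      by (simp only: if_cancel sum.neutral_const)
  qed
  finally have "g (chain_part k d w \<phi> v) = g v" .
  moreover have "g (v - chain_part k d w \<phi> v) + g (chain_part k d w \<phi> v) = g v"
    by (simp only: g_add[symmetric] diff_add_cancel)
  ultimately have "g (v - chain_part k d w \<phi> v) = 0"
    by (metis add_cancel_left_left)
  then show ?thesis
    by (simp only: g_def)
qed

lemma jordan_chains_extend:
  assumes J: "jordan_chains k d w \<phi>"
    and z0: "z0 \<noteq> 0" "\<And>i t. i < k \<Longrightarrow> \<phi> i ((e ^^ t) z0) = 0"
  shows "\<exists>d w \<phi>. jordan_chains (Suc k) d w \<phi>"
proof -
  obtain z \<delta> \<chi> where "next_chain k d w \<phi> z \<delta> \<chi>"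
    using next_chain_exists[OF J z0] by blast
  note nc = this[unfolded next_chain_def]
  have \<chi>_add: "\<chi> (u + v) = \<chi> u + \<chi> v" for u v
    by (rule nc[THEN conjunct1, THEN spec, THEN spec])
  have \<chi>_scale: "\<chi> (c *s v) = c * \<chi> v" for c v
    by (rule nc[THEN conjunct2, THEN conjunct1, THEN spec, THEN spec])
  have z_kernel: "\<forall>i<k. \<forall>t. \<phi> i ((e ^^ t) z) = 0"
    by (rule nc[THEN conjunct2, THEN conjunct2, THEN conjunct1])
  have \<chi>_z: "\<chi> ((e ^^ t) z) = (if t = \<delta> then 1 else 0)" for t
    by (rule nc[THEN conjunct2, THEN conjunct2, THEN conjunct2, THEN conjunct1, THEN spec])
  have \<chi>_w: "\<forall>i<k. \<forall>t\<le>d i. \<chi> ((e ^^ t) (w i)) = 0"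
    by (rule nc[THEN conjunct2, THEN conjunct2, THEN conjunct2, THEN conjunct2, THEN conjunct1])
  have kill: "(e ^^ Suc \<delta>) v = 0" if "\<forall>i<k. \<forall>t. \<phi> i ((e ^^ t) v) = 0" for v
    by (rule nc[THEN conjunct2, THEN conjunct2, THEN conjunct2, THEN conjunct2, THEN conjunct2, THEN spec, THEN mp, OF that])
  have \<chi>0: "\<chi> 0 = 0"
    by (metis \<chi>_add add_cancel_right_right)
  have \<chi>_w: "\<chi> ((e ^^ t) (w i)) = 0" if i: "i < k" for i t
  proof (cases "t \<le> d i")
    case True
    then show ?thesis
      using \<chi>_w i by blast
  next
    case False
    then have "(e ^^ t) (w i) = 0"
      by (intro funpow_eq_0[OF jordan_chains_pow_w[OF J i]]) simp
    then show ?thesis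
      by (simp only: \<chi>0)
  qed
  \<comment> \<open>By the greedy invariant \<open>e ^^ Suc (d i)\<close> kills \<open>z\<close>,
    whereas \<open>(e ^^ \<delta>) z\<close> is not 0.\<close>
  have \<delta>: "\<delta> \<le> d i" if i: "i < k" for i
  proof (rule ccontr)
    assume "\<not> ?thesis"
    then have "(e ^^ \<delta>) z = 0"
      by (intro funpow_eq_0[OF jordan_chains_kernel[OF J i z_kernel]]) simp
    then show False
      using \<chi>_z[of \<delta>] by (simp only: \<chi>0 simp_thms if_True zero_neq_one)
  qed
  \<comment> \<open>On the chain part of \<open>v\<close> this holds because \<open>\<chi>\<close>
    vanishes on the old chains; the rest of \<open>v\<close> lies in the invariant kernel, which
    \<open>e ^^ Suc \<delta>\<close> kills.\<close>
  have \<chi>_vanish: "\<chi> ((e ^^ Suc \<delta>) v) = 0" for v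
  proof -
    let ?p = "chain_part k d w \<phi> v"
    define g where "g u = \<chi> ((e ^^ Suc \<delta>) u)" for u
    have g_add: "g (u + v) = g u + g v" and g_scale: "g (c *s v) = c * g v" for u v c
      by (simp_all only: g_def pow \<chi>_add \<chi>_scale)
    have g_0: "g 0 = 0"
      by (metis g_add add_cancel_right_right)
    have g_sum: "g (\<Sum>i\<in>J. h i) = (\<Sum>i\<in>J. g (h i))" for J :: "nat set" and h
      by (induction J rule: infinite_finite_induct)
        (simp_all only: sum_recursion g_add g_0)
    have g_w: "g ((e ^^ t) (w i)) = 0" if "i < k" for i t
      unfolding g_def using \<chi>_w[OF that, of "Suc \<delta> + t"] by (simp only: funpow_add comp_apply)
    have "g ?p = (\<Sum>i<k. \<Sum>t\<le>d i. \<phi> i ((e ^^ (d i - t)) v) * g ((e ^^ t) (w i)))"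
      unfolding chain_part_def g_sum g_scale ..
    also have "\<dots> = 0"
      by (intro sum.neutral ballI) (simp only: g_w lessThan_iff mult_zero_right)
    finally have "g ?p = 0" .
    moreover have "g (v - ?p) = 0"
    proof -
      have "(e ^^ Suc \<delta>) (v - ?p) = 0"
        by (rule kill) (intro allI impI chain_part_kernel[OF J])
      then show ?thesis
        by (simp only: g_def \<chi>0)
    qed
    moreover have "g (v - ?p) + g ?p = g v"
      by (simp only: g_add[symmetric] diff_add_cancel)
    ultimately show ?thesis
      by (simp only: g_def add_0_right)
  qed
  define d' where "d' = d(k := \<delta>)"
  define w' where "w' = w(k := z)"
  define \<phi>' where "\<phi>' = \<phi>(k := \<chi>)"
  have old: "d' i = d i" "w' i = w i" "\<phi>' i = \<phi> i" if "i < k" for i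
    using that by (simp_all add: d'_def w'_def \<phi>'_def)
  have new: "d' k = \<delta>" "w' k = z" "\<phi>' k = \<chi>"
    by (simp_all add: d'_def w'_def \<phi>'_def)
  have "jordan_chains (Suc k) d' w' \<phi>'"
    unfolding jordan_chains_def
  proof (intro conjI allI impI)
    fix i u v assume "i < Suc k"
    then consider "i = k" | "i < k"
      by linarith
    then show "\<phi>' i (u + v) = \<phi>' i u + \<phi>' i v"
      by cases (simp_all only: new old \<chi>_add jordan_chains_add[OF J])
  next
    fix i c v assume "i < Suc k"
    then consider "i = k" | "i < k"
      by linarith
    then show "\<phi>' i (c *s v) = c * \<phi>' i v"
      by cases (simp_all only: new old \<chi>_scale jordan_chains_scale[OF J])
  next
    fix i j assume ij: "i \<le> j" "j < Suc k"
    then consider "i = k" "j = k" | "i < k" "j = k" | "i < k" "j < k"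
      by linarith
    then show "d' j \<le> d' i"
      by cases (simp_all only: new old \<delta> jordan_chains_antimono[OF J _ ij(1)] order_refl)
  next
    fix i j t assume "i < Suc k" "j < Suc k"
    then consider "i = k" "j = k" | "i < k" "j = k" | "i = k" "j < k" | "i < k" "j < k"
      by linarith
    then show "\<phi>' i ((e ^^ t) (w' j)) = (if i = j \<and> t = d' i then 1 else 0)"
    proof cases
      case 1
      then show ?thesis
        by (simp only: new \<chi>_z simp_thms)
    next
      case 2
      then have "i \<noteq> j"
        by simp
      then show ?thesis
        using 2 z_kernel[THEN spec, THEN mp, OF 2(1), THEN spec, of t] by (simp only: new old simp_thms if_False)
    next
      case 3
      then have "i \<noteq> j"
        by simp
      then show ?thesis
        using 3 by (simp only: new old \<chi>_w simp_thms if_False)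
    next
      case 4
      then show ?thesis
        by (simp only: old jordan_chains_w[OF J])
    qed
  next
    fix i assume "i < Suc k"
    then consider "i = k" | "i < k"
      by linarith
    then show "(e ^^ Suc (d' i)) (w' i) = 0"
      by cases (simp_all only: new old kill[OF z_kernel] jordan_chains_pow_w[OF J])
  next
    fix i v assume "i < Suc k"
    then consider "i = k" | "i < k"
      by linarith
    then show "\<phi>' i ((e ^^ Suc (d' i)) v) = 0"
      by cases (simp_all only: new old \<chi>_vanish jordan_chains_pow[OF J])
  next
    fix i v assume i: "i < Suc k" and v: "\<forall>j<Suc k. \<forall>t. \<phi>' j ((e ^^ t) v) = 0"
    have kernel: "\<forall>j<k. \<forall>t. \<phi> j ((e ^^ t) v) = 0"
    proof (intro allI impI)
      fix j t assume j: "j < k"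
      show "\<phi> j ((e ^^ t) v) = 0"
        using v[THEN spec, THEN mp, OF less_SucI[OF j], THEN spec, of t] unfolding old(3)[OF j] .
    qed
    from i consider "i = k" | "i < k"
      by linarith
    then show "(e ^^ Suc (d' i)) v = 0"
      by cases (simp_all only: new old kill[OF kernel] jordan_chains_kernel[OF J _ kernel])
  qed
  then show ?thesis
    by blast
qed

text \<open>The last vectors of the chains are independent, so a maximal number of chains exists. At
  the maximum the invariant kernel is 0, which makes \<open>chain_part\<close> the identity.\<close>

theorem jordan_basis_exists:
  assumes fin: "finite B" "span B = UNIV"
  shows "\<exists>k d w \<phi>. jordan_chains k d w \<phi> \<and> (\<forall>v. v = chain_part k d w \<phi> v)"
proof -
  define P where "P k \<longleftrightarrow> (\<exists>d w \<phi>. jordan_chains k d w \<phi>)" for k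
  have "P 0"
    by (simp add: P_def jordan_chains_def)
  have bound: "k \<le> card B" if Pk: "P k" for k
  proof (rule ccontr)
    assume k: "\<not> ?thesis"
    obtain d w \<phi> where J: "jordan_chains k d w \<phi>"
      using Pk by (auto simp: P_def)
    obtain c where c: "\<exists>i<k. c i \<noteq> 0" "(\<Sum>i<k. c i *s (e ^^ d i) (w i)) = 0"
      using family_dependent[OF fin(1), of k "\<lambda>i. (e ^^ d i) (w i)"] fin(2) k by auto
    have "c j = 0" if j: "j < k" for j
    proof -
      have \<phi>0: "\<phi> j 0 = 0"
        using jordan_chains_add[OF J j] by (metis add_cancel_right_right)
      have "\<phi> j (\<Sum>i\<in>I. h i) = (\<Sum>i\<in>I. \<phi> j (h i))" for I :: "nat set" and h
        by (induction I rule: infinite_finite_induct) (simp_all add: \<phi>0 jordan_chains_add[OF J j])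
      then have "0 = (\<Sum>i<k. \<phi> j (c i *s (e ^^ d i) (w i)))"
        using c(2) \<phi>0 by metis
      also have "\<dots> = (\<Sum>i<k. if i = j then c i else 0)"
        by (intro sum.cong) (auto simp: jordan_chains_scale[OF J j] jordan_chains_w[OF J j])
      finally show ?thesis
        using j by simp
    qed
    then show False
      using c(1) by blast
  qed
  define k where "k = Greatest P"
  have "P k"
    unfolding k_def by (rule GreatestI_nat[of P 0 "card B"]) (use \<open>P 0\<close> bound in auto)
  then obtain d w \<phi> where J: "jordan_chains k d w \<phi>"
    by (auto simp: P_def)
  have "\<not> P (Suc k)"
    using Greatest_le_nat[of P "Suc k" "card B"] bound by (auto simp: k_def)
  then have kernel: "z = 0" if "\<And>i t. i < k \<Longrightarrow> \<phi> i ((e ^^ t) z) = 0" for z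
    using jordan_chains_extend[OF J, of z] that unfolding P_def by blast
  have "v - chain_part k d w \<phi> v = 0" for v
    by (rule kernel) (rule chain_part_kernel[OF J])
  then show ?thesis
    using J by auto
qed

end

section \<open>The centraliser of a nilpotent endomorphism\<close>

lemma sum_Sigma_pairs:
  assumes "finite A" and "\<And>x. x \<in> A \<Longrightarrow> finite (B x)"
  shows "(\<Sum>u\<in>Sigma A B. F u) = (\<Sum>x\<in>A. \<Sum>y\<in>B x. F (x, y))"
proof -
  have "(\<Sum>x\<in>A. \<Sum>y\<in>B x. F (x, y)) = (\<Sum>(x, y)\<in>Sigma A B. F (x, y))"
    using assms by (intro sum.Sigma) auto
  then show ?thesis
    by (simp only: case_prod_eta)
qed

context jordan_basis
begin

sublocale E: vector_space "fun_scale s :: 'f \<Rightarrow> ('v \<Rightarrow> 'v) \<Rightarrow> ('v \<Rightarrow> 'v)"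
  by (rule vector_space_fun_scale) (rule vector_space_axioms)

abbreviation cent :: "('v \<Rightarrow> 'v) set" where
  "cent \<equiv> centraliser s e"

lemma mem_cent: "x \<in> cent \<longleftrightarrow>
    (\<forall>u v. x (u + v) = x u + x v) \<and> (\<forall>c v. x (c *s v) = c *s x v) \<and> (\<forall>v. x (e v) = e (x v))"
  by (rule mem_centraliser_iff) (rule vector_space_axioms)

lemma e_gl: "e \<in> gl s"
  by (simp add: mem_gl_iff[OF vector_space_axioms] e_add e_scale)

lemma subspace_cent: "E.subspace cent"
  by (rule subspace_centraliser[OF vector_space_axioms e_gl])

lemmas cent_closed = E.subspace_sum[OF subspace_cent] E.subspace_scale[OF subspace_cent]

lemma cent_add: "x \<in> cent \<Longrightarrow> x (u + v) = x u + x v"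
  and cent_scale: "x \<in> cent \<Longrightarrow> x (c *s v) = c *s x v"
  and cent_e: "x \<in> cent \<Longrightarrow> x (e v) = e (x v)"
  unfolding mem_cent by blast+

lemma cent_0: "x \<in> cent \<Longrightarrow> x 0 = 0"
  by (metis cent_add add_cancel_right_right)

lemma cent_sum: "x \<in> cent \<Longrightarrow> x (\<Sum>i\<in>I. f i) = (\<Sum>i\<in>I. x (f i))"
  by (induction I rule: infinite_finite_induct)
    (simp_all only: sum_recursion cent_add cent_0)

lemma cent_pow: "x \<in> cent \<Longrightarrow> x ((e ^^ t) v) = (e ^^ t) (x v)"
  by (induction t) (simp_all only: funpow.simps comp_apply id_apply cent_e)

lemma commutator_cent: "x \<in> cent \<Longrightarrow> y \<in> cent \<Longrightarrow> commutator x y \<in> cent"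
  by (rule commutator_mem_centraliser[OF vector_space_axioms e_gl])

lemmas pow_add = funpow_linear(1)[where s = s, OF e_add e_scale]
  and pow_scale = funpow_linear(2)[where s = s, OF e_add e_scale]

lemma pow_0: "(e ^^ t) 0 = 0"
  by (metis pow_add add_cancel_right_right)

lemma pow_pow: "(e ^^ t) ((e ^^ u) v) = (e ^^ (t + u)) v"
  by (simp only: funpow_add comp_apply)

lemma pow_sum: "(e ^^ t) (\<Sum>i\<in>I. f i) = (\<Sum>i\<in>I. (e ^^ t) (f i))"
  by (induction I rule: infinite_finite_induct)
    (simp_all only: sum_recursion pow_add pow_0)

lemma pow_w_0: "i < k \<Longrightarrow> d i < t \<Longrightarrow> (e ^^ t) (w i) = 0"
  using pow_pow[of "t - Suc (d i)" "Suc (d i)" "w i"] by (simp only: e_w pow_0 Suc_leI le_add_diff_inverse2)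

lemma \<phi>_0: "i < k \<Longrightarrow> \<phi> i 0 = 0"
  by (metis \<phi>_add add_cancel_right_right)

lemma \<phi>_sum: "i < k \<Longrightarrow> \<phi> i (\<Sum>j\<in>I. f j) = (\<Sum>j\<in>I. \<phi> i (f j))"
  by (induction I rule: infinite_finite_induct)
    (simp_all only: sum_recursion \<phi>_add \<phi>_0)

lemma \<phi>_pow_0:
  assumes "i < k" and "d i < t"
  shows "\<phi> i ((e ^^ t) v) = 0"
  using \<phi>_pow[OF assms(1), of "(e ^^ (t - Suc (d i))) v"] assms(2) pow_pow[of "Suc (d i)" "t - Suc (d i)" v]
  by (simp only: Suc_leI le_add_diff_inverse)

text \<open>\<open>coef x i j a\<close> is the coefficient of \<open>e\<^bsup>d j - a\<^esup> (w j)\<close> in \<open>x (w i)\<close>.\<close>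

definition coef :: "('v \<Rightarrow> 'v) \<Rightarrow> nat \<Rightarrow> nat \<Rightarrow> nat \<Rightarrow> 'f" where
  "coef x i j a = \<phi> j ((e ^^ a) (x (w i)))"

text \<open>For admissible \<open>a\<close>, the element of the centraliser sending
  \<open>w p\<close> to \<open>(e ^^ (d q - a)) (w q)\<close> and the other generators to 0. Since
  \<open>a\<close> counts from the end of chain \<open>q\<close>, it matches the last argument of
  \<open>coef\<close>.\<close>

definition \<xi> :: "nat \<Rightarrow> nat \<Rightarrow> nat \<Rightarrow> 'v \<Rightarrow> 'v" where
  "\<xi> p q a v = (\<Sum>t\<le>d p. \<phi> p ((e ^^ (d p - t)) v) *s (e ^^ (t + (d q - a))) (w q))"

lemma coef_add: "j < k \<Longrightarrow> coef (x + y) i j a = coef x i j a + coef y i j a"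
  by (simp only: coef_def plus_fun_apply pow_add \<phi>_add)

lemma coef_scale: "j < k \<Longrightarrow> coef (fun_scale s c x) i j a = c * coef x i j a"
  by (simp only: coef_def fun_scale_def pow_scale \<phi>_scale)

lemma coef_0: "j < k \<Longrightarrow> coef 0 i j a = 0"
  by (simp only: coef_def zero_fun_apply pow_0 \<phi>_0)

lemma coef_sum: "j < k \<Longrightarrow> coef (\<Sum>l\<in>I. f l) i j a = (\<Sum>l\<in>I. coef (f l) i j a)"
  by (induction I rule: infinite_finite_induct)
    (simp_all only: sum_recursion coef_add coef_0)

lemma coef_diff: "j < k \<Longrightarrow> coef (x - y) i j a = coef x i j a - coef y i j a"
  using coef_add[of j "x - y" y i a] by (simp only: diff_add_cancel add_diff_cancel)

lemma coef_eq_0: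
  assumes "x \<in> cent" and "i < k" and "j < k" and "min (d i) (d j) < a"
  shows "coef x i j a = 0"
proof (cases "d i < a")
  case True
  then have "x ((e ^^ a) (w i)) = 0"
    using pow_w_0[OF assms(2)] cent_0[OF assms(1)] by simp
  then show ?thesis
    using \<phi>_0[OF assms(3)] by (simp only: coef_def cent_pow[OF assms(1)])
next
  case False
  then show ?thesis
    using \<phi>_pow_0[OF assms(3)] assms(4) by (simp add: coef_def)
qed

text \<open>Applying \<open>e\<close> shifts the summation index by one. The upper boundary term
  vanishes because \<open>a \<le> d p\<close> makes the power of \<open>e\<close> exceed
  \<open>d q\<close>, the lower one because \<open>\<phi> p\<close> kills the image of
  \<open>e ^^ Suc (d p)\<close>.\<close>

lemma \<xi>_cent:
  assumes "p < k" and "q < k" and "a \<le> min (d p) (d q)"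
  shows "\<xi> p q a \<in> cent"
  unfolding mem_cent
proof (intro conjI allI)
  fix u v c
  show "\<xi> p q a (u + v) = \<xi> p q a u + \<xi> p q a v"
    unfolding \<xi>_def pow_add \<phi>_add[OF assms(1)] scale_left_distrib sum.distrib ..
  show "\<xi> p q a (c *s v) = c *s \<xi> p q a v"
    unfolding \<xi>_def pow_scale \<phi>_scale[OF assms(1)] scale_sum_right scale_scale ..
  let ?g = "\<lambda>t. \<phi> p ((e ^^ (Suc (d p) - t)) v) *s (e ^^ (t + (d q - a))) (w q)"
  have "\<xi> p q a (e v) = (\<Sum>t\<le>d p. ?g t)"
    unfolding \<xi>_def
  proof (intro sum.cong refl)
    fix t assume "t \<in> {..d p}"
    then have "Suc (d p) - t = d p - t + 1"
      by simp
    then show "\<phi> p ((e ^^ (d p - t)) (e v)) *s (e ^^ (t + (d q - a))) (w q) = ?g t"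
      using pow_pow[of "d p - t" 1 v] by (simp only: funpow_0 One_nat_def funpow.simps comp_id)
  qed
  also have "\<dots> = (\<Sum>t\<le>Suc (d p). ?g t)"
  proof -
    have "(e ^^ (Suc (d p) + (d q - a))) (w q) = 0"
      using assms by (intro pow_w_0) auto
    then show ?thesis
      by (simp only: sum.atMost_Suc scale_zero_right add_0_right)
  qed
  also have "\<dots> = ?g 0 + (\<Sum>t\<le>d p. ?g (Suc t))"
    by (rule sum.atMost_Suc_shift)
  also have "?g 0 = 0"
    unfolding diff_zero \<phi>_pow[OF assms(1)] by (rule scale_zero_left)
  also have "0 + (\<Sum>t\<le>d p. ?g (Suc t)) = e (\<xi> p q a v)"
  proof -
    have "e (\<xi> p q a v) = (\<Sum>t\<le>d p. e (\<phi> p ((e ^^ (d p - t)) v) *s (e ^^ (t + (d q - a))) (w q)))"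
      using pow_sum[of 1] by (simp only: \<xi>_def One_nat_def funpow.simps comp_apply id_apply)
    then show ?thesis
      by (simp only: e_scale diff_Suc_Suc add_Suc funpow.simps comp_apply add_0)
  qed
  finally show "\<xi> p q a (e v) = e (\<xi> p q a v)" .
qed

lemma \<xi>_w:
  assumes "p < k" and "i < k"
  shows "\<xi> p q a (w i) = (if i = p then (e ^^ (d q - a)) (w q) else 0)"
proof -
  have *: "\<phi> p ((e ^^ (d p - t)) (w i)) *s (e ^^ (t + (d q - a))) (w q) =
      (if t = 0 then (if i = p then (e ^^ (d q - a)) (w q) else 0) else 0)" if "t \<in> {..d p}" for t
  proof -
    have "d p - t = d p \<longleftrightarrow> t = 0"
      using that by auto
    then show ?thesis
      unfolding \<phi>_w[OF assms] by (cases "i = p"; cases "t = 0") (simp_all add: eq_commute[of p])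
  qed
  have "\<xi> p q a (w i) = (\<Sum>t\<le>d p. if t = 0 then (if i = p then (e ^^ (d q - a)) (w q) else 0) else 0)"
    unfolding \<xi>_def by (intro sum.cong refl *)
  then show ?thesis
    by simp
qed

lemma coef_\<xi>:
  assumes "p < k" and "q < k" and "i < k" and "j < k" and "a \<le> d q"
  shows "coef (\<xi> p q a) i j a' = (if i = p \<and> j = q \<and> a' = a then 1 else 0)"
proof (cases "i = p")
  case True
  have "a' + (d q - a) = d q \<longleftrightarrow> a' = a"
    using assms(5) by auto
  moreover have "coef (\<xi> p q a) i j a' = \<phi> j ((e ^^ (a' + (d q - a))) (w q))"
    unfolding coef_def \<xi>_w[OF assms(1,3)] if_P[OF True] pow_pow ..
  ultimately show ?thesis
    unfolding \<phi>_w[OF assms(4,2)] using True by auto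
next
  case False
  then show ?thesis
    unfolding coef_def \<xi>_w[OF assms(1,3)] by (simp only: if_False pow_0 \<phi>_0[OF assms(4)] simp_thms)
qed

definition \<Xi> :: "(nat \<times> nat \<times> nat) set" where
  "\<Xi> = {(p, q, a). p < k \<and> q < k \<and> a \<le> min (d p) (d q)}"

definition basis :: "nat \<times> nat \<times> nat \<Rightarrow> 'v \<Rightarrow> 'v" where
  "basis = (\<lambda>(p, q, a). \<xi> p q a)"

definition coord :: "nat \<times> nat \<times> nat \<Rightarrow> ('v \<Rightarrow> 'v) \<Rightarrow> 'f" where
  "coord = (\<lambda>(p, q, a) x. coef x p q a)"

lemma \<Xi>_Sigma: "\<Xi> = Sigma {..<k} (\<lambda>p. Sigma {..<k} (\<lambda>q. {..min (d p) (d q)}))"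
  by (auto simp: \<Xi>_def)

lemma finite_\<Xi>: "finite \<Xi>"
  unfolding \<Xi>_Sigma by (intro finite_SigmaI finite_lessThan finite_atMost)

lemma basis_cent: "u \<in> \<Xi> \<Longrightarrow> basis u \<in> cent"
  by (auto simp: \<Xi>_def basis_def intro!: \<xi>_cent)

lemma coord_add: "u \<in> \<Xi> \<Longrightarrow> coord u (x + y) = coord u x + coord u y"
  and coord_scale: "u \<in> \<Xi> \<Longrightarrow> coord u (fun_scale s c x) = c * coord u x"
  and coord_sum: "u \<in> \<Xi> \<Longrightarrow> coord u (\<Sum>l\<in>I. f l) = (\<Sum>l\<in>I. coord u (f l))"
  unfolding coord_def \<Xi>_def by (auto simp only: split_beta mem_Collect_eq prod.sel coef_add coef_scale coef_sum)

lemma coord_basis: "u \<in> \<Xi> \<Longrightarrow> v \<in> \<Xi> \<Longrightarrow> coord u (basis v) = (if u = v then 1 else 0)"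
  by (cases u; cases v) (simp add: coord_def basis_def \<Xi>_def coef_\<xi>)

lemma cent_eqI:
  assumes "x \<in> cent" and "y \<in> cent" and "\<And>i. i < k \<Longrightarrow> x (w i) = y (w i)"
  shows "x = y"
proof
  fix v
  have *: "x v = (\<Sum>i<k. \<Sum>t\<le>d i. \<phi> i ((e ^^ (d i - t)) v) *s (e ^^ t) (x (w i)))" if "x \<in> cent" for x
    using arg_cong[OF expand[of v], of x] by (simp only: cent_sum[OF that] cent_scale[OF that] cent_pow[OF that])
  show "x v = y v"
    unfolding *[OF assms(1)] *[OF assms(2)] by (intro sum.cong refl) (simp only: assms(3) lessThan_iff)
qed

lemma cent_expand:
  assumes x: "x \<in> cent"
  shows "x = (\<Sum>u\<in>\<Xi>. fun_scale s (coord u x) (basis u))"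
proof (rule cent_eqI[OF x])
  show "(\<Sum>u\<in>\<Xi>. fun_scale s (coord u x) (basis u)) \<in> cent"
    by (intro cent_closed basis_cent)
  fix i assume i: "i < k"
  have "(\<Sum>u\<in>\<Xi>. fun_scale s (coord u x) (basis u)) (w i) = (\<Sum>u\<in>\<Xi>. coord u x *s basis u (w i))"
    by (simp only: sum_fun_apply fun_scale_def)
  also have "\<dots> = (\<Sum>p<k. \<Sum>q<k. \<Sum>a\<le>min (d p) (d q). coef x p q a *s \<xi> p q a (w i))"
    unfolding \<Xi>_Sigma
    by (simp only: sum_Sigma_pairs finite_lessThan finite_atMost finite_SigmaI coord_def basis_def prod.case)
  also have "\<dots> = (\<Sum>p<k. if p = i then (\<Sum>q<k. \<Sum>a\<le>min (d i) (d q). coef x i q a *s (e ^^ (d q - a)) (w q)) else 0)"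
  proof (intro sum.cong refl)
    fix p assume "p \<in> {..<k}"
    then have p: "p < k"
      by simp
    show "(\<Sum>q<k. \<Sum>a\<le>min (d p) (d q). coef x p q a *s \<xi> p q a (w i)) =
        (if p = i then (\<Sum>q<k. \<Sum>a\<le>min (d i) (d q). coef x i q a *s (e ^^ (d q - a)) (w q)) else 0)"
      unfolding \<xi>_w[OF p i] by (cases "p = i") (simp_all only: simp_thms if_True if_False scale_zero_right sum.neutral_const eq_commute[of i])
  qed
  also have "\<dots> = (\<Sum>q<k. \<Sum>a\<le>min (d i) (d q). coef x i q a *s (e ^^ (d q - a)) (w q))"
    using i by simp
  also have "\<dots> = (\<Sum>q<k. \<Sum>t\<le>d q. \<phi> q ((e ^^ (d q - t)) (x (w i))) *s (e ^^ t) (w q))"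
  proof (rule sum.cong[OF refl])
    fix q assume "q \<in> {..<k}"
    then have q: "q < k"
      by simp
    \<comment> \<open>The coefficients added here vanish because \<open>x\<close> commutes with
      \<open>e\<close>, which limits the height of \<open>x (w i)\<close>.\<close>
    have "(\<Sum>a\<le>min (d i) (d q). coef x i q a *s (e ^^ (d q - a)) (w q)) = (\<Sum>a\<le>d q. coef x i q a *s (e ^^ (d q - a)) (w q))"
    proof (intro sum.mono_neutral_left)
      show "\<forall>a\<in>{..d q} - {..min (d i) (d q)}. coef x i q a *s (e ^^ (d q - a)) (w q) = 0"
      proof
        fix a assume "a \<in> {..d q} - {..min (d i) (d q)}"
        then have "coef x i q a = 0"
          by (intro coef_eq_0[OF x i q]) auto
        then show "coef x i q a *s (e ^^ (d q - a)) (w q) = 0"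
          by (simp only: scale_zero_left)
      qed
    qed auto
    also have "\<dots> = (\<Sum>t\<le>d q. coef x i q (d q - t) *s (e ^^ (d q - (d q - t))) (w q))"
      by (rule sum.nat_diff_reindex[symmetric, of "\<lambda>a. coef x i q a *s (e ^^ (d q - a)) (w q)" "Suc (d q)", unfolded lessThan_Suc_atMost diff_Suc_Suc])
    also have "\<dots> = (\<Sum>t\<le>d q. \<phi> q ((e ^^ (d q - t)) (x (w i))) *s (e ^^ t) (w q))"
      by (intro sum.cong refl) (simp only: coef_def atMost_iff diff_diff_cancel)
    finally show "(\<Sum>a\<le>min (d i) (d q). coef x i q a *s (e ^^ (d q - a)) (w q)) =
      (\<Sum>t\<le>d q. \<phi> q ((e ^^ (d q - t)) (x (w i))) *s (e ^^ t) (w q))" .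
  qed
  also have "\<dots> = x (w i)"
    by (rule expand[symmetric])
  finally show "x (w i) = (\<Sum>u\<in>\<Xi>. fun_scale s (coord u x) (basis u)) (w i)"
    by (rule sym)
qed

lemma coef_comp_\<xi>:
  assumes "x \<in> cent" and "p < k" and "i < k" and "j < k"
  shows "coef (x \<circ> \<xi> p q a) i j 0 = (if i = p then coef x q j (d q - a) else 0)"
proof (cases "i = p")
  case True
  then have "\<xi> p q a (w i) = (e ^^ (d q - a)) (w q)"
    unfolding \<xi>_w[OF assms(2,3)] by (rule if_P)
  then show ?thesis
    using True by (simp only: coef_def comp_apply cent_pow[OF assms(1)] if_True funpow_0 simp_thms)
next
  case False
  then show ?thesis
    by (simp only: coef_def comp_apply \<xi>_w[OF assms(2,3)] if_False funpow_0 cent_0[OF assms(1)] \<phi>_0[OF assms(4)])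
qed

lemma coef_\<xi>_comp:
  assumes "p < k" and "q < k" and "j < k" and a: "a \<le> min (d p) (d q)"
  shows "coef (\<xi> p q a \<circ> x) i j 0 = (if j = q then coef x i p (d p - a) else 0)"
proof -
  have "coef (\<xi> p q a \<circ> x) i j 0 =
      (\<Sum>t\<le>d p. \<phi> p ((e ^^ (d p - t)) (x (w i))) * \<phi> j ((e ^^ (t + (d q - a))) (w q)))"
    by (simp only: coef_def comp_apply funpow_0 \<xi>_def \<phi>_sum[OF assms(3)] \<phi>_scale[OF assms(3)])
  also have "\<dots> = (\<Sum>t\<le>d p. if t = a then (if j = q then coef x i p (d p - a) else 0) else 0)"
  proof (intro sum.cong refl)
    fix t
    have "t + (d q - a) = d q \<longleftrightarrow> t = a"
      using a by auto
    then show "\<phi> p ((e ^^ (d p - t)) (x (w i))) * \<phi> j ((e ^^ (t + (d q - a))) (w q)) =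
        (if t = a then (if j = q then coef x i p (d p - a) else 0) else 0)"
      unfolding \<phi>_w[OF assms(3,2)] coef_def by (cases "j = q"; cases "t = a") simp_all
  qed
  also have "\<dots> = (if j = q then coef x i p (d p - a) else 0)"
    using a by simp
  finally show ?thesis .
qed

lemma coef_commutator:
  assumes "x \<in> cent" and "p < k" and "q < k" and "a \<le> min (d p) (d q)" and "i < k" and "j < k"
  shows "coef (commutator x (\<xi> p q a)) i j 0 =
    (if i = p then coef x q j (d q - a) else 0) - (if j = q then coef x i p (d p - a) else 0)"
  unfolding commutator_def coef_diff[OF assms(6)] coef_comp_\<xi>[OF assms(1,2,5,6)] coef_\<xi>_comp[OF assms(2,3,6,4)] ..

text \<open>
  Diagonal, subdiagonal and superdiagonal weights \<open>M\<close> are modelled on the case \<open>e = 0\<close>, where such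
  functionals form the image of an irreducible representation of \<open>\<ss>\<ll>\<^sub>2\<close>, whose nonzero elements are
  all regular.
\<close>

definition functional :: "(nat \<Rightarrow> nat \<Rightarrow> 'f) \<Rightarrow> ('v \<Rightarrow> 'v) \<Rightarrow> 'f" where
  "functional M x = (if x \<in> cent then \<Sum>i<k. \<Sum>j<k. M i j * coef x i j 0 else 0)"

lemma functional_add:
  assumes "x \<in> cent" and "y \<in> cent"
  shows "functional M (x + y) = functional M x + functional M y"
proof -
  have "(\<Sum>i<k. \<Sum>j<k. M i j * coef (x + y) i j 0) = (\<Sum>i<k. \<Sum>j<k. M i j * coef x i j 0 + M i j * coef y i j 0)"
    by (intro sum.cong refl) (simp only: coef_add lessThan_iff distrib_left)
  then show ?thesis
    unfolding functional_def using assms E.subspace_add[OF subspace_cent assms] by (simp only: if_True sum.distrib)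
qed

lemma functional_scale:
  assumes "x \<in> cent"
  shows "functional M (fun_scale s c x) = c * functional M x"
proof -
  have "(\<Sum>i<k. \<Sum>j<k. M i j * coef (fun_scale s c x) i j 0) = (\<Sum>i<k. \<Sum>j<k. c * (M i j * coef x i j 0))"
    by (intro sum.cong refl) (simp only: coef_scale lessThan_iff mult.left_commute)
  then show ?thesis
    unfolding functional_def using assms E.subspace_scale[OF subspace_cent assms] by (simp only: if_True sum_distrib_left)
qed

lemma functional_dual: "functional M \<in> dual (fun_scale s) cent"
  unfolding dual_def using functional_add functional_scale by (auto simp: functional_def)

lemma functional_commutator:
  assumes x: "x \<in> cent" and p: "p < k" and q: "q < k" and a: "a \<le> min (d p) (d q)"
  shows "functional M (commutator x (\<xi> p q a)) =
    (\<Sum>j<k. M p j * coef x q j (d q - a)) - (\<Sum>i<k. M i q * coef x i p (d p - a))"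
proof -
  let ?l = "\<lambda>i j. if i = p then M p j * coef x q j (d q - a) else 0"
  let ?r = "\<lambda>i j. if j = q then M i q * coef x i p (d p - a) else 0"
  have "functional M (commutator x (\<xi> p q a)) = (\<Sum>i<k. \<Sum>j<k. M i j * coef (commutator x (\<xi> p q a)) i j 0)"
    unfolding functional_def using commutator_cent[OF x \<xi>_cent[OF p q a]] by (simp only: if_True)
  also have "\<dots> = (\<Sum>i<k. \<Sum>j<k. ?l i j - ?r i j)"
    by (intro sum.cong refl) (simp add: coef_commutator[OF x p q a] right_diff_distrib)
  also have "\<dots> = (\<Sum>i<k. \<Sum>j<k. ?l i j) - (\<Sum>i<k. \<Sum>j<k. ?r i j)"
    by (simp only: sum_subtractf)
  also have "(\<Sum>i<k. \<Sum>j<k. ?l i j) = (\<Sum>j<k. \<Sum>i<k. ?l i j)"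
    by (rule sum.swap)
  also have "\<dots> = (\<Sum>j<k. M p j * coef x q j (d q - a))"
    using p by simp
  also have "(\<Sum>i<k. \<Sum>j<k. ?r i j) = (\<Sum>i<k. M i q * coef x i p (d p - a))"
    using q by simp
  finally show ?thesis .
qed

text \<open>The weights \<open>j + 1\<close> are nonzero and pairwise distinct in characteristic
  zero; \<open>nondegenerate_diag\<close> uses both properties.\<close>

definition diag :: "nat \<Rightarrow> nat \<Rightarrow> 'f" where "diag i j = (if i = j then of_nat (Suc j) else 0)"
definition sub :: "nat \<Rightarrow> nat \<Rightarrow> 'f" where "sub i j = (if i = Suc j then 1 else 0)"
definition super :: "nat \<Rightarrow> nat \<Rightarrow> 'f" where "super i j = (if j = Suc i then 1 else 0)"

lemma diag_commutator:
  assumes "x \<in> cent" and "p < k" and "q < k" and "a \<le> min (d p) (d q)"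
  shows "functional diag (commutator x (\<xi> p q a)) =
    of_nat (Suc p) * coef x q p (d q - a) - of_nat (Suc q) * coef x q p (d p - a)"
proof -
  have "(\<Sum>j<k. diag p j * coef x q j (d q - a)) = (\<Sum>j<k. if j = p then of_nat (Suc p) * coef x q p (d q - a) else 0)"
    by (intro sum.cong) (auto simp: diag_def)
  moreover have "(\<Sum>i<k. diag i q * coef x i p (d p - a)) = (\<Sum>i<k. if i = q then of_nat (Suc q) * coef x q p (d p - a) else 0)"
    by (intro sum.cong) (auto simp: diag_def)
  ultimately show ?thesis
    unfolding functional_commutator[OF assms] using assms(2,3) by simp
qed

lemma sub_commutator:
  assumes "x \<in> cent" and "p < k" and "q < k" and "a \<le> min (d p) (d q)"
  shows "functional sub (commutator x (\<xi> p q a)) =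
    (if p = 0 then 0 else coef x q (p - 1) (d q - a)) - (if Suc q < k then coef x (Suc q) p (d p - a) else 0)"
proof -
  have "(\<Sum>j<k. sub p j * coef x q j (d q - a)) = (\<Sum>j<k. if j = p - 1 then if p = 0 then 0 else coef x q (p - 1) (d q - a) else 0)"
    by (intro sum.cong) (auto simp: sub_def)
  moreover have "(\<Sum>i<k. sub i q * coef x i p (d p - a)) = (\<Sum>i<k. if i = Suc q then coef x (Suc q) p (d p - a) else 0)"
    by (intro sum.cong) (auto simp: sub_def)
  moreover have "p - 1 < k"
    using assms(2) by simp
  ultimately show ?thesis
    unfolding functional_commutator[OF assms] by simp
qed

lemma super_commutator:
  assumes "x \<in> cent" and "p < k" and "q < k" and "a \<le> min (d p) (d q)"
  shows "functional super (commutator x (\<xi> p q a)) =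
    (if Suc p < k then coef x q (Suc p) (d q - a) else 0) - (if q = 0 then 0 else coef x (q - 1) p (d p - a))"
proof -
  have "(\<Sum>j<k. super p j * coef x q j (d q - a)) = (\<Sum>j<k. if j = Suc p then coef x q (Suc p) (d q - a) else 0)"
    by (intro sum.cong) (auto simp: super_def)
  moreover have "(\<Sum>i<k. super i q * coef x i p (d p - a)) = (\<Sum>i<k. if i = q - 1 then if q = 0 then 0 else coef x (q - 1) p (d p - a) else 0)"
    by (intro sum.cong) (auto simp: super_def)
  moreover have "q - 1 < k"
    using assms(3) by simp
  ultimately show ?thesis
    unfolding functional_commutator[OF assms] by simp
qed

section \<open>Three index sets with nonvanishing principal minors\<close>

definition \<Xi>_diag :: "(nat \<times> nat \<times> nat) set" where "\<Xi>_diag = {(p, q, a)\<in>\<Xi>. p \<noteq> q}"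
definition \<Xi>_sub :: "(nat \<times> nat \<times> nat) set" where "\<Xi>_sub = {(p, q, a)\<in>\<Xi>. p \<noteq> 0}"
definition \<Xi>_super :: "(nat \<times> nat \<times> nat) set" where "\<Xi>_super = {(p, q, a)\<in>\<Xi>. q \<noteq> 0}"

text \<open>The Kirillov form of \<open>functional M\<close> is nondegenerate on the span of the
  basis elements indexed by \<open>I\<close>.\<close>

definition nondegenerate :: "(nat \<Rightarrow> nat \<Rightarrow> 'f) \<Rightarrow> (nat \<times> nat \<times> nat) set \<Rightarrow> bool" where
  "nondegenerate M I \<longleftrightarrow> (\<forall>x\<in>cent. (\<forall>u\<in>\<Xi> - I. coord u x = 0) \<longrightarrow>
    (\<forall>u\<in>I. functional M (commutator x (basis u)) = 0) \<longrightarrow> (\<forall>u\<in>\<Xi>. coord u x = 0))"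

lemma nondegenerateI:
  assumes "I = {(p, q, a)\<in>\<Xi>. P p q}"
    and "\<And>x i j a. x \<in> cent \<Longrightarrow> (\<And>i j a. i < k \<Longrightarrow> j < k \<Longrightarrow> \<not> P i j \<Longrightarrow> coef x i j a = 0) \<Longrightarrow>
      (\<And>p q a. p < k \<Longrightarrow> q < k \<Longrightarrow> a \<le> min (d p) (d q) \<Longrightarrow> P p q \<Longrightarrow> functional M (commutator x (\<xi> p q a)) = 0) \<Longrightarrow>
      i < k \<Longrightarrow> j < k \<Longrightarrow> P i j \<Longrightarrow> coef x i j a = 0"
  shows "nondegenerate M I"
  unfolding nondegenerate_def
proof (intro ballI impI)
  fix x u assume x: "x \<in> cent" and 1: "\<forall>u\<in>\<Xi> - I. coord u x = 0"
    and 2: "\<forall>u\<in>I. functional M (commutator x (basis u)) = 0" and u: "u \<in> \<Xi>"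
  have out: "coef x i j a = 0" if "i < k" "j < k" "\<not> P i j" for i j a
  proof (cases "a \<le> min (d i) (d j)")
    case True
    then have "(i, j, a) \<in> \<Xi> - I"
      using that by (simp add: assms(1) \<Xi>_def)
    then have "coord (i, j, a) x = 0"
      using 1 by blast
    then show ?thesis
      by (simp only: coord_def prod.case)
  next
    case False
    then show ?thesis
      by (intro coef_eq_0[OF x that(1,2)]) linarith
  qed
  have zero: "functional M (commutator x (\<xi> p q a)) = 0" if "p < k" "q < k" "a \<le> min (d p) (d q)" "P p q" for p q a
  proof -
    have "(p, q, a) \<in> I"
      using that by (simp add: assms(1) \<Xi>_def)
    then have "functional M (commutator x (basis (p, q, a))) = 0"
      using 2 by blast
    then show ?thesis
      by (simp only: basis_def prod.case)
  qed
  obtain p q a where pqa: "u = (p, q, a)" "p < k" "q < k"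
    using u by (auto simp: \<Xi>_def)
  have "coef x p q a = 0"
  proof (cases "P p q")
    case True
    show ?thesis
      by (rule assms(2)[OF x out zero pqa(2,3) True])
  next
    case False
    show ?thesis
      by (rule out[OF pqa(2,3) False])
  qed
  then show "coord u x = 0"
    by (simp only: coord_def pqa(1) prod.case)
qed

text \<open>Each equation relates two coefficients of the same entry whose positions differ by the
  difference of the chain lengths. If the lengths differ, descending induction on \<open>a\<close>
  starts from the vanishing high coefficients; if they agree, distinct weights give the
  claim.\<close>

lemma nondegenerate_diag: "nondegenerate diag \<Xi>_diag"
proof (rule nondegenerateI[where P = "\<lambda>p q. p \<noteq> q"])
  show "\<Xi>_diag = {(p, q, a)\<in>\<Xi>. p \<noteq> q}"
    by (rule \<Xi>_diag_def)
  fix x i j a assume x: "x \<in> cent" and i: "i < k" and j: "j < k" and ij: "i \<noteq> j"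
    and zero: "\<And>p q a. p < k \<Longrightarrow> q < k \<Longrightarrow> a \<le> min (d p) (d q) \<Longrightarrow> p \<noteq> q \<Longrightarrow> functional diag (commutator x (\<xi> p q a)) = 0"
  have eq: "of_nat (Suc j) * coef x i j (d i - b) = of_nat (Suc i) * coef x i j (d j - b)" if "b \<le> min (d i) (d j)" for b
  proof -
    have b: "b \<le> min (d j) (d i)"
      using that by simp
    show ?thesis
      using zero[OF j i b] ij diag_commutator[OF x j i b] by (metis eq_iff_diff_eq_0)
  qed
  have ne: "(of_nat (Suc j) :: 'f) \<noteq> 0" "(of_nat (Suc i) :: 'f) \<noteq> 0" "(of_nat (Suc i) :: 'f) \<noteq> of_nat (Suc j)"
    using ij by (simp_all del: of_nat_Suc)
  have claim: "coef x i j a = 0" if "b + a = Suc (min (d i) (d j))" for b a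
    using that
  proof (induction b arbitrary: a rule: less_induct)
    case (less b)
    have IH: "coef x i j a' = 0" if "a' > a" for a'
    proof (cases "a' \<le> Suc (min (d i) (d j))")
      case True
      then show ?thesis
        using less.IH[of "Suc (min (d i) (d j)) - a'" a'] less.prems that by simp
    next
      case False
      then show ?thesis
        by (intro coef_eq_0[OF x i j]) linarith
    qed
    show ?case
    proof (cases "a \<le> min (d i) (d j)")
      case False
      then show ?thesis
        by (intro coef_eq_0[OF x i j]) linarith
    next
      case a: True
      consider "d i < d j" | "d j < d i" | "d i = d j"
        by linarith
      then show ?thesis
      proof cases
        case 1
        then have "coef x i j (d j - (d i - a)) = 0" "d i - (d i - a) = a" "d i - a \<le> min (d i) (d j)"
          using a by (intro IH, auto)
        then show ?thesis
          using eq[of "d i - a"] ne(1) by simp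
      next
        case 2
        then have "coef x i j (d i - (d j - a)) = 0" "d j - (d j - a) = a" "d j - a \<le> min (d i) (d j)"
          using a by (intro IH, auto)
        then show ?thesis
          using eq[of "d j - a"] ne(2) by simp
      next
        case 3
        then have "d j - (d j - a) = a" "d j - a \<le> min (d i) (d j)"
          using a by auto
        then have "of_nat (Suc j) * coef x i j a = of_nat (Suc i) * coef x i j a"
          using eq[of "d j - a"] 3 by (simp only:)
        then show ?thesis
          using ne(3) by (metis mult_cancel_right)
      qed
    qed
  qed
  show "coef x i j a = 0"
  proof (cases "a \<le> Suc (min (d i) (d j))")
    case True
    then show ?thesis
      by (intro claim[of "Suc (min (d i) (d j)) - a"]) simp
  next
    case False
    then show ?thesis
      by (intro coef_eq_0[OF x i j]) linarith
  qed
qed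

text \<open>The equations link entry \<open>(i, j)\<close> to \<open>(i + 1, j + 1)\<close>. Entries
  with \<open>j < i\<close> are followed down to the last row, where the neighbour is missing; the
  others are followed back to row 0, which is excluded. These directions keep the index
  \<open>b\<close> admissible because \<open>d\<close> is nonincreasing.\<close>

lemma nondegenerate_sub: "nondegenerate sub \<Xi>_sub"
proof (rule nondegenerateI[where P = "\<lambda>p q. p \<noteq> 0"])
  show "\<Xi>_sub = {(p, q, a)\<in>\<Xi>. p \<noteq> 0}"
    by (rule \<Xi>_sub_def)
  fix x i j a assume x: "x \<in> cent" and i: "i < k" and j: "j < k" and i0: "i \<noteq> 0"
    and out: "\<And>i j a. i < k \<Longrightarrow> j < k \<Longrightarrow> \<not> i \<noteq> 0 \<Longrightarrow> coef x i j a = 0"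
    and zero: "\<And>p q a. p < k \<Longrightarrow> q < k \<Longrightarrow> a \<le> min (d p) (d q) \<Longrightarrow> p \<noteq> 0 \<Longrightarrow> functional sub (commutator x (\<xi> p q a)) = 0"
  have eq: "coef x q (p - 1) (d q - b) = (if Suc q < k then coef x (Suc q) p (d p - b) else 0)"
    if "p < k" "q < k" "b \<le> min (d p) (d q)" "p \<noteq> 0" for p q b
    using zero[OF that, unfolded sub_commutator[OF x that(1-3)] if_not_P[OF that(4)]]
    by (rule eq_iff_diff_eq_0[THEN iffD2])
  have lower: "coef x i j a = 0" if "m + i = k" "j < i" "i < k" for m i j a
    using that
  proof (induction m arbitrary: i j a)
    case (Suc m)
    show ?case
    proof (cases "a \<le> min (d i) (d j)")
      case True
      have "d i \<le> d (Suc j)"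
        using Suc.prems by (intro d_antimono) auto
      then have "coef x i (Suc j - 1) (d i - (d i - a)) =
          (if Suc i < k then coef x (Suc i) (Suc j) (d (Suc j) - (d i - a)) else 0)"
        using Suc.prems True by (intro eq) auto
      moreover have "coef x (Suc i) (Suc j) b = 0" if "Suc i < k" for b
        using Suc.prems that by (intro Suc.IH) auto
      ultimately show ?thesis
        using True by (simp split: if_splits)
    next
      case False
      then show ?thesis
        using Suc.prems by (intro coef_eq_0[OF x]) auto
    qed
  qed simp
  have upper: "coef x i j a = 0" if "i \<le> j" "j < k" for i j a
    using that
  proof (induction i arbitrary: j a)
    case 0
    then show ?case
      by (intro out) auto
  next
    case (Suc i)
    show ?case
    proof (cases "a \<le> min (d (Suc i)) (d j)")
      case True
      have "d j \<le> d i"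
        using Suc.prems by (intro d_antimono) auto
      then have "coef x i (j - 1) (d i - (d j - a)) =
          (if Suc i < k then coef x (Suc i) j (d j - (d j - a)) else 0)"
        using Suc.prems True by (intro eq) auto
      moreover have "coef x i (j - 1) (d i - (d j - a)) = 0"
        using Suc.prems by (intro Suc.IH) auto
      ultimately show ?thesis
        using True Suc.prems by simp
    next
      case False
      then show ?thesis
        using Suc.prems by (intro coef_eq_0[OF x]) auto
    qed
  qed
  show "coef x i j a = 0"
    using lower[of "k - i" i j a] upper[of i j a] i j by (cases "j < i") simp_all
qed

text \<open>The mirror image of \<open>nondegenerate_sub\<close>: entries with \<open>i < j\<close>
  are followed to the last column, the others back to column 0.\<close>

lemma nondegenerate_super: "nondegenerate super \<Xi>_super"
proof (rule nondegenerateI[where P = "\<lambda>p q. q \<noteq> 0"])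
  show "\<Xi>_super = {(p, q, a)\<in>\<Xi>. q \<noteq> 0}"
    by (rule \<Xi>_super_def)
  fix x i j a assume x: "x \<in> cent" and i: "i < k" and j: "j < k" and j0: "j \<noteq> 0"
    and out: "\<And>i j a. i < k \<Longrightarrow> j < k \<Longrightarrow> \<not> j \<noteq> 0 \<Longrightarrow> coef x i j a = 0"
    and zero: "\<And>p q a. p < k \<Longrightarrow> q < k \<Longrightarrow> a \<le> min (d p) (d q) \<Longrightarrow> q \<noteq> 0 \<Longrightarrow> functional super (commutator x (\<xi> p q a)) = 0"
  have eq: "(if Suc p < k then coef x q (Suc p) (d q - b) else 0) = coef x (q - 1) p (d p - b)"
    if "p < k" "q < k" "b \<le> min (d p) (d q)" "q \<noteq> 0" for p q b
    using zero[OF that, unfolded super_commutator[OF x that(1-3)] if_not_P[OF that(4)]]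
    by (rule eq_iff_diff_eq_0[THEN iffD2])
  have lower: "coef x i j a = 0" if "j \<le> i" "i < k" for i j a
    using that
  proof (induction j arbitrary: i a)
    case 0
    then show ?case
      by (intro out) auto
  next
    case (Suc j)
    show ?case
    proof (cases "a \<le> min (d i) (d (Suc j))")
      case True
      have "d i \<le> d j"
        using Suc.prems by (intro d_antimono) auto
      then have "(if Suc j < k then coef x i (Suc j) (d i - (d i - a)) else 0) = coef x (i - 1) j (d j - (d i - a))"
        using Suc.prems True by (intro eq) auto
      moreover have "coef x (i - 1) j (d j - (d i - a)) = 0"
        using Suc.prems by (intro Suc.IH) auto
      ultimately show ?thesis
        using True Suc.prems by simp
    next
      case False
      then show ?thesis
        using Suc.prems by (intro coef_eq_0[OF x]) auto
    qed
  qed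
  have upper: "coef x i j a = 0" if "m + j = k" "i < j" "j < k" for m i j a
    using that
  proof (induction m arbitrary: i j a)
    case (Suc m)
    show ?case
    proof (cases "a \<le> min (d i) (d j)")
      case True
      have "d j \<le> d (Suc i)"
        using Suc.prems by (intro d_antimono) auto
      then have "(if Suc j < k then coef x (Suc i) (Suc j) (d (Suc i) - (d j - a)) else 0) =
          coef x (Suc i - 1) j (d j - (d j - a))"
        using Suc.prems True by (intro eq) auto
      moreover have "coef x (Suc i) (Suc j) b = 0" if "Suc j < k" for b
        using Suc.prems that by (intro Suc.IH) auto
      ultimately show ?thesis
        using True by (simp split: if_splits)
    next
      case False
      then show ?thesis
        using Suc.prems by (intro coef_eq_0[OF x]) auto
    qed
  qed simp
  show "coef x i j a = 0"
    using upper[of "k - j" j i a] lower[of j i a] i j by (cases "i < j") simp_all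
qed

end

section \<open>Determinants of functions and graded determinants\<close>

lemma of_int_sign_mult: "of_int (sign \<pi>) * f = (if sign \<pi> = 1 then f else - f)" for f :: "'a::comm_ring_1"
  by (simp add: sign_def)

lemma det_fun_apply:
  fixes f :: "nat \<Rightarrow> nat \<Rightarrow> 'w \<Rightarrow> 'f::field"
  shows "det (mat r r (\<lambda>(a, b). f a b)) w = det (mat r r (\<lambda>(a, b). f a b w))"
proof -
  have "(of_int (sign \<pi>) * g) w = of_int (sign \<pi>) * g w" for \<pi> :: "nat \<Rightarrow> nat" and g :: "'w \<Rightarrow> 'f"
    unfolding of_int_sign_mult by (cases "sign \<pi> = 1") simp_all
  then show ?thesis
    unfolding det_mat_leibniz sum_fun_apply by (simp only: prod_fun_apply)
qed

lemma det_mat_scale: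
  fixes m :: "nat \<Rightarrow> nat \<Rightarrow> 'a::comm_ring_1"
  shows "det (mat r r (\<lambda>(a, b). m a b * x)) = x ^ r * det (mat r r (\<lambda>(a, b). m a b))"
proof -
  have "mat r r (\<lambda>(a, b). m a b * x) = x \<cdot>\<^sub>m mat r r (\<lambda>(a, b). m a b)"
    by (rule eq_matI) (simp_all add: mult.commute)
  then show ?thesis
    by (simp add: det_smult)
qed

text \<open>Corresponding Leibniz terms agree modulo the ideal of \<open>T\<close>, so the
  determinants do too. This turns the vanishing of a minor into a relation between the leading parts
  \<open>h\<close> of its entries.\<close>

lemma det_in_ideal_part:
  fixes f h :: "nat \<Rightarrow> nat \<Rightarrow> 'w \<Rightarrow> 'f::field"
  assumes T: "T \<subseteq> G" and h: "\<And>a b. a < r \<Longrightarrow> b < r \<Longrightarrow> h a b \<in> FS.span G"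
    and fh: "\<And>a b. a < r \<Longrightarrow> b < r \<Longrightarrow> f a b - h a b \<in> FS.span T"
    and f: "det (mat r r (\<lambda>(a, b). f a b)) = 0"
  shows "det (mat r r (\<lambda>(a, b). h a b)) \<in> ideal_part T G r"
proof -
  let ?P = "{\<pi>. \<pi> permutes {0..<r}}"
  have "of_int (sign \<pi>) * (\<Prod>i=0..<r. f i (\<pi> i)) - of_int (sign \<pi>) * (\<Prod>i=0..<r. h i (\<pi> i)) \<in> ideal_part T G r"
    if "\<pi> \<in> ?P" for \<pi>
  proof -
    have \<pi>: "\<pi> i < r" if "i < r" for i
      using permutes_in_image[of \<pi> "{0..<r}" i] \<open>\<pi> \<in> ?P\<close> that by simp
    have mem: "(\<Prod>i<r. f i (\<pi> i)) - (\<Prod>i<r. h i (\<pi> i)) \<in> ideal_part T G r"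
      by (rule prod_diff_in_ideal_part[OF T h fh]) (assumption | rule \<pi>)+
    have neg: "- g \<in> ideal_part T G r" if "g \<in> ideal_part T G r" for g
      by (rule FS.subspace_neg[OF subspace_ideal_part that])
    show ?thesis
    proof (cases "sign \<pi> = 1")
      case True
      show ?thesis
        using mem unfolding of_int_sign_mult lessThan_atLeast0 if_P[OF True] .
    next
      case False
      show ?thesis
        using neg[OF mem] unfolding of_int_sign_mult lessThan_atLeast0 if_not_P[OF False] minus_diff_minus .
    qed
  qed
  then have "(\<Sum>\<pi>\<in>?P. of_int (sign \<pi>) * (\<Prod>i=0..<r. f i (\<pi> i)) - of_int (sign \<pi>) * (\<Prod>i=0..<r. h i (\<pi> i))) \<in> ideal_part T G r"
    by (rule FS.subspace_sum[OF subspace_ideal_part])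
  then have "det (mat r r (\<lambda>(a, b). f a b)) - det (mat r r (\<lambda>(a, b). h a b)) \<in> ideal_part T G r"
    unfolding det_mat_leibniz sum_subtractf .
  then show ?thesis
    unfolding f using FS.subspace_neg[OF subspace_ideal_part] by (metis diff_0 minus_minus)
qed

text \<open>
  The nonvanishing of \<open>det B\<close> forces the degrees to add up to \<open>r / 2\<close>, so in each term of the
  Leibniz expansion an entry of degree less than \<open>1\<close> is compensated by one of degree greater
  than \<open>1\<close>, which vanishes.
\<close>

lemma det_graded:
  fixes A B C :: "nat \<Rightarrow> nat \<Rightarrow> 'a::field" and deg :: "nat \<Rightarrow> int"
  assumes A: "\<And>a b. a < r \<Longrightarrow> b < r \<Longrightarrow> A a b \<noteq> 0 \<Longrightarrow> deg a + deg b = 0"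
    and B: "\<And>a b. a < r \<Longrightarrow> b < r \<Longrightarrow> B a b \<noteq> 0 \<Longrightarrow> deg a + deg b = 1"
    and C: "\<And>a b. a < r \<Longrightarrow> b < r \<Longrightarrow> C a b \<noteq> 0 \<Longrightarrow> deg a + deg b = -1"
    and det: "det (mat r r (\<lambda>(a, b). B a b)) \<noteq> 0"
  shows "det (mat r r (\<lambda>(a, b). A a b * x + B a b * y + C a b * z)) = y ^ r * det (mat r r (\<lambda>(a, b). B a b))"
proof -
  \<comment> \<open>Every index occurs once as a row and once as a column, so all Leibniz terms have
    the same total degree.\<close>
  have perm: "(\<Sum>i=0..<r. deg i + deg (\<pi> i)) = 2 * (\<Sum>i=0..<r. deg i)" if "\<pi> permutes {0..<r}" for \<pi>
    using sum.permute[OF that, of deg] by (simp add: sum.distrib comp_def)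
  have lt: "\<pi> i < r" if "\<pi> permutes {0..<r}" "i < r" for \<pi> i
    using permutes_in_image[OF that(1), of i] that(2) by simp
  obtain \<pi>\<^sub>0 where \<pi>0: "\<pi>\<^sub>0 permutes {0..<r}" "(\<Prod>i=0..<r. B i (\<pi>\<^sub>0 i)) \<noteq> 0"
  proof (rule ccontr)
    assume "\<not> thesis"
    then have "(\<Prod>i=0..<r. B i (\<pi> i)) = 0" if "\<pi> permutes {0..<r}" for \<pi>
      using that \<open>\<And>\<pi>\<^sub>0. \<pi>\<^sub>0 permutes {0..<r} \<Longrightarrow> (\<Prod>i=0..<r. B i (\<pi>\<^sub>0 i)) \<noteq> 0 \<Longrightarrow> thesis\<close> by blast
    then have "det (mat r r (\<lambda>(a, b). B a b)) = 0"
      unfolding det_mat_leibniz by (intro sum.neutral) simp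
    then show False
      using det by contradiction
  qed
  have "deg i + deg (\<pi>\<^sub>0 i) = 1" if "i < r" for i
    using \<pi>0(2) B[OF that lt[OF \<pi>0(1) that]] that by (auto simp: prod_zero_iff)
  then have "(\<Sum>i=0..<r. deg i + deg (\<pi>\<^sub>0 i)) = int r"
    by simp
  then have total: "2 * (\<Sum>i=0..<r. deg i) = int r"
    using perm[OF \<pi>0(1)] by simp
  let ?M = "\<lambda>a b. A a b * x + B a b * y + C a b * z"
  have leibniz: "(\<Prod>i=0..<r. ?M i (\<pi> i)) = y ^ r * (\<Prod>i=0..<r. B i (\<pi> i))" if \<pi>: "\<pi> permutes {0..<r}" for \<pi>
  proof (cases "\<exists>i<r. deg i + deg (\<pi> i) > 1")
    case True
    then obtain i where i: "i < r" "deg i + deg (\<pi> i) > 1"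
      by blast
    then have "A i (\<pi> i) = 0" "B i (\<pi> i) = 0" "C i (\<pi> i) = 0"
      using A[OF i(1) lt[OF \<pi> i(1)]] B[OF i(1) lt[OF \<pi> i(1)]] C[OF i(1) lt[OF \<pi> i(1)]] by force+
    then have "(\<Prod>i=0..<r. ?M i (\<pi> i)) = 0" "(\<Prod>i=0..<r. B i (\<pi> i)) = 0"
      using i(1) by (auto intro!: prod_zero bexI[of _ i])
    then show ?thesis
      by (simp only: mult_zero_right)
  next
    case False
    have "(\<Sum>i=0..<r. 1 - (deg i + deg (\<pi> i))) = 0"
      using perm[OF \<pi>] total by (simp add: sum_subtractf)
    then have one: "deg i + deg (\<pi> i) = 1" if "i < r" for i
      using sum_nonneg_eq_0_iff[of "{0..<r}" "\<lambda>i. 1 - (deg i + deg (\<pi> i))"] False that by force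
    have "?M i (\<pi> i) = y * B i (\<pi> i)" if "i < r" for i
    proof -
      have "A i (\<pi> i) = 0" "C i (\<pi> i) = 0"
        using A[OF that lt[OF \<pi> that]] C[OF that lt[OF \<pi> that]] one[OF that] by force+
      then show ?thesis
        by (simp only: mult_zero_left add_0_left add_0_right mult.commute)
    qed
    then have "(\<Prod>i=0..<r. ?M i (\<pi> i)) = (\<Prod>i=0..<r. y * B i (\<pi> i))"
      by (intro prod.cong) auto
    then show ?thesis
      by (simp add: prod.distrib)
  qed
  show ?thesis
    unfolding det_mat_leibniz sum_distrib_left
    by (intro sum.cong refl) (simp only: leibniz mem_Collect_eq mult.left_commute)
qed

section \<open>The singular set\<close>

context jordan_basis
begin

abbreviation N :: nat where
  "N \<equiv> \<Sum>i<k. Suc (d i)"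

abbreviation cent_dual :: "(('v \<Rightarrow> 'v) \<Rightarrow> 'f) set" where
  "cent_dual \<equiv> dual (fun_scale s) cent"

abbreviation sing :: "(('v \<Rightarrow> 'v) \<Rightarrow> 'f) set" where
  "sing \<equiv> dual_sing (fun_scale s) commutator cent"

lemma card_chains: "card (Sigma {..<k} (\<lambda>i. {..d i})) = N"
  by (simp add: card_SigmaI)

text \<open>The omitted indices correspond to the positions \<open>(i, a)\<close> in the Jordan
  chains. For the first row and the first column this uses that chain 0 is a longest one.\<close>

lemma card_\<Xi>_diag: "card \<Xi> = card \<Xi>_diag + N"
  and card_\<Xi>_sub: "card \<Xi> = card \<Xi>_sub + N"
  and card_\<Xi>_super: "card \<Xi> = card \<Xi>_super + N"
proof -
  have sub: "\<Xi>_diag \<subseteq> \<Xi>" "\<Xi>_sub \<subseteq> \<Xi>" "\<Xi>_super \<subseteq> \<Xi>"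
    by (auto simp: \<Xi>_diag_def \<Xi>_sub_def \<Xi>_super_def)
  have card: "card \<Xi> = card I + N" if I: "I \<subseteq> \<Xi>" and f: "\<Xi> - I = f ` Sigma {..<k} (\<lambda>i. {..d i})" "inj f" for I and f :: "nat \<times> nat \<Rightarrow> nat \<times> nat \<times> nat"
  proof -
    have "card (\<Xi> - I) = N"
      unfolding f(1) using card_image[OF inj_on_subset[OF f(2) subset_UNIV]] card_chains by metis
    moreover have "card (\<Xi> - I) = card \<Xi> - card I" "card I \<le> card \<Xi>"
      using I finite_\<Xi> by (simp_all add: card_Diff_subset finite_subset card_mono)
    ultimately show ?thesis
      by simp
  qed
  have d0: "d q \<le> d 0" if "q < k" for q
    using that by (intro d_antimono) auto
  have "\<Xi> - \<Xi>_diag = (\<lambda>(i, a). (i, i, a)) ` Sigma {..<k} (\<lambda>i. {..d i})"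
    by (auto simp: \<Xi>_diag_def \<Xi>_def image_iff)
  then show "card \<Xi> = card \<Xi>_diag + N"
    using sub(1) by (intro card) (auto simp: inj_def)
  have "\<Xi> - \<Xi>_sub = (\<lambda>(i, a). (0, i, a)) ` Sigma {..<k} (\<lambda>i. {..d i})"
    using d0 by (auto simp: \<Xi>_sub_def \<Xi>_def image_iff intro: le_trans)
  then show "card \<Xi> = card \<Xi>_sub + N"
    using sub(2) by (intro card) (auto simp: inj_def)
  have "\<Xi> - \<Xi>_super = (\<lambda>(i, a). (i, 0, a)) ` Sigma {..<k} (\<lambda>i. {..d i})"
    using d0 by (auto simp: \<Xi>_super_def \<Xi>_def image_iff intro: le_trans)
  then show "card \<Xi> = card \<Xi>_super + N"
    using sub(3) by (intro card) (auto simp: inj_def)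
qed

lemma coordinates_exist: "\<exists>b \<psi>. coordinates s N b \<psi>"
proof -
  let ?S = "Sigma {..<k} (\<lambda>i. {..d i})"
  have fin: "finite ?S"
    by (intro finite_SigmaI finite_lessThan finite_atMost)
  obtain h where "bij_betw h {0..<card ?S} ?S"
    using ex_bij_betw_nat_finite[OF fin] ..
  then have h: "bij_betw h {..<N} ?S"
    by (simp only: card_chains atLeast0LessThan)
  have hS: "fst (h m) < k" "snd (h m) \<le> d (fst (h m))" if "m < N" for m
    using bij_betwE[OF h, rule_format, of m] that by auto
  let ?b = "\<lambda>m. (e ^^ snd (h m)) (w (fst (h m)))"
  let ?\<psi> = "\<lambda>m v. \<phi> (fst (h m)) ((e ^^ (d (fst (h m)) - snd (h m))) v)"
  have "coordinates s N ?b ?\<psi>"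
  proof (intro coordinates.intro vector_space_axioms coordinates_axioms.intro)
    fix i u v c assume "i < N"
    show "?\<psi> i (u + v) = ?\<psi> i u + ?\<psi> i v"
      by (simp only: pow_add \<phi>_add[OF hS(1)[OF \<open>i < N\<close>]])
    show "?\<psi> i (c *s v) = c * ?\<psi> i v"
      by (simp only: pow_scale \<phi>_scale[OF hS(1)[OF \<open>i < N\<close>]])
  next
    fix i j assume i: "i < N" and j: "j < N"
    have "d (fst (h i)) - snd (h i) + snd (h j) = d (fst (h i)) \<longleftrightarrow> snd (h i) = snd (h j)"
      using hS(2)[OF i] by auto
    then have "fst (h i) = fst (h j) \<and> d (fst (h i)) - snd (h i) + snd (h j) = d (fst (h i)) \<longleftrightarrow> h i = h j"
      by (simp only: prod_eq_iff)
    also have "\<dots> \<longleftrightarrow> i = j"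
      using h i j by (auto simp: bij_betw_def dest: inj_onD)
    finally show "?\<psi> i (?b j) = (if i = j then 1 else 0)"
      by (simp only: pow_pow \<phi>_w[OF hS(1)[OF i] hS(1)[OF j]])
  next
    fix v
    have "v = (\<Sum>u\<in>?S. \<phi> (fst u) ((e ^^ (d (fst u) - snd u)) v) *s (e ^^ snd u) (w (fst u)))"
      using expand[of v] by (simp only: sum_Sigma_pairs finite_lessThan finite_atMost fst_conv snd_conv)
    also have "\<dots> = (\<Sum>i<N. ?\<psi> i v *s ?b i)"
      by (rule sum.reindex_bij_betw[OF h, symmetric])
    finally show "v = (\<Sum>i<N. ?\<psi> i v *s ?b i)" .
  qed
  then show ?thesis
    by blast
qed

lemma stabiliser_dim_ge:
  assumes "\<eta> \<in> cent_dual"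
  shows "N \<le> E.dim (stabiliser commutator cent \<eta>)"
proof -
  obtain b \<psi> where "coordinates s N b \<psi>"
    using coordinates_exist by blast
  then show ?thesis
    using e_gl assms by (rule coordinates.dim_stabiliser_ge)
qed

lemma sing_dim:
  assumes "\<eta> \<in> sing"
  shows "N < E.dim (stabiliser commutator cent \<eta>)"
proof -
  have "N \<le> lie_index (fun_scale s) commutator cent"
    unfolding lie_index_def
  proof (rule cINF_greatest)
    show "cent_dual \<noteq> {}"
      using functional_dual by blast
  qed (rule stabiliser_dim_ge)
  then show ?thesis
    using assms by (auto simp: dual_sing_def)
qed

lemma dual_add: "\<eta> \<in> cent_dual \<Longrightarrow> x \<in> cent \<Longrightarrow> y \<in> cent \<Longrightarrow> \<eta> (x + y) = \<eta> x + \<eta> y"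
  and dual_scale: "\<eta> \<in> cent_dual \<Longrightarrow> x \<in> cent \<Longrightarrow> \<eta> (fun_scale s c x) = c * \<eta> x"
  and dual_outside: "\<eta> \<in> cent_dual \<Longrightarrow> x \<notin> cent \<Longrightarrow> \<eta> x = 0"
  unfolding dual_def by blast+

lemma zero_cent: "0 \<in> cent"
  by (rule E.subspace_0[OF subspace_cent])

lemma dual_0: "\<eta> \<in> cent_dual \<Longrightarrow> \<eta> 0 = 0"
  using dual_scale[OF _ zero_cent, of \<eta> 0] by (simp only: E.scale_zero_left mult_zero_left)

lemma dual_sum:
  assumes "\<eta> \<in> cent_dual" and "finite I" and "\<And>l. l \<in> I \<Longrightarrow> f l \<in> cent"
  shows "\<eta> (\<Sum>l\<in>I. fun_scale s (c l) (f l)) = (\<Sum>l\<in>I. c l * \<eta> (f l))"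
  using assms(2,3)
proof (induction I)
  case empty
  show ?case
    by (simp only: sum.empty dual_0[OF assms(1)])
next
  case (insert l I)
  have l: "f l \<in> cent" "fun_scale s (c l) (f l) \<in> cent"
    using insert.prems E.subspace_scale[OF subspace_cent] by blast+
  have "(\<Sum>l\<in>I. fun_scale s (c l) (f l)) \<in> cent"
    using insert.prems by (intro cent_closed) blast
  moreover have "\<eta> (\<Sum>l\<in>I. fun_scale s (c l) (f l)) = (\<Sum>l\<in>I. c l * \<eta> (f l))"
    by (rule insert.IH) (rule insert.prems, rule insertI2)
  ultimately show ?case
    using insert.hyps l
    by (simp only: sum.insert not_False_eq_True dual_add[OF assms(1)] dual_scale[OF assms(1)])
qed

lemma dual_expand:
  assumes "\<eta> \<in> cent_dual" and "x \<in> cent"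
  shows "\<eta> x = (\<Sum>u\<in>\<Xi>. coord u x * \<eta> (basis u))"
proof -
  have "\<eta> x = \<eta> (\<Sum>u\<in>\<Xi>. fun_scale s (coord u x) (basis u))"
    by (rule arg_cong[OF cent_expand[OF assms(2)]])
  also have "\<dots> = (\<Sum>u\<in>\<Xi>. coord u x * \<eta> (basis u))"
    by (rule dual_sum[OF assms(1) finite_\<Xi> basis_cent])
  finally show ?thesis .
qed

lemma dual_commutator_swap:
  assumes "\<eta> \<in> cent_dual" and "x \<in> cent" and "y \<in> cent"
  shows "\<eta> (commutator x y) = - \<eta> (commutator y x)"
proof -
  have "commutator x y + commutator y x = 0"
    by (simp add: commutator_def fun_eq_iff)
  then show ?thesis
    using dual_add[OF assms(1) commutator_cent[OF assms(2,3)] commutator_cent[OF assms(3,2)]] dual_0[OF assms(1)]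
    by (metis eq_neg_iff_add_eq_0)
qed

lemma dual_commutator_sum:
  fixes r :: nat
  assumes \<eta>: "\<eta> \<in> cent_dual" and x: "x \<in> cent" and f: "\<And>l. l < r \<Longrightarrow> f l \<in> cent"
  shows "\<eta> (commutator x (\<Sum>l<r. fun_scale s (c l) (f l))) = (\<Sum>l<r. \<eta> (commutator x (f l)) * c l)"
proof -
  have comm: "commutator x (\<Sum>l\<in>I. fun_scale s (c l) (f l)) = (\<Sum>l\<in>I. fun_scale s (c l) (commutator x (f l)))" for I
    by (rule ext) (simp add: commutator_def sum_fun_apply fun_scale_def cent_sum[OF x] cent_scale[OF x]
        scale_right_diff_distrib sum_subtractf)
  have "\<eta> (\<Sum>l<r. fun_scale s (c l) (commutator x (f l))) = (\<Sum>l<r. c l * \<eta> (commutator x (f l)))"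
    by (rule dual_sum[where f = "\<lambda>l. commutator x (f l)", OF \<eta> finite_lessThan]) (use commutator_cent[OF x f] in simp)
  then show ?thesis
    by (simp only: comm mult.commute)
qed

abbreviation gram :: "(('v \<Rightarrow> 'v) \<Rightarrow> 'f) \<Rightarrow> (nat \<Rightarrow> nat \<times> nat \<times> nat) \<Rightarrow> nat \<Rightarrow> nat \<Rightarrow> 'f" where
  "gram \<eta> u a b \<equiv> \<eta> (commutator (basis (u a)) (basis (u b)))"

text \<open>The span of the \<open>r\<close> basis elements and the stabiliser, of dimension more
  than \<open>N\<close>, must meet nontrivially in a space of dimension \<open>r + N\<close>. A
  common nonzero vector is a kernel vector of the Gram matrix.\<close>

lemma sing_det_eq_0:
  assumes \<eta>: "\<eta> \<in> sing" and I: "I \<subseteq> \<Xi>" and card: "card \<Xi> = r + N" and u: "bij_betw u {..<r} I"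
  shows "det (mat r r (\<lambda>(a, b). gram \<eta> u a b)) = 0"
proof -
  let ?S = "stabiliser commutator cent \<eta>"
  have \<eta>_dual: "\<eta> \<in> cent_dual"
    using \<eta> by (simp add: dual_sing_def)
  obtain B where B: "B \<subseteq> ?S" "E.independent B" "?S \<subseteq> E.span B" "card B = E.dim ?S"
    by (rule E.basis_exists)
  have "N < card B"
    using sing_dim[OF \<eta>] B(4) by simp
  then have "finite B"
    by (metis card.infinite not_less_zero)
  then obtain \<sigma> where \<sigma>: "bij_betw \<sigma> {..<card B} B"
    using ex_bij_betw_nat_finite lessThan_atLeast0 by metis
  have u\<Xi>: "u a \<in> \<Xi>" if "a < r" for a
    using bij_betwE[OF u] I that by auto
  have \<sigma>S: "\<sigma> i \<in> ?S" if "i < card B" for i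
    using bij_betwE[OF \<sigma>] B(1) that by auto
  have S_cent: "?S \<subseteq> cent"
    by (auto simp: stabiliser_def)
  define h where "h i = (if i < r then basis (u i) else \<sigma> (i - r))" for i
  have "cent \<subseteq> E.span (basis ` \<Xi>)"
  proof
    fix x assume "x \<in> cent"
    then show "x \<in> E.span (basis ` \<Xi>)"
      by (subst cent_expand, assumption) (intro E.span_sum E.span_scale E.span_base imageI)
  qed
  moreover have "h i \<in> cent" if "i < r + card B" for i
    using basis_cent[OF u\<Xi>] \<sigma>S S_cent that unfolding h_def by auto
  ultimately have span: "h i \<in> E.span (basis ` \<Xi>)" if "i < r + card B" for i
    using that by blast
  have "card (basis ` \<Xi>) < r + card B"
    using card_image_le[OF finite_\<Xi>, of basis] card \<open>N < card B\<close> by simp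
  then have "\<exists>c. (\<exists>i<r + card B. c i \<noteq> 0) \<and> (\<Sum>i<r + card B. fun_scale s (c i) (h i)) = 0"
    by (intro E.family_dependent[of "basis ` \<Xi>"] finite_imageI finite_\<Xi> span)
  then obtain c where c: "(\<exists>i<r + card B. c i \<noteq> 0) \<and> (\<Sum>i<r + card B. fun_scale s (c i) (h i)) = 0" ..
  define v where "v = (\<Sum>i<r. fun_scale s (c i) (basis (u i)))"
  define z where "z = (\<Sum>i<card B. fun_scale s (c (r + i)) (\<sigma> i))"
  have "(\<Sum>i<r. fun_scale s (c i) (h i)) = v" "(\<Sum>i<card B. fun_scale s (c (r + i)) (h (r + i))) = z"
    unfolding v_def z_def h_def by (auto intro: sum.cong)
  then have vz: "v + z = 0"
    using conjunct2[OF c] unfolding sum_lessThan_add by (simp only:)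
  have nz: "\<exists>i<r. c i \<noteq> 0"
  proof (rule ccontr)
    assume "\<not> ?thesis"
    then have zero: "c i = 0" if "i < r" for i
      using that by blast
    have "fun_scale s (c i) (basis (u i)) = 0" if "i \<in> {..<r}" for i
      using zero[of i] that by (simp only: lessThan_iff E.scale_zero_left)
    then have "v = 0"
      unfolding v_def by (intro sum.neutral ballI)
    then have z0: "(\<Sum>i<card B. fun_scale s (c (r + i)) (\<sigma> i)) = 0"
      using vz unfolding z_def by (simp only: add_0)
    have "\<sigma> ` {..<card B} = B" "inj_on \<sigma> {..<card B}"
      using \<sigma> by (auto simp: bij_betw_def)
    then have "c (r + i) = 0" if "i < card B" for i
      using E.independent_family[OF _ _ z0 that] B(2) by simp
    then have "c i = 0" if "i < r + card B" for i
      using zero that by (metis add_diff_inverse_nat nat_add_left_cancel_less)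
    then show False
      using conjunct1[OF c] by blast
  qed
  have "\<eta> (commutator (basis (u a)) v) = 0" if a: "a < r" for a
  proof -
    let ?x = "basis (u a)"
    have x: "?x \<in> cent"
      by (rule basis_cent[OF u\<Xi>[OF a]])
    have "v \<in> cent"
      unfolding v_def by (intro cent_closed basis_cent u\<Xi>) simp
    have "\<eta> (commutator ?x z) = (\<Sum>i<card B. \<eta> (commutator ?x (\<sigma> i)) * c (r + i))"
      unfolding z_def by (rule dual_commutator_sum[OF \<eta>_dual x]) (use \<sigma>S S_cent in blast)
    also have "\<dots> = 0"
    proof (intro sum.neutral ballI)
      fix i assume "i \<in> {..<card B}"
      then have i: "\<sigma> i \<in> ?S" "\<sigma> i \<in> cent"
        using \<sigma>S S_cent by auto
      then have "\<eta> (commutator (\<sigma> i) ?x) = 0"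
        using x by (auto simp: stabiliser_def)
      then show "\<eta> (commutator ?x (\<sigma> i)) * c (r + i) = 0"
        using dual_commutator_swap[OF \<eta>_dual x i(2)] by simp
    qed
    finally have "\<eta> (commutator ?x z) = 0" .
    moreover have "commutator ?x v = fun_scale s (-1) (commutator ?x z)"
    proof -
      have "v y = - z y" for y
        using fun_cong[OF vz, of y] by (simp add: eq_neg_iff_add_eq_0)
      moreover have "?x (- y) = - ?x y" for y
        using cent_scale[OF x, of "-1" y] by simp
      ultimately show ?thesis
        by (simp add: fun_eq_iff commutator_def fun_scale_def)
    qed
    moreover have "commutator ?x z \<in> cent"
      unfolding z_def using \<sigma>S S_cent
      by (intro commutator_cent[OF x] cent_closed) auto
    ultimately show ?thesis
      using dual_scale[OF \<eta>_dual, of "commutator ?x z" "-1"] by simp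
  qed
  moreover have "\<eta> (commutator (basis (u a)) v) = (\<Sum>b<r. gram \<eta> u a b * c b)" if "a < r" for a
    unfolding v_def by (rule dual_commutator_sum[OF \<eta>_dual basis_cent[OF u\<Xi>[OF that]] basis_cent[OF u\<Xi>]])
  ultimately show ?thesis
    unfolding det_mat_eq_0_iff using nz by (intro exI[of _ c]) auto
qed

lemma nondegenerate_det:
  assumes nd: "nondegenerate M I" and I: "I \<subseteq> \<Xi>" and u: "bij_betw u {..<r} I"
  shows "det (mat r r (\<lambda>(a, b). gram (functional M) u a b)) \<noteq> 0"
proof
  assume "det (mat r r (\<lambda>(a, b). gram (functional M) u a b)) = 0"
  then obtain c where c: "(\<exists>i<r. c i \<noteq> 0) \<and> (\<forall>a<r. (\<Sum>b<r. gram (functional M) u a b * c b) = 0)"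
    unfolding det_mat_eq_0_iff ..
  have u\<Xi>: "u a \<in> \<Xi>" if "a < r" for a
    using bij_betwE[OF u] I that by auto
  define x where "x = (\<Sum>b<r. fun_scale s (c b) (basis (u b)))"
  have x: "x \<in> cent"
    unfolding x_def by (intro cent_closed basis_cent u\<Xi>) simp
  have coord: "coord v x = (\<Sum>b<r. if v = u b then c b else 0)" if v: "v \<in> \<Xi>" for v
    unfolding x_def coord_sum[OF v] by (intro sum.cong refl) (simp add: coord_scale[OF v] coord_basis[OF v u\<Xi>])
  have out: "coord v x = 0" if "v \<in> \<Xi> - I" for v
  proof -
    have "v \<noteq> u b" if "b < r" for b
      using bij_betwE[OF u] that \<open>v \<in> \<Xi> - I\<close> by auto
    then show ?thesis
      using coord[of v] that by simp
  qed
  have zero: "functional M (commutator x (basis v)) = 0" if v: "v \<in> I" for v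
  proof -
    obtain a where a: "a < r" "v = u a"
      using u v by (auto simp: bij_betw_def)
    have "functional M (commutator (basis (u a)) x) = (\<Sum>b<r. gram (functional M) u a b * c b)"
      unfolding x_def by (rule dual_commutator_sum[OF functional_dual basis_cent[OF u\<Xi>[OF a(1)]] basis_cent[OF u\<Xi>]])
    also have "\<dots> = 0"
      by (rule conjunct2[OF c, THEN spec, THEN mp, OF a(1)])
    finally have "functional M (commutator (basis (u a)) x) = 0" .
    moreover have "functional M (commutator x (basis v)) = - functional M (commutator (basis (u a)) x)"
      unfolding a(2) by (rule dual_commutator_swap[OF functional_dual x basis_cent[OF u\<Xi>[OF a(1)]]])
    ultimately show ?thesis
      by (simp only: minus_zero)
  qed
  have all_out: "\<forall>v\<in>\<Xi> - I. coord v x = 0"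
    by (intro ballI out)
  have all_zero: "\<forall>v\<in>I. functional M (commutator x (basis v)) = 0"
    by (intro ballI zero)
  have imp: "(\<forall>v\<in>\<Xi> - I. coord v x = 0) \<longrightarrow> (\<forall>v\<in>I. functional M (commutator x (basis v)) = 0) \<longrightarrow>
      (\<forall>v\<in>\<Xi>. coord v x = 0)"
    using nd x unfolding nondegenerate_def by (rule bspec)
  have all: "\<forall>v\<in>\<Xi>. coord v x = 0"
    by (rule mp[OF mp[OF imp all_out] all_zero])
  have "c a = 0" if a: "a < r" for a
  proof -
    have "u a = u b \<longleftrightarrow> b = a" if "b < r" for b
      using u a that by (auto simp: bij_betw_def dest: inj_onD)
    then have "(\<Sum>b<r. if u a = u b then c b else 0) = (\<Sum>b<r. if b = a then c b else 0)"
      by (intro sum.cong) auto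
    then show ?thesis
      using coord[OF u\<Xi>[OF a]] bspec[OF all u\<Xi>[OF a]] a by simp
  qed
  then show False
    using c by blast
qed

section \<open>The grading by block numbers and coordinates on the dual\<close>

definition degree :: "nat \<times> nat \<times> nat \<Rightarrow> int" where
  "degree = (\<lambda>(p, q, a). int p - int q)"

text \<open>Degrees add under composition, and each of the three functionals sees only entries
  \<open>(i, j)\<close> with one fixed value of \<open>i - j\<close>.\<close>

lemma functional_degree:
  assumes "u \<in> \<Xi>" and "v \<in> \<Xi>"
  shows "functional diag (commutator (basis u) (basis v)) \<noteq> 0 \<Longrightarrow> degree u + degree v = 0"
    and "functional sub (commutator (basis u) (basis v)) \<noteq> 0 \<Longrightarrow> degree u + degree v = 1"
    and "functional super (commutator (basis u) (basis v)) \<noteq> 0 \<Longrightarrow> degree u + degree v = -1"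
proof -
  obtain p q a p' q' a' where uv: "u = (p, q, a)" "v = (p', q', a')"
    by (cases u; cases v)
  have *: "p < k" "q < k" "a \<le> min (d p) (d q)" "p' < k" "q' < k" "a' \<le> min (d p') (d q')" "a \<le> d q"
    using assms by (auto simp: uv \<Xi>_def)
  note x = \<xi>_cent[OF *(1-3)]
  show "degree u + degree v = 0" if "functional diag (commutator (basis u) (basis v)) \<noteq> 0"
    using that unfolding uv basis_def prod.case diag_commutator[OF x *(4-6)] coef_\<xi>[OF *(1,2,5,4,7)]
    by (auto simp: degree_def split: if_splits)
  show "degree u + degree v = 1" if "functional sub (commutator (basis u) (basis v)) \<noteq> 0"
  proof -
    have "p' - 1 < k"
      using *(4) by simp
    then show ?thesis
      using that coef_\<xi>[OF *(1,2,5) _ *(7), of "p' - 1"] coef_\<xi>[OF *(1,2) _ *(4,7), of "Suc q'"]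
      unfolding uv basis_def prod.case sub_commutator[OF x *(4-6)]
      by (auto simp: degree_def split: if_splits)
  qed
  show "degree u + degree v = -1" if "functional super (commutator (basis u) (basis v)) \<noteq> 0"
  proof -
    have "q' - 1 < k"
      using *(5) by simp
    then show ?thesis
      using that coef_\<xi>[OF *(1,2,5) _ *(7), of "Suc p'"] coef_\<xi>[OF *(1,2) _ *(4,7), of "q' - 1"]
      unfolding uv basis_def prod.case super_commutator[OF x *(4-6)]
      by (auto simp: degree_def split: if_splits)
  qed
qed

lemma functional_basis:
  assumes "(p, q, a) \<in> \<Xi>"
  shows "functional M (basis (p, q, a)) = (if a = 0 then M p q else 0)"
proof -
  have *: "p < k" "q < k" "a \<le> d q"
    using assms by (auto simp: \<Xi>_def)
  have "functional M (basis (p, q, a)) = (\<Sum>i<k. \<Sum>j<k. M i j * coef (\<xi> p q a) i j 0)"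
    using basis_cent[OF assms] by (simp add: functional_def basis_def)
  also have "\<dots> = (\<Sum>i<k. \<Sum>j<k. if j = q then if i = p then if a = 0 then M p q else 0 else 0 else 0)"
    by (intro sum.cong refl) (use * in \<open>auto simp: coef_\<xi>\<close>)
  also have "\<dots> = (if a = 0 then M p q else 0)"
    using * by simp
  finally show ?thesis .
qed

definition dual_basis :: "nat \<times> nat \<times> nat \<Rightarrow> ('v \<Rightarrow> 'v) \<Rightarrow> 'f" where
  "dual_basis u x = (if x \<in> cent then coord u x else 0)"

lemma dual_basis_dual: "u \<in> \<Xi> \<Longrightarrow> dual_basis u \<in> cent_dual"
  unfolding dual_def
  using E.subspace_add[OF subspace_cent] E.subspace_scale[OF subspace_cent]
  by (auto simp: dual_basis_def coord_add coord_scale)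

lemma dual_basis_basis: "u \<in> \<Xi> \<Longrightarrow> v \<in> \<Xi> \<Longrightarrow> dual_basis u (basis v) = (if u = v then 1 else 0)"
  by (simp add: dual_basis_def basis_cent coord_basis)

lemma dual_eq_sum:
  assumes "\<eta> \<in> cent_dual"
  shows "\<eta> = (\<Sum>u\<in>\<Xi>. fun_scale (*) (\<eta> (basis u)) (dual_basis u))"
proof
  fix x
  show "\<eta> x = (\<Sum>u\<in>\<Xi>. fun_scale (*) (\<eta> (basis u)) (dual_basis u)) x"
  proof (cases "x \<in> cent")
    case True
    then show ?thesis
      unfolding dual_expand[OF assms True] sum_fun_apply fun_scale_def dual_basis_def
      by (intro sum.cong refl) (simp add: mult.commute)
  next
    case False
    then show ?thesis
      unfolding dual_outside[OF assms False] sum_fun_apply fun_scale_def dual_basis_def by simp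
  qed
qed

lemma dim_cent_dual: "FS.dim cent_dual = card \<Xi>"
proof -
  have inj: "inj_on dual_basis \<Xi>"
  proof (rule inj_onI)
    fix u v assume uv: "u \<in> \<Xi>" "v \<in> \<Xi>" "dual_basis u = dual_basis v"
    then show "u = v"
      using dual_basis_basis[OF uv(1,1)] dual_basis_basis[OF uv(2,1)] by (metis zero_neq_one)
  qed
  have "FS.independent (dual_basis ` \<Xi>)"
  proof (rule FS.independent_if_scalars_zero)
    show "finite (dual_basis ` \<Xi>)"
      using finite_\<Xi> by (rule finite_imageI)
    fix g \<chi> assume g: "(\<Sum>\<chi>\<in>dual_basis ` \<Xi>. fun_scale (*) (g \<chi>) \<chi>) = 0" and "\<chi> \<in> dual_basis ` \<Xi>"
    then obtain v where v: "v \<in> \<Xi>" "\<chi> = dual_basis v"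
      by blast
    have "(\<Sum>u\<in>\<Xi>. g (dual_basis u) * dual_basis u (basis v)) = 0"
      using fun_cong[OF g, of "basis v"] unfolding sum.reindex[OF inj] sum_fun_apply comp_apply fun_scale_def zero_fun_apply .
    moreover have "(\<Sum>u\<in>\<Xi>. g (dual_basis u) * dual_basis u (basis v)) = (\<Sum>u\<in>\<Xi>. if u = v then g \<chi> else 0)"
      by (intro sum.cong refl) (simp add: dual_basis_basis v)
    ultimately show "g \<chi> = 0"
      using v(1) finite_\<Xi> by simp
  qed
  moreover have "dual_basis ` \<Xi> \<subseteq> cent_dual"
    using dual_basis_dual by blast
  moreover have "cent_dual \<subseteq> FS.span (dual_basis ` \<Xi>)"
  proof
    fix \<eta> assume "\<eta> \<in> cent_dual"
    then show "\<eta> \<in> FS.span (dual_basis ` \<Xi>)"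
      by (subst dual_eq_sum, assumption) (intro FS.span_sum FS.span_scale FS.span_base imageI)
  qed
  ultimately have "card (dual_basis ` \<Xi>) = FS.dim cent_dual"
    by (intro FS.basis_card_eq_dim)
  then show ?thesis
    using card_image[OF inj] by simp
qed

text \<open>
  Cutting the evaluations off outside the singular set turns its equations into identities between
  functions.
\<close>

definition ev :: "('v \<Rightarrow> 'v) \<Rightarrow> (('v \<Rightarrow> 'v) \<Rightarrow> 'f) \<Rightarrow> 'f" where
  "ev x \<eta> = (if \<eta> \<in> sing then \<eta> x else 0)"

lemma sing_dual: "\<eta> \<in> sing \<Longrightarrow> \<eta> \<in> cent_dual"
  by (simp add: dual_sing_def)

lemma ev_expand: "x \<in> cent \<Longrightarrow> ev x \<eta> = (\<Sum>u\<in>\<Xi>. coord u x * ev (basis u) \<eta>)"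
  unfolding ev_def using dual_expand[OF sing_dual] by simp

text \<open>Reflexivity in finite dimension: a linear functional on the dual is a combination of
  evaluations.\<close>

lemma linear_on_sing:
  assumes "l \<in> dual (fun_scale (*)) cent_dual"
  shows "\<exists>g\<in>FS.span ((\<lambda>u. ev (basis u)) ` \<Xi>). \<forall>\<eta>\<in>sing. l \<eta> = g \<eta>"
proof (intro bexI ballI)
  let ?g = "\<Sum>u\<in>\<Xi>. fun_scale (*) (l (dual_basis u)) (ev (basis u))"
  show "?g \<in> FS.span ((\<lambda>u. ev (basis u)) ` \<Xi>)"
    by (intro FS.span_sum FS.span_scale FS.span_base imageI)
  have sub: "FS.subspace cent_dual"
    unfolding FS.subspace_def
    using E.subspace_add[OF subspace_cent] E.subspace_scale[OF subspace_cent]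
    by (auto simp: dual_def fun_scale_def algebra_simps)
  have l_add: "l (\<eta> + \<theta>) = l \<eta> + l \<theta>" and l_scale: "l (fun_scale (*) c \<eta>) = c * l \<eta>"
    if "\<eta> \<in> cent_dual" "\<theta> \<in> cent_dual" for \<eta> \<theta> c
    using assms that unfolding dual_def[of "fun_scale (*)" cent_dual] by blast+
  have l_0: "l 0 = 0"
    using l_scale[OF FS.subspace_0[OF sub] FS.subspace_0[OF sub], of 0] by (simp only: FS.scale_zero_left mult_zero_left)
  have l_sum: "l (\<Sum>u\<in>I. fun_scale (*) (c u) (dual_basis u)) = (\<Sum>u\<in>I. c u * l (dual_basis u))"
    if "finite I" "I \<subseteq> \<Xi>" for c I
    using that
  proof (induction I)
    case empty
    show ?case
      by (simp only: sum.empty l_0)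
  next
    case (insert u I)
    have u: "dual_basis u \<in> cent_dual"
      using insert.prems by (intro dual_basis_dual) blast
    have I: "(\<Sum>u\<in>I. fun_scale (*) (c u) (dual_basis u)) \<in> cent_dual"
      using insert.prems by (intro FS.subspace_sum[OF sub] FS.subspace_scale[OF sub] dual_basis_dual) blast
    have IH: "l (\<Sum>u\<in>I. fun_scale (*) (c u) (dual_basis u)) = (\<Sum>u\<in>I. c u * l (dual_basis u))"
      using insert.prems by (intro insert.IH) blast
    show ?case
      unfolding sum.insert[OF insert.hyps] l_add[OF FS.subspace_scale[OF sub u] I] l_scale[OF u u] IH ..
  qed
  fix \<eta> assume \<eta>: "\<eta> \<in> sing"
  have "l \<eta> = (\<Sum>u\<in>\<Xi>. \<eta> (basis u) * l (dual_basis u))"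
    using arg_cong[OF dual_eq_sum[OF sing_dual[OF \<eta>]], of l] unfolding l_sum[OF finite_\<Xi> subset_refl] .
  also have "\<dots> = ?g \<eta>"
  proof -
    have "(fun_scale (*) c f) \<eta> = c * f \<eta>" for c and f :: "(('v \<Rightarrow> 'v) \<Rightarrow> 'f) \<Rightarrow> 'f"
      by (simp only: fun_scale_def)
    moreover have "ev x \<eta> = \<eta> x" for x
      by (simp only: ev_def \<eta> if_True)
    ultimately show ?thesis
      unfolding sum_fun_apply by (simp only: mult.commute)
  qed
  finally show "l \<eta> = ?g \<eta>" .
qed

lemma ev_det_eq_0:
  assumes "I \<subseteq> \<Xi>" and "card \<Xi> = r + N" and "bij_betw u {..<r} I" and "r > 0"
  shows "det (mat r r (\<lambda>(a, b). ev (commutator (basis (u a)) (basis (u b))))) = 0"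
proof
  fix \<eta>
  show "det (mat r r (\<lambda>(a, b). ev (commutator (basis (u a)) (basis (u b))))) \<eta> = 0 \<eta>"
  proof (cases "\<eta> \<in> sing")
    case True
    then show ?thesis
      unfolding det_fun_apply ev_def if_P[OF True] zero_fun_apply by (rule sing_det_eq_0[OF _ assms(1-3)])
  next
    \<comment> \<open>Outside the singular set all entries are cut off to 0. The determinant is then
      0 only because \<open>r > 0\<close>; the empty one is 1.\<close>
    case False
    have "det (mat r r (\<lambda>(a, b). 0 :: 'f)) = 0"
      unfolding det_mat_eq_0_iff using assms(4) by (intro exI[of _ "\<lambda>_. 1"]) auto
    then show ?thesis
      unfolding det_fun_apply ev_def if_not_P[OF False] zero_fun_apply .
  qed
qed

theorem krull_dim_sing_le:
  assumes k: "2 \<le> k"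
  shows "krull_dim (subtopology (zariski (fun_scale (*)) cent_dual) sing) \<le> ereal (real (card \<Xi> - 3))"
proof -
  define r where "r = card \<Xi>_diag"
  have r: "card \<Xi> = r + N" "card \<Xi>_sub = r" "card \<Xi>_super = r"
    using card_\<Xi>_diag card_\<Xi>_sub card_\<Xi>_super by (simp_all add: r_def)
  have sub: "\<Xi>_diag \<subseteq> \<Xi>" "\<Xi>_sub \<subseteq> \<Xi>" "\<Xi>_super \<subseteq> \<Xi>"
    by (auto simp: \<Xi>_diag_def \<Xi>_sub_def \<Xi>_super_def)
  \<comment> \<open>These three indices are dual to the three functionals: each functional is 1 on
    its own basis element and 0 on the other two.\<close>
  let ?a = "(0, 0, 0) :: nat \<times> nat \<times> nat"
  let ?b = "(1, 0, 0) :: nat \<times> nat \<times> nat"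
  let ?c = "(0, 1, 0) :: nat \<times> nat \<times> nat"
  have piv: "?a \<in> \<Xi>" "?b \<in> \<Xi>" "?c \<in> \<Xi>"
    using k by (auto simp: \<Xi>_def)
  have "?b \<in> \<Xi>_diag"
    using piv by (simp add: \<Xi>_diag_def)
  then have r_pos: "r > 0"
    unfolding r_def using finite_subset[OF sub(1) finite_\<Xi>] by (metis card_gt_0_iff empty_iff)
  define x where "x = ev (basis ?a)"
  define y where "y = ev (basis ?b)"
  define z where "z = ev (basis ?c)"
  let ?A = "functional diag"
  let ?B = "functional sub"
  let ?C = "functional super"
  \<comment> \<open>The restriction of evaluation at \<open>g\<close> to the span of the three
    functionals, written in the coordinates \<open>x\<close>, \<open>y\<close>,
    \<open>z\<close>.\<close>
  define part where "part g = fun_scale (*) (?A g) x + fun_scale (*) (?B g) y + fun_scale (*) (?C g) z" for g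
  \<comment> \<open>The linear forms vanishing on that span. The pivots would contribute 0 and are
    left out, which bounds the number of forms by \<open>card \<Xi> - 3\<close>.\<close>
  define T where "T = (\<lambda>u. ev (basis u) - part (basis u)) ` (\<Xi> - {?a, ?b, ?c})"
  define G where "G = {x, y, z} \<union> T"
  have cardT: "card T \<le> card \<Xi> - 3"
  proof -
    have "card T \<le> card (\<Xi> - {?a, ?b, ?c})"
      unfolding T_def using finite_\<Xi> by (intro card_image_le) simp
    also have "\<dots> = card \<Xi> - card {?a, ?b, ?c}"
      using piv finite_\<Xi> by (intro card_Diff_subset) auto
    finally show ?thesis
      by simp
  qed
  have part_apply: "part g \<eta> = ?A g * x \<eta> + ?B g * y \<eta> + ?C g * z \<eta>" for g \<eta>
    unfolding part_def plus_fun_apply fun_scale_def ..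
  have pivots: "ev (basis u) - part (basis u) = 0" if "u \<in> {?a, ?b, ?c}" for u
  proof
    fix \<eta>
    show "(ev (basis u) - part (basis u)) \<eta> = 0 \<eta>"
      using that piv
      by (auto simp: part_apply functional_basis diag_def sub_def super_def x_def y_def z_def)
  qed
  have ev_part: "ev g - part g \<in> FS.span T" if g: "g \<in> cent" for g
  proof -
    have "ev g - part g = (\<Sum>u\<in>\<Xi>. fun_scale (*) (coord u g) (ev (basis u) - part (basis u)))"
    proof
      fix \<eta>
      have *: "functional M g = (\<Sum>u\<in>\<Xi>. coord u g * functional M (basis u))" for M
        by (rule dual_expand[OF functional_dual g])
      show "(ev g - part g) \<eta> = (\<Sum>u\<in>\<Xi>. fun_scale (*) (coord u g) (ev (basis u) - part (basis u))) \<eta>"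
        unfolding sum_fun_apply fun_scale_def minus_apply part_apply ev_expand[OF g] *
          sum_distrib_right sum.distrib[symmetric] sum_subtractf[symmetric]
        by (intro sum.cong refl) (simp add: algebra_simps)
    qed
    also have "\<dots> \<in> FS.span T"
    proof (intro FS.span_sum FS.span_scale)
      fix u assume u: "u \<in> \<Xi>"
      show "ev (basis u) - part (basis u) \<in> FS.span T"
      proof (cases "u \<in> {?a, ?b, ?c}")
        case True
        show ?thesis
          unfolding pivots[OF True] by (rule FS.span_zero)
      next
        case False
        then show ?thesis
          using u unfolding T_def by (intro FS.span_base imageI) blast
      qed
    qed
    finally show ?thesis .
  qed
  have TG: "T \<subseteq> G" and xyz: "x \<in> G" "y \<in> G" "z \<in> G"
    by (auto simp: G_def)
  have part_G: "part g \<in> FS.span G" for g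
    unfolding part_def by (intro FS.span_add FS.span_scale FS.span_base xyz)
  have u\<Xi>: "u a \<in> \<Xi>" if "bij_betw u {..<r} I" "I \<subseteq> \<Xi>" "a < r" for u I a
    using bij_betwE[OF that(1)] that(2,3) by auto
  have comm: "commutator (basis (u a)) (basis (u b)) \<in> cent"
    if "bij_betw u {..<r} I" "I \<subseteq> \<Xi>" "a < r" "b < r" for u I a b
    by (intro commutator_cent basis_cent u\<Xi>[OF that(1,2)] that)
  have enum: "\<exists>u. bij_betw u {..<r} I" if "card I = r" "I \<subseteq> \<Xi>" for I
    using ex_bij_betw_nat_finite[OF finite_subset[OF that(2) finite_\<Xi>]] that(1) unfolding lessThan_atLeast0 by blast
  have pow_mem: "p ^ r \<in> ideal_part T' G r"
    if "det (mat r r (\<lambda>(a, b). h a b)) \<in> ideal_part T' G r" "D \<noteq> 0"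
      "\<And>\<eta>. det (mat r r (\<lambda>(a, b). h a b \<eta>)) = p \<eta> ^ r * D" for h p D and T'
  proof -
    have "det (mat r r (\<lambda>(a, b). h a b)) = fun_scale (*) D (p ^ r)"
      by (rule ext) (simp only: det_fun_apply that(3) fun_scale_def power_fun_apply mult.commute)
    then have "fun_scale (*) (inverse D) (fun_scale (*) D (p ^ r)) \<in> ideal_part T' G r"
      using that(1) by (simp only: FS.subspace_scale[OF subspace_ideal_part])
    then show ?thesis
      by (simp only: FS.scale_scale left_inverse[OF that(2)] FS.scale_one)
  qed
  \<comment> \<open>On \<open>\<Xi>_diag\<close> a pair of entries in \<open>y\<close> and
    \<open>z\<close> also has total degree 0, so \<open>det_graded\<close> does not apply;
    \<open>y\<close> and \<open>z\<close> are put into the ideal instead.\<close>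
  have x_mem: "x ^ r \<in> ideal_part (insert y (insert z T)) G r"
  proof -
    obtain u where u: "bij_betw u {..<r} \<Xi>_diag"
      using enum[OF _ sub(1)] r_def by blast
    let ?g = "\<lambda>a b. commutator (basis (u a)) (basis (u b))"
    have "det (mat r r (\<lambda>(a, b). fun_scale (*) (?A (?g a b)) x)) \<in> ideal_part (insert y (insert z T)) G r"
    proof (rule det_in_ideal_part)
      show "insert y (insert z T) \<subseteq> G"
        using TG xyz by blast
      show "det (mat r r (\<lambda>(a, b). ev (?g a b))) = 0"
        by (rule ev_det_eq_0[OF sub(1) r(1) u r_pos])
      fix a b assume ab: "a < r" "b < r"
      show "fun_scale (*) (?A (?g a b)) x \<in> FS.span G"
        by (intro FS.span_scale FS.span_base xyz)
      have "ev (?g a b) - part (?g a b) \<in> FS.span (insert y (insert z T))"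
        using ev_part[OF comm[OF u sub(1) ab]] FS.span_mono[of T "insert y (insert z T)"] by blast
      then have "(ev (?g a b) - part (?g a b)) + (fun_scale (*) (?B (?g a b)) y + fun_scale (*) (?C (?g a b)) z) \<in>
          FS.span (insert y (insert z T))"
        by (intro FS.span_add FS.span_scale) (auto intro: FS.span_base)
      moreover have "(ev (?g a b) - part (?g a b)) + (fun_scale (*) (?B (?g a b)) y + fun_scale (*) (?C (?g a b)) z) =
          ev (?g a b) - fun_scale (*) (?A (?g a b)) x"
        by (rule ext) (simp add: part_apply fun_scale_def)
      ultimately show "ev (?g a b) - fun_scale (*) (?A (?g a b)) x \<in> FS.span (insert y (insert z T))"
        by (simp only:)
    qed
    then show ?thesis
    proof (rule pow_mem)
      show "det (mat r r (\<lambda>(a, b). ?A (?g a b))) \<noteq> 0"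
        by (rule nondegenerate_det[OF nondegenerate_diag sub(1) u])
      show "det (mat r r (\<lambda>(a, b). fun_scale (*) (?A (?g a b)) x \<eta>)) = x \<eta> ^ r * det (mat r r (\<lambda>(a, b). ?A (?g a b)))" for \<eta>
        unfolding fun_scale_def by (rule det_mat_scale)
    qed
  qed
  have det_part: "det (mat r r (\<lambda>(a, b). part (commutator (basis (u a)) (basis (u b))))) \<in> ideal_part T G r"
    if u: "bij_betw u {..<r} I" and I: "I \<subseteq> \<Xi>" for u I
    by (rule det_in_ideal_part[OF TG part_G ev_part[OF comm[OF u I]] ev_det_eq_0[OF I r(1) u r_pos]])
  have y_mem: "y ^ r \<in> ideal_part T G r"
  proof -
    obtain u where u: "bij_betw u {..<r} \<Xi>_sub"
      using enum[OF r(2) sub(2)] by blast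
    let ?g = "\<lambda>a b. commutator (basis (u a)) (basis (u b))"
    have nz: "det (mat r r (\<lambda>(a, b). ?B (?g a b))) \<noteq> 0"
      by (rule nondegenerate_det[OF nondegenerate_sub sub(2) u])
    show ?thesis
    proof (rule pow_mem[OF det_part[OF u sub(2)] nz])
      fix \<eta>
      show "det (mat r r (\<lambda>(a, b). part (?g a b) \<eta>)) = y \<eta> ^ r * det (mat r r (\<lambda>(a, b). ?B (?g a b)))"
        unfolding part_apply
        by (rule det_graded[where deg = "\<lambda>a. degree (u a)", OF _ _ _ nz])
          (rule functional_degree[OF u\<Xi>[OF u sub(2)] u\<Xi>[OF u sub(2)]]; assumption)+
    qed
  qed
  have z_mem: "z ^ r \<in> ideal_part T G r"
  proof -
    obtain u where u: "bij_betw u {..<r} \<Xi>_super"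
      using enum[OF r(3) sub(3)] by blast
    let ?g = "\<lambda>a b. commutator (basis (u a)) (basis (u b))"
    have nz: "det (mat r r (\<lambda>(a, b). ?C (?g a b))) \<noteq> 0"
      by (rule nondegenerate_det[OF nondegenerate_super sub(3) u])
    show ?thesis
    proof (rule pow_mem[OF det_part[OF u sub(3)] nz])
      fix \<eta>
      have "det (mat r r (\<lambda>(a, b). ?A (?g a b) * x \<eta> + ?C (?g a b) * z \<eta> + ?B (?g a b) * y \<eta>)) =
          z \<eta> ^ r * det (mat r r (\<lambda>(a, b). ?C (?g a b)))"
      \<comment> \<open>Negating the degree exchanges the roles of the subdiagonal and superdiagonal
        parts.\<close>
      proof (rule det_graded[where deg = "\<lambda>a. - degree (u a)", OF _ _ _ nz])
        fix a b assume "a < r" "b < r"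
        note deg = functional_degree[OF u\<Xi>[OF u sub(3) this(1)] u\<Xi>[OF u sub(3) this(2)]]
        show "- degree (u a) + - degree (u b) = 0" if "?A (?g a b) \<noteq> 0"
          using deg(1)[OF that] by linarith
        show "- degree (u a) + - degree (u b) = 1" if "?C (?g a b) \<noteq> 0"
          using deg(3)[OF that] by linarith
        show "- degree (u a) + - degree (u b) = -1" if "?B (?g a b) \<noteq> 0"
          using deg(2)[OF that] by linarith
      qed
      then show "det (mat r r (\<lambda>(a, b). part (?g a b) \<eta>)) = z \<eta> ^ r * det (mat r r (\<lambda>(a, b). ?C (?g a b)))"
        unfolding part_apply by (simp only: add.assoc add.commute[of "?B _ * y \<eta>"])
    qed
  qed
  obtain l where l: "r = Suc l"
    using r_pos by (cases r) auto
  have eq: "Suc l * r = Suc (l + l * r)"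
    unfolding l by simp
  have "z ^ r \<in> ideal_part T G r" "y ^ r \<in> ideal_part (insert z T) G r"
    using z_mem y_mem ideal_part_mono[of T "insert z T" G r] by blast+
  moreover have "insert z T \<subseteq> G"
    using TG xyz by blast
  \<comment> \<open>Eliminating \<open>y\<close> and then \<open>z\<close> raises the exponent of
    \<open>x\<close> from \<open>r\<close> to its square and then to its cube; the successor forms
    only fit the shape of \<open>ideal_part_eliminate\<close>.\<close>
  ultimately have "(x ^ r) ^ r \<in> ideal_part (insert z T) G (Suc l * r)"
    using x_mem xyz(2) unfolding l by (intro ideal_part_eliminate)
  then have "(x ^ r) ^ r \<in> ideal_part (insert z T) G (Suc (l + l * r))"
    unfolding eq .
  then have "((x ^ r) ^ r) ^ r \<in> ideal_part T G (Suc (l + l * r) * r)"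
    by (rule ideal_part_eliminate[OF TG xyz(3) _ z_mem])
  moreover have "((x ^ r) ^ r) ^ r = x ^ (Suc (l + l * r) * r)"
    by (simp only: eq[symmetric] l[symmetric] power_mult)
  ultimately have x_mem': "x ^ (Suc (l + l * r) * r) \<in> ideal_part T G (Suc (l + l * r) * r)"
    by (simp only:)
  have "\<exists>K. monomials ({x, y, z} \<union> T) K \<subseteq> ideal_part T G K"
  proof (rule monomials_subset_ideal_part)
    fix g assume "g \<in> {x, y, z}"
    then consider "g = x" | "g = y" | "g = z"
      by blast
    then show "\<exists>a. g ^ a \<in> ideal_part T G a"
      using x_mem' y_mem z_mem by cases blast+
  qed (use TG xyz in auto)
  then obtain K where K: "monomials G K \<subseteq> ideal_part T G K"
    unfolding G_def[symmetric] ..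
  have finG: "finite G"
    unfolding G_def T_def using finite_\<Xi> by simp
  have span_G: "FS.span ((\<lambda>u. ev (basis u)) ` \<Xi>) \<subseteq> FS.span G"
  proof (rule FS.span_minimal)
    show "(\<lambda>u. ev (basis u)) ` \<Xi> \<subseteq> FS.span G"
    proof clarify
      fix p q a assume u: "(p, q, a) \<in> \<Xi>"
      let ?g = "basis (p, q, a)"
      have "(ev ?g - part ?g) + part ?g \<in> FS.span G"
        using ev_part[OF basis_cent[OF u]] FS.span_mono[OF TG] part_G[of ?g] by (intro FS.span_add) blast+
      then show "ev ?g \<in> FS.span G"
        by (simp only: diff_add_cancel)
    qed
  qed simp
  have lin: "\<exists>g\<in>FS.span G. \<forall>\<eta>\<in>sing. f \<eta> = g \<eta>" if "f \<in> dual (fun_scale (*)) cent_dual" for f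
    using linear_on_sing[OF that] span_G by blast
  have "krull_dim (subtopology (zariski (fun_scale (*)) cent_dual) sing) \<le> ereal (real (card T))"
    by (rule krull_dim_le[OF finG TG K lin])
  also have "\<dots> \<le> ereal (real (card \<Xi> - 3))"
    using cardT by simp
  finally show ?thesis .
qed

theorem codim_sing_ge_3: "codim (fun_scale (*)) cent_dual sing \<ge> 3"
proof (cases "k \<ge> 2")
  case True
  \<comment> \<open>The three pivots ensure that the truncated subtraction in
    \<open>card \<Xi> - 3\<close> is exact.\<close>
  have "{(0, 0, 0), (1, 0, 0), (0, 1, 0)} \<subseteq> \<Xi>"
    using True by (auto simp: \<Xi>_def)
  then have "card {(0 :: nat, 0 :: nat, 0 :: nat), (1, 0, 0), (0, 1, 0)} \<le> card \<Xi>"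
    by (rule card_mono[OF finite_\<Xi>])
  then have "3 \<le> card \<Xi>"
    by simp
  then have "ereal (real (card \<Xi>)) - ereal (real (card \<Xi> - 3)) = 3"
    by (simp add: of_nat_diff)
  moreover have "ereal (real (card \<Xi>)) - ereal (real (card \<Xi> - 3)) \<le> codim (fun_scale (*)) cent_dual sing"
    unfolding codim_def dim_cent_dual by (intro ereal_minus_mono order_refl krull_dim_sing_le[OF True])
  ultimately show ?thesis
    by simp
next
  case False
  then have "\<Xi>_diag = {}"
    by (auto simp: \<Xi>_diag_def \<Xi>_def)
  have "\<eta> \<notin> sing" for \<eta>
  proof
    assume "\<eta> \<in> sing"
    \<comment> \<open>With at most one Jordan block the centraliser is commutative and
      \<open>r = 0\<close>: a singular functional would make the empty determinant vanish, but it is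
      1.\<close>
    then have "det (mat 0 0 (\<lambda>(a, b). gram \<eta> (\<lambda>_. undefined) a b)) = 0"
      using card_\<Xi>_diag \<open>\<Xi>_diag = {}\<close> by (intro sing_det_eq_0[where I = "{}"]) (auto simp: bij_betw_def)
    then show False
      by (simp add: det_mat_eq_0_iff)
  qed
  then have "sing = {}"
    by blast
  then show ?thesis
    by (simp add: codim_empty)
qed

end

lemma jordan_basis_if_chains:
  fixes s :: "'f::field_char_0 \<Rightarrow> 'v::ab_group_add \<Rightarrow> 'v"
  assumes e: "nilpotent_endomorphism s e n" and J: "nilpotent_endomorphism.jordan_chains s e k d w \<phi>"
    and expand: "\<And>v. v = nilpotent_endomorphism.chain_part s e k d w \<phi> v"
  shows "jordan_basis s e k d w \<phi>"
proof -
  interpret nilpotent_endomorphism s e n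
    by (rule e)
  show ?thesis
  proof (intro jordan_basis.intro vector_space_axioms jordan_basis_axioms.intro)
    show "v = (\<Sum>i<k. \<Sum>t\<le>d i. s (\<phi> i ((e ^^ (d i - t)) v)) ((e ^^ t) (w i)))" for v
      using expand[of v] unfolding chain_part_def .
  qed (rule e_add e_scale jordan_chains_add[OF J] jordan_chains_scale[OF J] jordan_chains_antimono[OF J]
      jordan_chains_w[OF J] jordan_chains_pow_w[OF J] jordan_chains_pow[OF J]; assumption)+
qed

theorem theorem13:
  fixes s :: "'f::{alg_closed_field, field_char_0} \<Rightarrow> 'v::ab_group_add \<Rightarrow> 'v"
    and Basis :: "'v set"
    and e :: "'v \<Rightarrow> 'v"
  assumes "finite_dimensional_vector_space s Basis"
    and "vector_space.dim s (UNIV :: 'v set) \<ge> 3"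
    and "e \<in> gl s"
    and "nilpotent_endo e"
  shows "codim (fun_scale (*)) (dual (fun_scale s) (centraliser s e))
           (dual_sing (fun_scale s) commutator (centraliser s e)) \<ge> 3"
proof -
  interpret V: finite_dimensional_vector_space s Basis
    by (rule assms(1))
  obtain n where n: "e ^^ n = (\<lambda>_. 0)"
    using assms(4) unfolding nilpotent_endo_def ..
  have e: "nilpotent_endomorphism s e n"
  proof (intro nilpotent_endomorphism.intro nilpotent_endomorphism_axioms.intro V.vector_space_axioms)
    show "e (u + v) = e u + e v" and "e (s c v) = s c (e v)" and "(e ^^ n) v = 0" for u v c
      using assms(3) n by (simp_all add: mem_gl_iff[OF V.vector_space_axioms])
  qed
  obtain k d w \<phi> where "nilpotent_endomorphism.jordan_chains s e k d w \<phi>"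
    "\<forall>v. v = nilpotent_endomorphism.chain_part s e k d w \<phi> v"
    using nilpotent_endomorphism.jordan_basis_exists[OF e V.finite_Basis V.span_Basis] by blast
  then have "jordan_basis s e k d w \<phi>"
    using jordan_basis_if_chains[OF e] by blast
  then show ?thesis
    by (rule jordan_basis.codim_sing_ge_3)
qed

end
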